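(* Let the standard cone $S\approx(0,+\infty)\times S^1$ be given with the Riemannian metric $$ds^2=dr^2+\xi^2r^2d\varphi^2,\qquad (r,\varphi\bmod2\pi)\in(0,+\infty)\times S^1,$$ where $\xi>0$, i.e. the angle at the vertex of the cone equals $2\pi\xi$. If $\xi$ is not rational, then there are no closing (respectively locally, semilocally, strongly or weakly closing) ($C^\infty$) central potentials on this cone. If $\xi$ is rational, then there exist two and only two (up to additive and multiplicative constants) closing (respectively locally, semilocally, strongly or weakly closing) central potentials on the cone: the gravitational and oscillator potentials $$V_i(r)=(-1)^iAr^{i^2-2}/i+B,\qquad i=1,2,$$ where $A>0$ and $B$ are arbitrary constants. The corresponding nonsingular noncircular bounded orbits are given by periodic functions $r=r(\varphi)$ with minimal positive period $\Phi_i=2\pi/(i\xi)$. The vertex $\{0\}\times S^1$ of the cone is an attracting centre of the field for each of the potentials $V_1,V_2$.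
   Context: Let $f(r)=\xi r$ and $(a,b)=(0,+\infty)$. A central potential is a $C^\infty$ function $V=V(r)$ on $(a,b)$. A point moves on $S$ with Lagrangian $L=\frac12(\dot r^2+f^2(r)\dot\varphi^2)-V(r)$; first integrals are the energy $\frac12(\dot r^2+f^2\dot\varphi^2)+V$ and the angular momentum $K=f^2(r)\dot\varphi$. A trajectory is a solution defined on a maximal time interval; its orbit is its image in $S$; the phase trajectory is the trajectory with its velocity in $TS$. An orbit (trajectory) is circular if it is an orbit $\{r_0\}\times S^1$ of the rotation group. A circular orbit is strongly stable if on it the effective potential $V(r)+\frac{K_0^2}{2f^2(r)}$ has a nondegenerate local minimum for some $K_0\ne0$. A closed orbit is orbitally stable if the corresponding phase trajectory is orbitally stable for the restriction of the system to the level set of $K$ containing it. A trajectory (orbit) is bounded if it is defined for all $t\in\mathbb{R}$ and its image lies in a compact set $[r_1,r_2]\times S^1\subset(a,b)\times S^1$. It is singular if $K=0$ on it (i.e. $\varphi=\mathrm{const}$). Conditions on $V$: ($\exists$) there exists a nonsingular bounded noncircular orbit $\gamma$ in $S$; ($\forall$) every nonsingular bounded orbit in $S$ is closed; ($\exists$)$^{\rm loc}$ there exists a strongly stable circular orbit in $S$; ($\forall$)$^{\rm loc}$ for every strongly stable circular orbit $\{r_0\}\times S^1$ there is $\varepsilon>0$ such that every nonsingular bounded orbit contained in $[r_0-\varepsilon,r_0+\varepsilon]\times S^1$ with angular momentum in $(K_0-\varepsilon,K_0+\varepsilon)$ is closed, where $K_0$ is the angular momentum of the corresponding circular trajectory;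 ($\forall$)$^{\rm s-loc}$ every nonsingular bounded orbit in the annulus $[a',b']\times S^1$ with angular momentum $\hat K$ is closed, where $a'=\inf r|_\gamma$, $b'=\sup r|_\gamma$, $\gamma$ is the orbit from ($\exists$) and $\hat K$ is its angular momentum. $V$ is called: closing if ($\exists$) and ($\forall$) hold; locally closing if ($\exists$)$^{\rm loc}$ and ($\forall$)$^{\rm loc}$ hold; semilocally closing if ($\exists$), ($\forall$)$^{\rm loc}$ and ($\forall$)$^{\rm s-loc}$ hold; strongly (resp. weakly) closing if ($\forall$)$^{\rm loc}$ (resp. its analogue for every orbitally stable circular orbit) holds and every circle $\{r\}\times S^1$ is a strongly stable (resp. orbitally stable) circular orbit. A boundary circle is an attracting centre for a potential if the infimum of the potential is attained there (as a limit). *)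

theory Defs
  imports "HOL-Analysis.Analysis"
begin

section \<open>Central potentials and the mechanical system on the cone\<close>

text \<open>
  Potentials live on the open half-line \<^term>\<open>{0::real<..}\<close>; their values elsewhere are irrelevant.
  Since the half-line is open, the iterated derivatives there depend only on the values there,
  and the next definition is smoothness of class C-infinity.
\<close>

definition central_potential :: "(real \<Rightarrow> real) \<Rightarrow> bool" where
  "central_potential V \<longleftrightarrow> (\<forall>n. \<forall>x>0. (deriv ^^ n) V differentiable (at x))"

definition cone_profile :: "real \<Rightarrow> real \<Rightarrow> real" where
  "cone_profile \<xi> r = \<xi> * r"

definition lagrangian :: "real \<Rightarrow> (real \<Rightarrow> real) \<Rightarrow> real \<Rightarrow> real \<Rightarrow> real \<Rightarrow> real \<Rightarrow> real" where
  "lagrangian \<xi> V r \<phi> r' \<phi>' = (r'\<^sup>2 + (cone_profile \<xi> r)\<^sup>2 * \<phi>'\<^sup>2) / 2 - V r"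

text \<open>
  A point of the cone is \<^term>\<open>(\<rho>, cis \<theta>)\<close> with \<^term>\<open>\<rho> > (0::real)\<close>, the circle being the unit circle
  in the complex plane. A motion is described by its time interval \<^term>\<open>I\<close>, its radial part
  \<^term>\<open>r\<close> and a lift \<^term>\<open>\<phi>\<close> of its angular part to the real line (continuous lifts always
  exist on an interval).
  The equations of motion are the Euler--Lagrange equations of the Lagrangian.
\<close>

definition solution ::
  "real \<Rightarrow> (real \<Rightarrow> real) \<Rightarrow> real set \<Rightarrow> (real \<Rightarrow> real) \<Rightarrow> (real \<Rightarrow> real) \<Rightarrow> bool" where
  "solution \<xi> V I r \<phi> \<longleftrightarrow>
     open I \<and> is_interval I \<and> I \<noteq> {} \<and>
     (\<forall>t\<in>I. r t > 0 \<and> r differentiable (at t) \<and> \<phi> differentiable (at t) \<and>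
       ((\<lambda>s. deriv (\<lambda>v. lagrangian \<xi> V (r s) (\<phi> s) v (deriv \<phi> s)) (deriv r s))
          has_real_derivative
        deriv (\<lambda>x. lagrangian \<xi> V x (\<phi> t) (deriv r t) (deriv \<phi> t)) (r t)) (at t) \<and>
       ((\<lambda>s. deriv (\<lambda>w. lagrangian \<xi> V (r s) (\<phi> s) (deriv r s) w) (deriv \<phi> s))
          has_real_derivative
        deriv (\<lambda>x. lagrangian \<xi> V (r t) x (deriv r t) (deriv \<phi> t)) (\<phi> t)) (at t))"

definition trajectory ::
  "real \<Rightarrow> (real \<Rightarrow> real) \<Rightarrow> real set \<Rightarrow> (real \<Rightarrow> real) \<Rightarrow> (real \<Rightarrow> real) \<Rightarrow> bool" where
  "trajectory \<xi> V I r \<phi> \<longleftrightarrow>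
     solution \<xi> V I r \<phi> \<and>
     (\<forall>J r1 \<phi>1. solution \<xi> V J r1 \<phi>1 \<and> I \<subseteq> J \<and> (\<forall>t\<in>I. r1 t = r t \<and> \<phi>1 t = \<phi> t) \<longrightarrow> J = I)"

definition orbit :: "real set \<Rightarrow> (real \<Rightarrow> real) \<Rightarrow> (real \<Rightarrow> real) \<Rightarrow> (real \<times> complex) set" where
  "orbit I r \<phi> = (\<lambda>t. (r t, cis (\<phi> t))) ` I"

text \<open>
  The tangent bundle of the cone is trivialised by the coordinate velocities.
\<close>

definition phase_point ::
  "(real \<Rightarrow> real) \<Rightarrow> (real \<Rightarrow> real) \<Rightarrow> real \<Rightarrow> real \<times> complex \<times> real \<times> real" where
  "phase_point r \<phi> t = (r t, cis (\<phi> t), deriv r t, deriv \<phi> t)"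

definition has_angular_momentum ::
  "real \<Rightarrow> real set \<Rightarrow> (real \<Rightarrow> real) \<Rightarrow> (real \<Rightarrow> real) \<Rightarrow> real \<Rightarrow> bool" where
  "has_angular_momentum \<xi> I r \<phi> K \<longleftrightarrow> (\<forall>t\<in>I. (cone_profile \<xi> (r t))\<^sup>2 * deriv \<phi> t = K)"

definition effective_potential :: "real \<Rightarrow> (real \<Rightarrow> real) \<Rightarrow> real \<Rightarrow> real \<Rightarrow> real" where
  "effective_potential \<xi> V K r = V r + K\<^sup>2 / (2 * (cone_profile \<xi> r)\<^sup>2)"


section \<open>Properties of trajectories and orbits\<close>

definition annulus :: "real \<Rightarrow> real \<Rightarrow> (real \<times> complex) set" where
  "annulus r1 r2 = {r1..r2} \<times> sphere 0 1"

definition circle :: "real \<Rightarrow> (real \<times> complex) set" where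
  "circle r0 = {r0} \<times> sphere 0 1"

definition circular :: "real set \<Rightarrow> (real \<Rightarrow> real) \<Rightarrow> (real \<Rightarrow> real) \<Rightarrow> bool" where
  "circular I r \<phi> \<longleftrightarrow> (\<exists>r0. orbit I r \<phi> = circle r0)"

definition singular :: "real \<Rightarrow> real set \<Rightarrow> (real \<Rightarrow> real) \<Rightarrow> (real \<Rightarrow> real) \<Rightarrow> bool" where
  "singular \<xi> I r \<phi> \<longleftrightarrow> has_angular_momentum \<xi> I r \<phi> 0"

definition bounded_motion :: "real set \<Rightarrow> (real \<Rightarrow> real) \<Rightarrow> (real \<Rightarrow> real) \<Rightarrow> bool" where
  "bounded_motion I r \<phi> \<longleftrightarrow>
     I = UNIV \<and> (\<exists>r1 r2. 0 < r1 \<and> r1 \<le> r2 \<and> orbit I r \<phi> \<subseteq> annulus r1 r2)"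

definition closed_motion :: "real set \<Rightarrow> (real \<Rightarrow> real) \<Rightarrow> (real \<Rightarrow> real) \<Rightarrow> bool" where
  "closed_motion I r \<phi> \<longleftrightarrow>
     I = UNIV \<and> (\<exists>T>0. \<forall>t. r (t + T) = r t \<and> cis (\<phi> (t + T)) = cis (\<phi> t))"

definition nonsingular_bounded ::
  "real \<Rightarrow> (real \<Rightarrow> real) \<Rightarrow> real set \<Rightarrow> (real \<Rightarrow> real) \<Rightarrow> (real \<Rightarrow> real) \<Rightarrow> bool" where
  "nonsingular_bounded \<xi> V I r \<phi> \<longleftrightarrow>
     trajectory \<xi> V I r \<phi> \<and> \<not> singular \<xi> I r \<phi> \<and> bounded_motion I r \<phi>"

definition circular_orbit :: "real \<Rightarrow> (real \<Rightarrow> real) \<Rightarrow> real \<Rightarrow> bool" where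
  "circular_orbit \<xi> V r0 \<longleftrightarrow>
     r0 > 0 \<and> (\<exists>I r \<phi>. trajectory \<xi> V I r \<phi> \<and> orbit I r \<phi> = circle r0)"

definition nondegenerate_local_min :: "(real \<Rightarrow> real) \<Rightarrow> real \<Rightarrow> bool" where
  "nondegenerate_local_min U x \<longleftrightarrow> (\<forall>\<^sub>F y in at x. U x \<le> U y) \<and> deriv (deriv U) x \<noteq> 0"

definition strongly_stable :: "real \<Rightarrow> (real \<Rightarrow> real) \<Rightarrow> real \<Rightarrow> bool" where
  "strongly_stable \<xi> V r0 \<longleftrightarrow>
     circular_orbit \<xi> V r0 \<and>
     (\<exists>K0. K0 \<noteq> 0 \<and> nondegenerate_local_min (effective_potential \<xi> V K0) r0)"

text \<open>
  Orbital stability of a phase trajectory inside the level set of the angular momentum containing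
  it: trajectories with the same angular momentum starting close to the phase orbit exist
  for all later times and remain close to it.
\<close>

definition orbitally_stable_motion ::
  "real \<Rightarrow> (real \<Rightarrow> real) \<Rightarrow> real set \<Rightarrow> (real \<Rightarrow> real) \<Rightarrow> (real \<Rightarrow> real) \<Rightarrow> bool" where
  "orbitally_stable_motion \<xi> V I r \<phi> \<longleftrightarrow>
     (\<forall>K. has_angular_momentum \<xi> I r \<phi> K \<longrightarrow>
       (\<forall>U. open U \<and> phase_point r \<phi> ` I \<subseteq> U \<longrightarrow>
         (\<exists>W. open W \<and> phase_point r \<phi> ` I \<subseteq> W \<and>
           (\<forall>J r1 \<phi>1 t0.
              trajectory \<xi> V J r1 \<phi>1 \<and> has_angular_momentum \<xi> J r1 \<phi>1 K \<and>
              t0 \<in> J \<and> phase_point r1 \<phi>1 t0 \<in> W \<longrightarrow>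
              {t0..} \<subseteq> J \<and> (\<forall>t\<ge>t0. phase_point r1 \<phi>1 t \<in> U)))))"

definition orbitally_stable :: "real \<Rightarrow> (real \<Rightarrow> real) \<Rightarrow> real \<Rightarrow> bool" where
  "orbitally_stable \<xi> V r0 \<longleftrightarrow>
     r0 > 0 \<and>
     (\<exists>I r \<phi>. trajectory \<xi> V I r \<phi> \<and> orbit I r \<phi> = circle r0 \<and> closed_motion I r \<phi> \<and>
        orbitally_stable_motion \<xi> V I r \<phi>)"


section \<open>Closing potentials\<close>

definition cond_ex :: "real \<Rightarrow> (real \<Rightarrow> real) \<Rightarrow> bool" where
  "cond_ex \<xi> V \<longleftrightarrow> (\<exists>I r \<phi>. nonsingular_bounded \<xi> V I r \<phi> \<and> \<not> circular I r \<phi>)"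

definition cond_all :: "real \<Rightarrow> (real \<Rightarrow> real) \<Rightarrow> bool" where
  "cond_all \<xi> V \<longleftrightarrow> (\<forall>I r \<phi>. nonsingular_bounded \<xi> V I r \<phi> \<longrightarrow> closed_motion I r \<phi>)"

definition cond_ex_loc :: "real \<Rightarrow> (real \<Rightarrow> real) \<Rightarrow> bool" where
  "cond_ex_loc \<xi> V \<longleftrightarrow> (\<exists>r0. strongly_stable \<xi> V r0)"

text \<open>
  The circle of radius \<^term>\<open>r0\<close> carries two circular motions up to time shift, with opposite angular
  momenta; the condition below is required for either of them.
\<close>

definition closed_near :: "real \<Rightarrow> (real \<Rightarrow> real) \<Rightarrow> real \<Rightarrow> bool" where
  "closed_near \<xi> V r0 \<longleftrightarrow>
     (\<forall>I0 r0' \<phi>0 K0.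
        trajectory \<xi> V I0 r0' \<phi>0 \<and> orbit I0 r0' \<phi>0 = circle r0 \<and>
        has_angular_momentum \<xi> I0 r0' \<phi>0 K0 \<longrightarrow>
        (\<exists>\<epsilon>>0. \<forall>I r \<phi> K.
           nonsingular_bounded \<xi> V I r \<phi> \<and> orbit I r \<phi> \<subseteq> annulus (r0 - \<epsilon>) (r0 + \<epsilon>) \<and>
           has_angular_momentum \<xi> I r \<phi> K \<and> K \<in> {K0 - \<epsilon><..<K0 + \<epsilon>} \<longrightarrow>
           closed_motion I r \<phi>))"

definition cond_all_loc :: "real \<Rightarrow> (real \<Rightarrow> real) \<Rightarrow> bool" where
  "cond_all_loc \<xi> V \<longleftrightarrow> (\<forall>r0. strongly_stable \<xi> V r0 \<longrightarrow> closed_near \<xi> V r0)"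

definition cond_all_loc_weak :: "real \<Rightarrow> (real \<Rightarrow> real) \<Rightarrow> bool" where
  "cond_all_loc_weak \<xi> V \<longleftrightarrow> (\<forall>r0. orbitally_stable \<xi> V r0 \<longrightarrow> closed_near \<xi> V r0)"

text \<open>
  The semilocal condition refers to the orbit provided by the existence condition, so it is
  formulated for a given trajectory.
\<close>

definition cond_all_sloc ::
  "real \<Rightarrow> (real \<Rightarrow> real) \<Rightarrow> real set \<Rightarrow> (real \<Rightarrow> real) \<Rightarrow> (real \<Rightarrow> real) \<Rightarrow> bool" where
  "cond_all_sloc \<xi> V I0 r0 \<phi>0 \<longleftrightarrow>
     (\<forall>I r \<phi> K.
        nonsingular_bounded \<xi> V I r \<phi> \<and>
        orbit I r \<phi> \<subseteq> annulus (Inf (r0 ` I0)) (Sup (r0 ` I0)) \<and>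
        has_angular_momentum \<xi> I0 r0 \<phi>0 K \<and> has_angular_momentum \<xi> I r \<phi> K \<longrightarrow>
        closed_motion I r \<phi>)"

definition closing :: "real \<Rightarrow> (real \<Rightarrow> real) \<Rightarrow> bool" where
  "closing \<xi> V \<longleftrightarrow> cond_ex \<xi> V \<and> cond_all \<xi> V"

definition locally_closing :: "real \<Rightarrow> (real \<Rightarrow> real) \<Rightarrow> bool" where
  "locally_closing \<xi> V \<longleftrightarrow> cond_ex_loc \<xi> V \<and> cond_all_loc \<xi> V"

definition semilocally_closing :: "real \<Rightarrow> (real \<Rightarrow> real) \<Rightarrow> bool" where
  "semilocally_closing \<xi> V \<longleftrightarrow>
     (\<exists>I r \<phi>. nonsingular_bounded \<xi> V I r \<phi> \<and> \<not> circular I r \<phi> \<and> cond_all_sloc \<xi> V I r \<phi>) \<and>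
     cond_all_loc \<xi> V"

definition strongly_closing :: "real \<Rightarrow> (real \<Rightarrow> real) \<Rightarrow> bool" where
  "strongly_closing \<xi> V \<longleftrightarrow> cond_all_loc \<xi> V \<and> (\<forall>r0>0. strongly_stable \<xi> V r0)"

definition weakly_closing :: "real \<Rightarrow> (real \<Rightarrow> real) \<Rightarrow> bool" where
  "weakly_closing \<xi> V \<longleftrightarrow> cond_all_loc_weak \<xi> V \<and> (\<forall>r0>0. orbitally_stable \<xi> V r0)"


section \<open>The gravitational and oscillator potentials\<close>

definition bertrand_potential :: "nat \<Rightarrow> real \<Rightarrow> real \<Rightarrow> real \<Rightarrow> real" where
  "bertrand_potential i A B r = (-1) ^ i * A * r powi (int i ^ 2 - 2) / real i + B"

definition minimal_positive_period :: "(real \<Rightarrow> real) \<Rightarrow> real \<Rightarrow> bool" where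
  "minimal_positive_period g p \<longleftrightarrow>
     p > 0 \<and> (\<forall>x. g (x + p) = g x) \<and> (\<forall>q. 0 < q \<and> q < p \<longrightarrow> \<not> (\<forall>x. g (x + q) = g x))"

definition given_by :: "real set \<Rightarrow> (real \<Rightarrow> real) \<Rightarrow> (real \<Rightarrow> real) \<Rightarrow> (real \<Rightarrow> real) \<Rightarrow> bool" where
  "given_by I r \<phi> g \<longleftrightarrow> (\<lambda>t. (\<phi> t, r t)) ` I = range (\<lambda>x. (x, g x))"

text \<open>
  The infimum is taken in the extended reals, since it may be minus infinity.
\<close>

definition vertex_attracting :: "(real \<Rightarrow> real) \<Rightarrow> bool" where
  "vertex_attracting V \<longleftrightarrow>
     ((\<lambda>r. ereal (V r)) \<longlongrightarrow> (INF r\<in>{0<..}. ereal (V r))) (at_right 0)"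

end

theory Submission
  imports Defs "HOL-Real_Asymp.Real_Asymp"
begin

text \<open>
  For fixed angular momentum \<open>K\<close> and with \<open>z = 1/r\<close> and \<open>\<phi>\<close> as time, a motion becomes a
  one-dimensional oscillation in the potential \<open>P(z) = \<xi>\<^sup>2 z\<^sup>2 / 2 + \<xi>\<^sup>4 V(1/z) / K\<^sup>2\<close>. Near a
  strongly stable circle \<open>P\<close> is the square of a coordinate \<open>x\<close>, up to a constant, and the orbits are
  \<open>x = \<mu> sin \<theta>\<close>; the angular period is, up to a constant factor, the integral of
  \<open>dz/dx (\<mu> sin \<theta>)\<close> over \<open>\<theta>\<close>. If the orbits close, this period is a rational multiple of \<open>2 \<pi>\<close>; being
  continuous in \<open>\<mu>\<close>, it is constant. For \<open>\<mu>\<close> tending to 0 the frequency \<open>\<xi> sqrt (3 + r V'' / V')\<close>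
  is therefore rational, hence constant in \<open>r\<close>, and \<open>V'\<close> is a power of \<open>r\<close>. The next order in \<open>\<mu>\<close>
  gives \<open>5 P'''\<^sup>2 = 3 P'' P''''\<close>, which leaves \<open>V' = A / r\<^sup>2\<close> and \<open>V' = A r\<close>. For these two
  potentials \<open>1/r\<close>, respectively \<open>1/r\<^sup>2\<close>, is a harmonic oscillation in \<open>\<phi>\<close> of frequency \<open>\<xi>\<close>,
  respectively \<open>2 \<xi>\<close>, plus a constant.
\<close>

section \<open>Real analysis\<close>

text \<open>All five notions are reduced to local closing, so the obstacle is to find one stable
  circle. The level \<open>K^2/\<xi>^2 = r^3 V'(r)\<close> of circular motions decides: a
  noncircular bounded orbit is trapped only if \<open>r^3 V'\<close> passes upwards through its
  level, and if \<open>r^3 V'\<close> never increased, circles would lie on top of energy barriers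
  and be orbitally unstable. Closedness is available only near stable circles, so the frequency is
  at first constant on one connected component of stable radii; the power law found there persists
  at the end points, makes them stable too, and so the component is the whole half-line. The
  second-order condition alone selects the values 1 and 4 of \<open>3 + r V''/V'\<close>;
  rationality of \<open>\<xi>\<close> comes from the frequency. Motions are built by quadrature:
  time and angle are antiderivatives in a phase variable, which is then recovered by inverting the
  time function. Hence maximality of a trajectory is checked by hand, and a Gronwall estimate gives
  the uniqueness that identifies an unknown trajectory with a constructed one.\<close>

lemma increasing_diffeo:
  fixes F f :: "real \<Rightarrow> real"
  assumes d: "\<And>x. (F has_real_derivative f x) (at x)" and pos: "\<And>x. f x > 0"
  shows "strict_mono F" "inj F" "open (range F)" "is_interval (range F)"
    "\<And>x. (inv F has_real_derivative inverse (f x)) (at (F x))"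
proof -
  show sm: "strict_mono F"
    by (rule strict_monoI) (use d pos DERIV_pos_imp_increasing in blast)
  show inj: "inj F"
    using sm by (simp add: strict_mono_imp_inj_on)
  have cont: "continuous_on UNIV F"
    using d by (meson DERIV_isCont continuous_at_imp_continuous_on)
  show "open (range F)"
    unfolding open_dist
  proof (intro ballI)
    fix y assume "y \<in> range F"
    then obtain x where x: "y = F x" by auto
    have *: "F (x - 1) < F x" "F x < F (x + 1)" using sm by (auto simp: strict_mono_def)
    show "\<exists>e>0. \<forall>z. dist z y < e \<longrightarrow> z \<in> range F"
    proof (intro exI[of _ "min (F x - F (x-1)) (F (x+1) - F x)"] conjI allI impI)
      fix z assume "dist z y < min (F x - F (x-1)) (F (x+1) - F x)"
      then have "F (x - 1) \<le> z" "z \<le> F (x + 1)" by (auto simp: dist_real_def x)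
      then show "z \<in> range F"
        using IVT'[of F "x-1" z "x+1"] cont continuous_on_subset by fastforce
    qed (use * in auto)
  qed
  show "is_interval (range F)"
    using cont by (simp add: connected_continuous_image is_interval_connected_1)
  show "(inv F has_real_derivative inverse (f x)) (at (F x))" for x
    unfolding has_field_derivative_def
    by (rule has_derivative_inverse_strong[of UNIV x F "inv F" "(*) (f x)"])
      (use d[of x] pos[of x] cont inj in \<open>auto simp: has_field_derivative_def\<close>)
qed

text \<open>A slope bounded below by a positive constant forces linear growth at both ends. Applied
  to a time function this says that the motion exists for all times, applied to an angle that the
  orbit winds around forever.\<close>

lemma increasing_surj:
  fixes F f :: "real \<Rightarrow> real"
  assumes d: "\<And>x. (F has_real_derivative f x) (at x)" and "c > 0" and ge: "\<And>x. f x \<ge> c"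
  shows "range F = UNIV"
proof -
  have grow: "F y - F x \<ge> c * (y - x)" if "x \<le> y" for x y
  proof -
    have "((\<lambda>t. F t - c * t) has_real_derivative f t - c) (at t)" for t
      by (auto intro!: derivative_eq_intros d)
    then have "F x - c * x \<le> F y - c * y"
      by (intro DERIV_nonneg_imp_nondecreasing[OF that]) (metis diff_ge_0_iff_ge ge)
    then show ?thesis by (simp add: algebra_simps)
  qed
  have cont: "continuous_on A F" for A
    using d by (meson DERIV_isCont continuous_at_imp_continuous_on)
  have "y \<in> range F" for y
  proof -
    define R where "R = \<bar>y - F 0\<bar> / c"
    have R: "R \<ge> 0" "c * R = \<bar>y - F 0\<bar>" using \<open>c > 0\<close> by (auto simp: R_def)
    have "F (- R) \<le> y" "y \<le> F R" using grow[of "-R" 0] grow[of 0 R] R by auto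
    then show ?thesis using IVT'[of F "-R" y R] cont R by fastforce
  qed
  then show ?thesis by auto
qed

lemma antiderivative_exists:
  fixes f :: "real \<Rightarrow> real"
  assumes "continuous_on UNIV f"
  obtains F where "\<And>x. (F has_real_derivative f x) (at x)" "F a = b"
proof -
  have "\<exists>F. \<forall>x::real. -\<infinity> < ereal x \<longrightarrow> ereal x < \<infinity> \<longrightarrow> (F has_vector_derivative f x) (at x)"
    by (rule einterval_antiderivative) (use assms in \<open>auto simp: continuous_on_eq_continuous_at\<close>)
  then obtain F where F: "\<And>x. (F has_real_derivative f x) (at x)"
    by (auto simp: has_real_derivative_iff_has_vector_derivative)
  have "((\<lambda>x. F x + (b - F a)) has_real_derivative f x) (at x)" for x
    by (auto intro!: derivative_eq_intros F)
  then show ?thesis by (rule that) simp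
qed

text \<open>Energy conservation: as long as the point has not moved back below \<open>r t0\<close>,
  the potential has not risen, so the speed cannot drop below its initial value; a velocity that
  never falls to half of that value gives unbounded linear growth.\<close>

lemma escape_above:
  fixes r h U :: "real \<Rightarrow> real"
  assumes d: "\<And>t. (r has_real_derivative h t) (at t)" and c: "continuous_on UNIV h"
    and e: "\<And>t. (h t)\<^sup>2 / 2 + U (r t) = E" and v: "h t0 > 0"
    and U: "\<And>y. y \<ge> r t0 \<Longrightarrow> U y \<le> U (r t0)"
  shows "\<exists>t. r t > b"
proof -
  define v where "v = h t0"
  have "v > 0" using assms by (simp add: v_def)
  have *: "h t > v / 2" if "t \<ge> t0" for t
  proof (rule ccontr)
    assume "\<not> h t > v / 2"
    \<comment> \<open>Times at which the speed has fallen to half its value. The infimum is the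
      first such time; up to it the velocity is nonnegative, so the radius has not decreased and the
      energy balance still gives full speed, a contradiction.\<close>
    define S where "S = {s\<in>{t0..t}. h s \<le> v / 2}"
    have "S \<noteq> {}" using \<open>\<not> h t > v / 2\<close> that by (auto simp: S_def)
    have "S = {t0..t} \<inter> h -` {..v/2}" by (auto simp: S_def)
    then have "closed S"
      using continuous_closed_preimage[of "{t0..t}" h "{..v/2}"] c continuous_on_subset by auto
    have bd: "bdd_below S" by (auto simp: S_def bdd_below_def)
    define s where "s = Inf S"
    have s: "s \<in> S" unfolding s_def using closed_contains_Inf \<open>S \<noteq> {}\<close> \<open>closed S\<close> bd by blast
    obtain x where x: "t0 \<le> x" "x \<le> s" "h x = v / 2"
      using IVT2'[of h s "v/2" t0] s v c continuous_on_subset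
      by (fastforce simp: S_def v_def)
    have "x \<in> S" using x s by (auto simp: S_def)
    then have "s \<le> x" unfolding s_def using bd by (simp add: cInf_lower)
    with x have hs: "h s = v / 2" by auto
    have h0: "h y \<ge> 0" if "t0 \<le> y" "y \<le> s" for y
    proof (rule ccontr)
      assume "\<not> h y \<ge> 0"
      then have "h y < v / 2" using \<open>v > 0\<close> by linarith
      then have "y \<in> S" using that s by (auto simp: S_def)
      then have "s \<le> y" unfolding s_def using bd by (simp add: cInf_lower)
      then have "y = s" using that by auto
      with hs \<open>\<not> h y \<ge> 0\<close> \<open>v > 0\<close> show False by simp
    qed
    have "r t0 \<le> r s"
    proof (rule DERIV_nonneg_imp_nondecreasing[of t0 s r])
      show "t0 \<le> s" using s by (simp add: S_def)
      show "\<exists>y. (r has_real_derivative y) (at x) \<and> 0 \<le> y" if "t0 \<le> x" "x \<le> s" for x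
        using d[of x] h0[OF that] by blast
    qed
    then have "U (r s) \<le> U (r t0)" by (rule U)
    moreover have "(h s)\<^sup>2 / 2 + U (r s) = v\<^sup>2 / 2 + U (r t0)" using e by (simp add: v_def)
    ultimately have "(v/2)\<^sup>2 \<ge> v\<^sup>2" using hs by simp
    then show False using \<open>v > 0\<close> by (simp add: power_divide)
  qed
  have grow: "r t \<ge> r t0 + v / 2 * (t - t0)" if "t \<ge> t0" for t
  proof -
    have "((\<lambda>t. r t - v / 2 * t) has_real_derivative h t - v / 2) (at t)" for t
      by (auto intro!: derivative_eq_intros d)
    then have "r t0 - v / 2 * t0 \<le> r t - v / 2 * t"
      by (intro DERIV_nonneg_imp_nondecreasing[OF that]) (metis * diff_ge_0_iff_ge less_imp_le)
    then show ?thesis by (simp add: field_simps)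
  qed
  \<comment> \<open>The time at which the linear lower bound reaches
    \<open>r t0 + \<bar>b - r t0\<bar> + 1\<close>, which exceeds \<open>b\<close>.\<close>
  define \<tau> where "\<tau> = t0 + 2 * (\<bar>b - r t0\<bar> + 1) / v"
  have "v / 2 * (\<tau> - t0) = \<bar>b - r t0\<bar> + 1" "\<tau> \<ge> t0" using \<open>v > 0\<close> by (auto simp: \<tau>_def)
  with grow[of \<tau>] have "r \<tau> > b" by linarith
  then show ?thesis by blast
qed

text \<open>A connected set of reals with two points is uncountable. This turns rationality of
  periods and frequencies into constancy.\<close>

lemma continuous_on_countable_values_const:
  fixes f :: "real \<Rightarrow> real"
  assumes "connected S" "continuous_on S f" "f ` S \<subseteq> C" "countable C"
  shows "f constant_on S"
proof (cases "S = {}")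
  case False
  then obtain a where "a \<in> S" by auto
  have "connected (f ` S)" using assms connected_continuous_image by blast
  moreover have "countable (f ` S)" using assms countable_subset by blast
  ultimately have "f ` S \<subseteq> {f a}"
    using \<open>a \<in> S\<close> connected_uncountable by (metis imageI insert_subset singletonD subsetI insert_iff)
  then show ?thesis by (auto simp: constant_on_def)
qed (simp add: constant_on_def)

text \<open>Second derivative test in both directions, with the second derivative taken at the point
  alone. A negative \<open>D\<close> would give \<open>-U\<close> a strict local minimum at
  \<open>x\<close>, contradicting that \<open>U\<close> has one.\<close>

lemma local_min_iff_deriv:
  fixes U U1 :: "real \<Rightarrow> real"
  assumes ev: "\<forall>\<^sub>F y in nhds x. (U has_real_derivative U1 y) (at y)"
    and d: "(U1 has_real_derivative D) (at x)" and "D \<noteq> 0"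
  shows "(\<forall>\<^sub>F y in at x. U x \<le> U y) \<longleftrightarrow> U1 x = 0 \<and> D > 0"
proof -
  obtain e where e: "e > 0" "\<And>y. \<bar>y - x\<bar> < e \<Longrightarrow> (U has_real_derivative U1 y) (at y)"
    using ev unfolding eventually_nhds_metric dist_real_def by blast
  have pos: "\<forall>\<^sub>F y in at x. g x < g y"
    if gd: "\<And>y. \<bar>y - x\<bar> < e \<Longrightarrow> (g has_real_derivative g1 y) (at y)"
       and g1d: "(g1 has_real_derivative D') (at x)" and "D' > 0" "g1 x = 0" for g g1 :: "real \<Rightarrow> real" and D'
  proof -
    obtain a where a: "a > 0" "\<And>h. h > 0 \<Longrightarrow> h < a \<Longrightarrow> g1 (x + h) > 0"
      using DERIV_pos_inc_right[OF g1d \<open>D' > 0\<close>] \<open>g1 x = 0\<close> by auto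
    obtain b where b: "b > 0" "\<And>h. h > 0 \<Longrightarrow> h < b \<Longrightarrow> g1 (x - h) < 0"
      using DERIV_pos_inc_left[OF g1d \<open>D' > 0\<close>] \<open>g1 x = 0\<close> by auto
    define m where "m = min e (min a b)"
    have m: "m > 0" "m \<le> e" "m \<le> a" "m \<le> b" using a b e by (auto simp: m_def)
    have "g x < g y" if y: "y \<noteq> x" "\<bar>y - x\<bar> < m" for y
    proof (cases "y > x")
      case True
      obtain z where z: "x < z" "z < y" "g y - g x = (y - x) * g1 z"
        using MVT2[OF True, of g g1] gd y m True by force
      have "g1 z > 0" using a(2)[of "z - x"] z y m by auto
      then have "(y - x) * g1 z > 0" using True by simp
      with z(3) show ?thesis by linarith
    next
      case False
      then have F: "y < x" using y by auto
      obtain z where z: "y < z" "z < x" "g x - g y = (x - y) * g1 z"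
        using MVT2[OF F, of g g1] gd y m F by force
      have "g1 z < 0" using b(2)[of "x - z"] z y m by auto
      then have "(x - y) * g1 z < 0" using F by (simp add: mult_pos_neg)
      with z(3) show ?thesis by linarith
    qed
    then show ?thesis using m(1) by (auto simp: eventually_at dist_real_def)
  qed
  show ?thesis
  proof
    assume L: "\<forall>\<^sub>F y in at x. U x \<le> U y"
    then obtain c where c: "c > 0" "\<And>y. \<bar>y - x\<bar> < c \<Longrightarrow> U x \<le> U y"
      unfolding eventually_at dist_real_def by (metis UNIV_I order_refl)
    have U1: "U1 x = 0"
      by (rule DERIV_local_min[OF e(2) c(1)]) (use c(2) e(1) in \<open>auto simp: abs_minus_commute\<close>)
    have "D > 0"
    proof (rule ccontr)
      assume "\<not> D > 0"
      then have "\<forall>\<^sub>F y in at x. - U x < - U y"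
        using \<open>D \<noteq> 0\<close> by (intro pos[of _ "\<lambda>y. - U1 y" "- D"])
          (auto intro!: derivative_eq_intros e(2) d simp: U1)
      with L have "\<forall>\<^sub>F y in at x. False" by eventually_elim auto
      then show False by simp
    qed
    with U1 show "U1 x = 0 \<and> D > 0" by auto
  next
    assume "U1 x = 0 \<and> D > 0"
    then have "\<forall>\<^sub>F y in at x. U x < U y" using pos[OF e(2) d] by auto
    then show "\<forall>\<^sub>F y in at x. U x \<le> U y" by eventually_elim simp
  qed
qed

section \<open>Taylor remainders and the square-root coordinate of a well\<close>

text \<open>L'Hopital's rule read backwards: integrating raises the order of a remainder by one.
  Iteration yields Taylor expansions whose top derivative is assumed to exist only at the
  centre.\<close>

lemma quotient_limit_antiderivative:
  fixes g g1 :: "real \<Rightarrow> real"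
  assumes "\<forall>\<^sub>F y in nhds a. (g has_real_derivative g1 y) (at y)" and "g a = 0"
    and l: "((\<lambda>y. g1 y / (y - a) ^ n) \<longlongrightarrow> l) (at a)"
  shows "((\<lambda>y. g y / (y - a) ^ Suc n) \<longlongrightarrow> l / Suc n) (at a)"
proof (rule lhopital[of g a "\<lambda>y. (y - a) ^ Suc n" "\<lambda>y. Suc n * (y - a) ^ n" g1])
  have "(g has_real_derivative g1 a) (at a)" using assms(1) by (rule eventually_nhds_x_imp_x)
  then show "(g \<longlongrightarrow> 0) (at a)" using \<open>g a = 0\<close> DERIV_isCont isCont_def by metis
  have "((\<lambda>y. (y - a) ^ Suc n) \<longlongrightarrow> (a - a) ^ Suc n) (at a)" by (intro tendsto_intros)
  then show "((\<lambda>y. (y - a) ^ Suc n) \<longlongrightarrow> 0) (at a)" by simp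
  show "\<forall>\<^sub>F x in at a. (x - a) ^ Suc n \<noteq> 0" unfolding eventually_at_filter by (intro always_eventually) auto
  show "\<forall>\<^sub>F x in at a. real (Suc n) * (x - a) ^ n \<noteq> 0" unfolding eventually_at_filter by (intro always_eventually) (auto simp del: of_nat_Suc)
  show "\<forall>\<^sub>F x in at a. (g has_real_derivative g1 x) (at x)"
    using assms(1) by (simp add: eventually_at_filter eventually_mono)
  show "\<forall>\<^sub>F x in at a. ((\<lambda>y. (y - a) ^ Suc n) has_real_derivative real (Suc n) * (x - a) ^ n) (at x)"
    by (intro always_eventually allI) (auto intro!: derivative_eq_intros simp del: power_Suc of_nat_Suc)
  have "((\<lambda>y. (g1 y / (y - a) ^ n) / real (Suc n)) \<longlongrightarrow> l / real (Suc n)) (at a)"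
    by (intro tendsto_intros l) simp
  then show "((\<lambda>y. g1 y / (real (Suc n) * (y - a) ^ n)) \<longlongrightarrow> l / real (Suc n)) (at a)"
    by (simp add: mult.commute)
qed

lemma deriv_quotient_limit:
  fixes g :: "real \<Rightarrow> real"
  assumes "(g has_real_derivative D) (at a)" "g a = 0"
  shows "((\<lambda>y. g y / (y - a) ^ 1) \<longlongrightarrow> D) (at a)"
  using assms by (simp add: has_field_derivative_iff)

text \<open>The Morse lemma in one variable: near a nondegenerate minimum the signed square root of
  \<open>P - P z0\<close> is a C1 coordinate with nonzero derivative, and \<open>H\<close> is its
  inverse.\<close>

lemma well_coordinate:
  fixes P P1 :: "real \<Rightarrow> real"
  assumes "\<eta> > 0" and dP: "\<And>z. \<bar>z - z0\<bar> < \<eta> \<Longrightarrow> (P has_real_derivative P1 z) (at z)"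
    and cP1: "\<And>z. \<bar>z - z0\<bar> < \<eta> \<Longrightarrow> isCont P1 z"
    and dP1: "(P1 has_real_derivative D) (at z0)"
    and P10: "P1 z0 = 0" and "D > 0"
  obtains \<delta> H h where "\<delta> > 0" "H 0 = z0" "h 0 = sqrt (2 / D)"
    "continuous_on {-\<delta><..<\<delta>} h"
    "\<And>x. \<bar>x\<bar> < \<delta> \<Longrightarrow> (H has_real_derivative h x) (at x)"
    "\<And>x. \<bar>x\<bar> < \<delta> \<Longrightarrow> h x > 0"
    "\<And>x. \<bar>x\<bar> < \<delta> \<Longrightarrow> \<bar>H x - z0\<bar> < \<eta>"
    "\<And>x. \<bar>x\<bar> < \<delta> \<Longrightarrow> P (H x) = P z0 + x\<^sup>2"
    "\<And>x. \<bar>x\<bar> < \<delta> \<Longrightarrow> P1 (H x) * h x = 2 * x"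
proof -
  obtain a where a: "a > 0" "\<And>h. h > 0 \<Longrightarrow> h < a \<Longrightarrow> P1 (z0 + h) > 0"
    using DERIV_pos_inc_right[OF dP1 \<open>D > 0\<close>] P10 by auto
  obtain b where b: "b > 0" "\<And>h. h > 0 \<Longrightarrow> h < b \<Longrightarrow> P1 (z0 - h) < 0"
    using DERIV_pos_inc_left[OF dP1 \<open>D > 0\<close>] P10 by auto
  \<comment> \<open>On this interval \<open>P1\<close> vanishes at \<open>z0\<close> only and has
    the sign of \<open>z - z0\<close>, so \<open>P > P z0\<close> elsewhere.\<close>
  define m where "m = min \<eta> (min a b)"
  have m: "m > 0" "m \<le> \<eta>" "m \<le> a" "m \<le> b" using a b \<open>\<eta> > 0\<close> by (auto simp: m_def)
  have P1r: "P1 z > 0" if "z0 < z" "z < z0 + m" for z using a(2)[of "z - z0"] that m by auto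
  have P1l: "P1 z < 0" if "z < z0" "z0 - m < z" for z using b(2)[of "z0 - z"] that m by auto
  have Pr: "P z > P z0" if w: "z0 < z" "z < z0 + m" for z
  proof -
    obtain t where "z0 < t" "t < z" "P z - P z0 = (z - z0) * P1 t"
      using MVT2[OF w(1), of P P1] dP w m by force
    then show ?thesis using P1r[of t] w by (smt (verit) mult_pos_pos)
  qed
  have Pl: "P z > P z0" if w: "z < z0" "z0 - m < z" for z
  proof -
    obtain t where "z < t" "t < z0" "P z0 - P z = (z0 - z) * P1 t"
      using MVT2[OF w(1), of P P1] dP w m by force
    then show ?thesis using P1l[of t] w by (smt (verit) mult_pos_neg)
  qed
  define s0 where "s0 = sqrt (D / 2)"
  have s0: "s0 > 0" "s0\<^sup>2 = D / 2" using \<open>D > 0\<close> by (auto simp: s0_def)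
  define X where "X z = sgn (z - z0) * sqrt (P z - P z0)" for z
  \<comment> \<open>The derivative of \<open>X\<close>. Off \<open>z0\<close> it is that of the
    square root; \<open>s0\<close> is its limit at \<open>z0\<close>, since \<open>P - P z0\<close>
    is to leading order \<open>s0^2 (z - z0)^2\<close>.\<close>
  define k where "k z = (if z = z0 then s0 else P1 z / (2 * X z))" for z
  define S where "S = {z0 - m<..<z0 + m}"
  have Ssub: "\<bar>z - z0\<bar> < \<eta>" if "z \<in> S" for z using that m by (auto simp: S_def)
  have evS: "\<forall>\<^sub>F z in at z0. z \<in> S"
    using m by (intro eventually_at_in_open') (auto simp: S_def)
  have "((\<lambda>z. (P z - P z0) / (z - z0) ^ Suc 1) \<longlongrightarrow> D / Suc 1) (at z0)"
  proof (rule quotient_limit_antiderivative)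
    have "\<forall>\<^sub>F y in nhds z0. y \<in> S" using m by (intro eventually_nhds_in_open) (auto simp: S_def)
    then show "\<forall>\<^sub>F y in nhds z0. ((\<lambda>z. P z - P z0) has_real_derivative P1 y) (at y)"
      by eventually_elim (auto intro!: derivative_eq_intros dP Ssub)
    show "((\<lambda>y. P1 y / (y - z0) ^ 1) \<longlongrightarrow> D) (at z0)" using deriv_quotient_limit[OF dP1 P10] .
  qed simp
  then have "((\<lambda>z. sqrt ((P z - P z0) / (z - z0)\<^sup>2)) \<longlongrightarrow> s0) (at z0)"
    unfolding s0_def by (intro tendsto_real_sqrt) (simp add: numeral_2_eq_2)
  then have Xlim: "((\<lambda>z. X z / (z - z0)) \<longlongrightarrow> s0) (at z0)"
  proof (rule Lim_transform_eventually)
    show "\<forall>\<^sub>F z in at z0. sqrt ((P z - P z0) / (z - z0)\<^sup>2) = X z / (z - z0)"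
      unfolding eventually_at_filter
      by (intro always_eventually) (auto simp: X_def real_sqrt_divide sgn_if, metis minus_diff_eq minus_divide_right)
  qed
  have X0 [simp]: "X z0 = 0" by (simp add: X_def)
  have Xpos: "X z > 0" if "z \<in> S" "z > z0" for z using Pr[of z] that by (auto simp: X_def S_def)
  have Xneg: "X z < 0" if "z \<in> S" "z < z0" for z using Pl[of z] that by (auto simp: X_def S_def)
  have kpos: "k z > 0" if "z \<in> S" for z
    using that Xpos[of z] Xneg[of z] P1r[of z] P1l[of z] s0(1)
    by (cases z z0 rule: linorder_cases) (auto simp: k_def S_def divide_simps)
  have dX: "(X has_real_derivative k z) (at z)" if z: "z \<in> S" for z
  proof (cases z z0 rule: linorder_cases)
    case equal
    then show ?thesis using Xlim by (simp add: has_field_derivative_iff k_def)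
  next
    case greater
    have d: "((\<lambda>z. sqrt (P z - P z0)) has_real_derivative k z) (at z)"
      using Pr[of z] greater z dP[OF Ssub[OF z]]
      by (auto intro!: derivative_eq_intros simp: k_def X_def S_def field_simps)
    have "\<forall>\<^sub>F y in nhds z. y > z0" using eventually_nhds_in_open[of "{z0<..}" z] greater by simp
    then have ev: "\<forall>\<^sub>F y in nhds z. sqrt (P y - P z0) = X y"
      by eventually_elim (simp add: X_def)
    show ?thesis using d DERIV_cong_ev[OF refl ev refl] by blast
  next
    case less
    have d: "((\<lambda>z. - sqrt (P z - P z0)) has_real_derivative k z) (at z)"
      using Pl[of z] less z dP[OF Ssub[OF z]]
      by (auto intro!: derivative_eq_intros simp: k_def X_def S_def field_simps)
    have "\<forall>\<^sub>F y in nhds z. y < z0" using eventually_nhds_in_open[of "{..<z0}" z] less by simp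
    then have ev: "\<forall>\<^sub>F y in nhds z. - sqrt (P y - P z0) = X y"
      by eventually_elim (simp add: X_def)
    show ?thesis using d DERIV_cong_ev[OF refl ev refl] by blast
  qed
  have cX: "continuous_on S X" using dX by (meson DERIV_isCont continuous_at_imp_continuous_on)
  have mono: "X x < X y" if "x \<in> S" "y \<in> S" "x < y" for x y
  proof (rule DERIV_pos_imp_increasing[OF \<open>x < y\<close>, of X])
    fix t assume "x \<le> t" "t \<le> y"
    then have "t \<in> S" using that by (auto simp: S_def)
    then show "\<exists>y. (X has_real_derivative y) (at t) \<and> y > 0" using dX kpos by blast
  qed
  have inj: "inj_on X S"
  proof (rule inj_onI)
    fix x y assume "x \<in> S" "y \<in> S" "X x = X y"
    then show "x = y" using mono[of x y] mono[of y x] by (cases x y rule: linorder_cases) simp_all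
  qed
  have "open S" "z0 \<in> S" using m by (auto simp: S_def)
  have ck: "isCont k z" if z: "z \<in> S" for z
  proof (cases "z = z0")
    case True
    have "((\<lambda>z. (P1 z / (z - z0) ^ 1) / (2 * (X z / (z - z0)))) \<longlongrightarrow> D / (2 * s0)) (at z0)"
      using s0 by (intro tendsto_intros Xlim deriv_quotient_limit[OF dP1 P10]) auto
    moreover have "\<forall>\<^sub>F z in at z0. (P1 z / (z - z0) ^ 1) / (2 * (X z / (z - z0))) = k z"
      unfolding eventually_at_filter by (intro always_eventually) (auto simp: k_def)
    moreover have "D / (2 * s0) = k z0" using s0 by (simp add: k_def field_simps power2_eq_square)
    ultimately show ?thesis using True by (simp add: isCont_def Lim_transform_eventually)
  next
    case False
    have "X z \<noteq> 0" using Xpos[OF z] Xneg[OF z] False by force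
    then have c: "isCont (\<lambda>z. P1 z / (2 * X z)) z"
      using cP1[OF Ssub[OF z]] DERIV_isCont[OF dX[OF z]] by (intro continuous_intros) auto
    have "\<forall>\<^sub>F y in nhds z. y \<noteq> z0" using False by (metis t1_space_nhds)
    then have ev: "\<forall>\<^sub>F y in nhds z. P1 y / (2 * X y) = k y"
      by eventually_elim (simp add: k_def)
    show ?thesis using c isCont_cong[OF ev] by blast
  qed
  define H where "H = the_inv_into S X"
  have HX: "H (X z) = z" if "z \<in> S" for z using the_inv_into_f_f[OF inj that] by (simp add: H_def)
  have dH: "(H has_real_derivative inverse (k z)) (at (X z))" if "z \<in> S" for z
    unfolding has_field_derivative_def
    by (rule has_derivative_inverse_strong[of S z X H "(*) (k z)"])
      (use that dX[of z] kpos[of z] cX HX \<open>open S\<close> in \<open>auto simp: has_field_derivative_def\<close>)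
  \<comment> \<open>By the intermediate value theorem, \<open>X\<close> takes every value smaller
    than \<open>u\<close> in modulus on the half-width interval, whose end points still lie in
    \<open>S\<close>.\<close>
  define u where "u = min (X (z0 + m / 2)) (- X (z0 - m / 2))"
  have u: "u > 0" using Xpos[of "z0 + m/2"] Xneg[of "z0 - m/2"] m by (auto simp: u_def S_def)
  have cov: "\<exists>z\<in>S. X z = x" if "\<bar>x\<bar> < u" for x
  proof -
    have "\<exists>z\<ge>z0 - m/2. z \<le> z0 + m/2 \<and> X z = x"
      using that m by (intro IVT') (auto simp: u_def S_def intro!: continuous_on_subset[OF cX])
    then show ?thesis using m by (auto simp: S_def intro!: bexI)
  qed
  have HS: "H x \<in> S" "X (H x) = x" if "\<bar>x\<bar> < u" for x using cov[OF that] HX by auto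
  show ?thesis
  proof (rule that[of u H "\<lambda>x. inverse (k (H x))"])
    show "u > 0" by fact
    show "H 0 = z0" using HX[OF \<open>z0 \<in> S\<close>] by simp
    then show "inverse (k (H 0)) = sqrt (2 / D)"
      by (simp add: k_def s0_def real_sqrt_divide)
    show "(H has_real_derivative inverse (k (H x))) (at x)" if "\<bar>x\<bar> < u" for x
      using dH[OF HS(1)[OF that]] HS(2)[OF that] by simp
    then have cH: "isCont H x" if "\<bar>x\<bar> < u" for x using that DERIV_isCont by blast
    show "continuous_on {- u<..<u} (\<lambda>x. inverse (k (H x)))"
    proof (intro continuous_at_imp_continuous_on ballI)
      fix x assume "x \<in> {- u<..<u}"
      then have x: "\<bar>x\<bar> < u" by auto
      have "isCont (\<lambda>x. k (H x)) x" using isCont_o2[OF cH[OF x] ck[OF HS(1)[OF x]]] .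
      moreover have "k (H x) \<noteq> 0" using kpos[OF HS(1)[OF x]] by simp
      ultimately show "isCont (\<lambda>x. inverse (k (H x))) x" by (rule continuous_at_within_inverse)
    qed
    fix x assume x: "\<bar>x\<bar> < u"
    show "inverse (k (H x)) > 0" using kpos[OF HS(1)[OF x]] by simp
    show "\<bar>H x - z0\<bar> < \<eta>" using Ssub[OF HS(1)[OF x]] .
    have "P (H x) \<ge> P z0"
      using HS(1)[OF x] Pr[of "H x"] Pl[of "H x"] by (cases "H x" z0 rule: linorder_cases) (auto simp: S_def)
    moreover have "x\<^sup>2 = (X (H x))\<^sup>2" using HS(2)[OF x] by simp
    ultimately show "P (H x) = P z0 + x\<^sup>2"
      by (auto simp: X_def power_mult_distrib sgn_if)
    show "P1 (H x) * inverse (k (H x)) = 2 * x"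
    proof (cases "H x = z0")
      case True
      then show ?thesis using P10 HS(2)[OF x] by simp
    next
      case False
      then have "P1 (H x) \<noteq> 0" using HS(1)[OF x] P1r[of "H x"] P1l[of "H x"] by (force simp: S_def)
      with False show ?thesis using HS(2)[OF x] by (simp add: k_def)
    qed
  qed
qed

section \<open>The period integral and its expansion for small amplitudes\<close>

lemma integral_sin_full_period:
  "((\<lambda>s. sin s) has_integral 0) {0..2*pi}" "((\<lambda>s. (sin s)\<^sup>2) has_integral pi) {0..2*pi}"
proof -
  have "((\<lambda>s. sin s) has_integral (- cos (2*pi) - - cos 0)) {0..2*pi}"
    by (rule fundamental_theorem_of_calculus)
      (auto intro!: derivative_eq_intros simp flip: has_real_derivative_iff_has_vector_derivative)
  then show "((\<lambda>s. sin s) has_integral 0) {0..2*pi}" by simp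
  have "((\<lambda>s. (sin s)\<^sup>2) has_integral (((2*pi) - sin (2*pi) * cos (2*pi)) / 2 - (0 - sin 0 * cos 0) / 2)) {0..2*pi}"
  proof (rule fundamental_theorem_of_calculus, simp)
    fix x :: real
    have "((\<lambda>x. (x - sin x * cos x) / 2) has_real_derivative (sin x)\<^sup>2) (at x within {0..2*pi})"
      by (auto intro!: derivative_eq_intros simp: power2_eq_square[symmetric] cos_squared_eq)
    then show "((\<lambda>x. (x - sin x * cos x) / 2) has_vector_derivative (sin x)\<^sup>2) (at x within {0..2*pi})"
      by (simp add: has_real_derivative_iff_has_vector_derivative)
  qed
  then show "((\<lambda>s. (sin s)\<^sup>2) has_integral pi) {0..2*pi}" by simp
qed

lemma abs_mult_sin_less: "\<bar>\<mu>\<bar> < \<delta> \<Longrightarrow> \<bar>\<mu> * sin s\<bar> < (\<delta>::real)"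
  using mult_left_le[of "\<bar>sin s\<bar>" "\<bar>\<mu>\<bar>"] abs_sin_le_one[of s] by (simp add: abs_mult)

text \<open>For amplitude 0 the orbit is the circle itself and its closedness says nothing about the
  integral. The integral is continuous there as well, so the constant found for positive amplitudes
  must equal its value at 0.\<close>

lemma period_integral_const:
  fixes h :: "real \<Rightarrow> real"
  assumes "\<delta> > 0" and c: "continuous_on {-\<delta><..<\<delta>} h" and C: "countable C"
    and v: "\<And>\<mu>. 0 < \<mu> \<Longrightarrow> \<mu> < \<delta> \<Longrightarrow> integral {0..2*pi} (\<lambda>s. h (\<mu> * sin s)) \<in> C"
    and "0 < \<mu>" "\<mu> < \<delta>"
  shows "integral {0..2*pi} (\<lambda>s. h (\<mu> * sin s)) = 2 * pi * h 0"
proof -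
  define I where "I \<mu> = integral (cbox 0 (2*pi)) (\<lambda>s. h (\<mu> * sin s))" for \<mu>
  have cI: "continuous_on {-\<delta><..<\<delta>} I" unfolding I_def
  proof (rule integral_continuous_on_param)
    have "continuous_on ({-\<delta><..<\<delta>} \<times> cbox 0 (2*pi)) (\<lambda>p. h (fst p * sin (snd p)))"
    proof (rule continuous_on_compose2[OF c])
      show "continuous_on ({-\<delta><..<\<delta>} \<times> cbox 0 (2*pi)) (\<lambda>p. fst p * sin (snd p))"
        by (intro continuous_intros)
      show "(\<lambda>p. fst p * sin (snd p)) ` ({-\<delta><..<\<delta>} \<times> cbox 0 (2*pi)) \<subseteq> {-\<delta><..<\<delta>}"
      proof clarify
        fix x s :: real
        assume "x \<in> {-\<delta><..<\<delta>}"
        then have "\<bar>x * sin s\<bar> < \<delta>" by (intro abs_mult_sin_less) auto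
        then show "fst (x, s) * sin (snd (x, s)) \<in> {-\<delta><..<\<delta>}" by (auto simp: abs_less_iff)
      qed
    qed
    then show "continuous_on ({-\<delta><..<\<delta>} \<times> cbox 0 (2*pi)) (\<lambda>(x, t). h (x * sin t))"
      by (simp add: case_prod_unfold)
  qed
  have "I constant_on {0<..<\<delta>}"
    by (rule continuous_on_countable_values_const[OF _ continuous_on_subset[OF cI] _ C])
      (use v in \<open>auto simp: I_def\<close>)
  then obtain y where y: "\<And>x. 0 < x \<Longrightarrow> x < \<delta> \<Longrightarrow> I x = y" by (auto simp: constant_on_def)
  have "isCont I 0" using cI \<open>\<delta> > 0\<close> by (simp add: continuous_on_eq_continuous_at)
  then have "(I \<longlongrightarrow> I 0) (at_right 0)"
    unfolding isCont_def using filterlim_at_split by blast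
  moreover have "(I \<longlongrightarrow> y) (at_right 0)"
    by (rule tendsto_eventually) (use \<open>\<delta> > 0\<close> y in \<open>auto simp: eventually_at_right_field\<close>)
  ultimately have "I 0 = y" using tendsto_unique trivial_limit_at_right_real by blast
  moreover have "I 0 = 2 * pi * h 0" by (simp add: I_def)
  ultimately show ?thesis using y[of \<mu>] assms by (simp add: I_def)
qed

text \<open>If \<open>N > 0\<close>, then \<open>h x\<close> is at least
  \<open>h 0 + c2 x + (N/2) x^2\<close> near 0. Averaged over \<open>x = \<mu> sin s\<close>, the
  linear term vanishes and the quadratic one leaves a surplus \<open>N \<mu>^2 pi / 2\<close>, which
  a constant integral excludes.\<close>

lemma isochronous_second_order_pos:
  fixes h :: "real \<Rightarrow> real"
  assumes "\<delta> > 0" and c: "continuous_on {-\<delta><..<\<delta>} h"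
    and v: "\<And>\<mu>. 0 < \<mu> \<Longrightarrow> \<mu> < \<delta> \<Longrightarrow> integral {0..2*pi} (\<lambda>s. h (\<mu> * sin s)) = 2 * pi * h 0"
    and lim: "((\<lambda>x. (h x - h 0 - c2 * x) / x\<^sup>2) \<longlongrightarrow> N) (at 0)"
  shows "N \<le> 0"
proof (rule ccontr)
  assume "\<not> N \<le> 0"
  then have "\<forall>\<^sub>F x in at 0. (h x - h 0 - c2 * x) / x\<^sup>2 > N / 2"
    using lim by (intro order_tendstoD(1)[of _ N]) auto
  then obtain d where d: "d > 0" "\<And>x. x \<noteq> 0 \<Longrightarrow> \<bar>x\<bar> < d \<Longrightarrow> (h x - h 0 - c2 * x) / x\<^sup>2 > N / 2"
    by (auto simp: eventually_at dist_real_def)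
  have ge: "h x \<ge> h 0 + c2 * x + N / 2 * x\<^sup>2" if "\<bar>x\<bar> < d" for x
  proof (cases "x = 0")
    case False
    then have "N / 2 * x\<^sup>2 < h x - h 0 - c2 * x" using d(2)[OF False that] by (simp add: field_simps)
    then show ?thesis by simp
  qed simp
  define \<mu> where "\<mu> = min d \<delta> / 2"
  have \<mu>: "0 < \<mu>" "\<mu> < d" "\<mu> < \<delta>" using d \<open>\<delta> > 0\<close> by (auto simp: \<mu>_def)
  have "\<mu> * sin s \<in> {-\<delta><..<\<delta>}" for s
    using \<mu> abs_mult_sin_less[of \<mu> \<delta> s] by (auto simp: abs_less_iff)
  then have "continuous_on {0..2*pi} (\<lambda>s. h (\<mu> * sin s))"
    by (intro continuous_on_compose2[OF c]) (auto intro!: continuous_intros)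
  then have "(\<lambda>s. h (\<mu> * sin s)) integrable_on {0..2*pi}" by (rule integrable_continuous_real)
  then have 1: "((\<lambda>s. h (\<mu> * sin s)) has_integral 2 * pi * h 0) {0..2*pi}"
    using v[OF \<mu>(1,3)] by (metis integrable_integral)
  have c0: "((\<lambda>s. h 0) has_integral (2 * pi * h 0)) {0..2*pi}"
    using has_integral_const_real[of "h 0" 0 "2*pi"] by simp
  have 2: "((\<lambda>s. h 0 + (c2 * \<mu>) * sin s + (N / 2 * \<mu>\<^sup>2) * (sin s)\<^sup>2) has_integral
      2 * pi * h 0 + (c2 * \<mu>) * 0 + (N / 2 * \<mu>\<^sup>2) * pi) {0..2*pi}"
    by (intro has_integral_add has_integral_mult_right integral_sin_full_period c0)
  have "2 * pi * h 0 + (c2 * \<mu>) * 0 + (N / 2 * \<mu>\<^sup>2) * pi \<le> 2 * pi * h 0"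
    by (rule has_integral_le[OF 2 1])
      (use ge[OF abs_mult_sin_less[of \<mu> d]] \<mu> in \<open>auto simp: power_mult_distrib algebra_simps\<close>)
  moreover have "(N / 2 * \<mu>\<^sup>2) * pi > 0" using \<open>\<not> N \<le> 0\<close> \<mu> by simp
  ultimately show False by simp
qed

text \<open>The one-sided bound applied to \<open>h\<close> and to \<open>-h\<close>.\<close>

lemma isochronous_second_order:
  fixes h :: "real \<Rightarrow> real"
  assumes "\<delta> > 0" and c: "continuous_on {-\<delta><..<\<delta>} h"
    and v: "\<And>\<mu>. 0 < \<mu> \<Longrightarrow> \<mu> < \<delta> \<Longrightarrow> integral {0..2*pi} (\<lambda>s. h (\<mu> * sin s)) = 2 * pi * h 0"
    and lim: "((\<lambda>x. (h x - h 0 - c2 * x) / x\<^sup>2) \<longlongrightarrow> N) (at 0)"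
  shows "N = 0"
proof -
  have "((\<lambda>x. - ((h x - h 0 - c2 * x) / x\<^sup>2)) \<longlongrightarrow> - N) (at 0)" using lim by (rule tendsto_minus)
  moreover have "- ((h x - h 0 - c2 * x) / x\<^sup>2) = (- h x - - h 0 - (- c2) * x) / x\<^sup>2" for x
    by (simp add: diff_divide_distrib add_divide_distrib)
  ultimately have "- N \<le> 0"
    using assms by (intro isochronous_second_order_pos[of \<delta> "\<lambda>x. - h x" "- c2"])
      (auto intro!: continuous_intros)
  moreover have "N \<le> 0" using isochronous_second_order_pos[OF assms] .
  ultimately show ?thesis by simp
qed

text \<open>If the well is isochronous, the odd part of \<open>H\<close> is linear, and the coefficient of \<open>x\<^sup>2\<close> in
  \<open>h = H'\<close> vanishes. In terms of the Taylor coefficients of the potential it is a multiple of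
  \<open>5 P'''\<^sup>2 - 3 P'' P''''\<close>.\<close>

lemma isochronous_well:
  fixes P P1 P2 P3 :: "real \<Rightarrow> real"
  assumes "\<delta> > 0" and H0: "H 0 = z0" and h0: "h 0 = sqrt (2 / P2 z0)"
    and ch: "continuous_on {-\<delta><..<\<delta>} h"
    and dH: "\<And>x. \<bar>x\<bar> < \<delta> \<Longrightarrow> (H has_real_derivative h x) (at x)"
    and hpos: "\<And>x. \<bar>x\<bar> < \<delta> \<Longrightarrow> h x > 0"
    and Heta: "\<And>x. \<bar>x\<bar> < \<delta> \<Longrightarrow> \<bar>H x - z0\<bar> < \<eta>"
    and PH: "\<And>x. \<bar>x\<bar> < \<delta> \<Longrightarrow> P (H x) = P z0 + x\<^sup>2"
    and P1H: "\<And>x. \<bar>x\<bar> < \<delta> \<Longrightarrow> P1 (H x) * h x = 2 * x"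
    and "\<eta> > 0"
    and d0: "\<And>z. \<bar>z - z0\<bar> < \<eta> \<Longrightarrow> (P has_real_derivative P1 z) (at z)"
    and d1: "\<And>z. \<bar>z - z0\<bar> < \<eta> \<Longrightarrow> (P1 has_real_derivative P2 z) (at z)"
    and d2: "\<And>z. \<bar>z - z0\<bar> < \<eta> \<Longrightarrow> (P2 has_real_derivative P3 z) (at z)"
    and d3: "(P3 has_real_derivative D4) (at z0)"
    and P10: "P1 z0 = 0" and P2pos: "P2 z0 > 0"
    and iso: "\<And>\<mu>. 0 < \<mu> \<Longrightarrow> \<mu> < \<delta> \<Longrightarrow> integral {0..2*pi} (\<lambda>s. h (\<mu> * sin s)) = 2 * pi * h 0"
  shows "5 * (P3 z0)\<^sup>2 = 3 * P2 z0 * D4"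
proof -
  \<comment> \<open>With \<open>y = H x - z0\<close> one expects
    \<open>x = s0 y + s1 y^2 + ...\<close>. Squaring and comparing with the Taylor series of
    \<open>P\<close> gives \<open>s0^2 = P''/2\<close> and \<open>2 s0 s1 = P'''/6\<close>.\<close>
  define s0 where "s0 = sqrt (P2 z0 / 2)"
  have s0: "s0 > 0" using P2pos by (simp add: s0_def)
  have p2: "P2 z0 = 2 * s0\<^sup>2" using P2pos by (simp add: s0_def)
  define s1 where "s1 = P3 z0 / (12 * s0)"
  have p3: "P3 z0 = 12 * s0 * s1" using s0 by (simp add: s1_def)
  have ev: "\<forall>\<^sub>F z in nhds z0. \<bar>z - z0\<bar> < \<eta>"
    unfolding eventually_nhds_metric dist_real_def using \<open>\<eta> > 0\<close> by blast
  \<comment> \<open>The fourth derivative of \<open>P\<close> is given only at \<open>z0\<close>, so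
    the remainders are integrated up from \<open>P3\<close> to \<open>P\<close>.\<close>
  have T3: "((\<lambda>z. (P3 z - P3 z0 - D4 * (z - z0)) / (z - z0) ^ 1) \<longlongrightarrow> 0) (at z0)"
    by (rule deriv_quotient_limit) (auto intro!: derivative_eq_intros d3)
  have T2: "((\<lambda>z. (P2 z - P2 z0 - P3 z0 * (z - z0) - D4 / 2 * (z - z0)\<^sup>2) / (z - z0) ^ Suc 1) \<longlongrightarrow> 0 / Suc 1) (at z0)"
  proof (rule quotient_limit_antiderivative[OF _ _ T3])
    show "\<forall>\<^sub>F z in nhds z0. ((\<lambda>z. P2 z - P2 z0 - P3 z0 * (z - z0) - D4 / 2 * (z - z0)\<^sup>2)
        has_real_derivative (P3 z - P3 z0 - D4 * (z - z0))) (at z)"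
      using ev by eventually_elim (auto intro!: derivative_eq_intros d2 simp: field_simps)
  qed simp
  then have T2': "((\<lambda>z. (P2 z - P2 z0 - P3 z0 * (z - z0) - D4 / 2 * (z - z0)\<^sup>2) / (z - z0) ^ 2) \<longlongrightarrow> 0) (at z0)"
    by (simp add: numeral_2_eq_2)
  have T1: "((\<lambda>z. (P1 z - P2 z0 * (z - z0) - P3 z0 / 2 * (z - z0)\<^sup>2 - D4 / 6 * (z - z0)^3)
      / (z - z0) ^ Suc 2) \<longlongrightarrow> 0 / Suc 2) (at z0)"
  proof (rule quotient_limit_antiderivative[OF _ _ T2'])
    show "\<forall>\<^sub>F z in nhds z0. ((\<lambda>z. P1 z - P2 z0 * (z - z0) - P3 z0 / 2 * (z - z0)\<^sup>2 - D4 / 6 * (z - z0)^3)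
        has_real_derivative (P2 z - P2 z0 - P3 z0 * (z - z0) - D4 / 2 * (z - z0)\<^sup>2)) (at z)"
      using ev by eventually_elim (auto intro!: derivative_eq_intros d1 simp: algebra_simps power2_eq_square add_divide_distrib diff_divide_distrib)
  qed (simp add: P10)
  then have T1': "((\<lambda>z. (P1 z - P2 z0 * (z - z0) - P3 z0 / 2 * (z - z0)\<^sup>2 - D4 / 6 * (z - z0)^3)
      / (z - z0) ^ 3) \<longlongrightarrow> 0) (at z0)"
    by (simp add: numeral_3_eq_3 numeral_2_eq_2)
  have T0: "((\<lambda>z. (P z - P z0 - P2 z0 / 2 * (z - z0)\<^sup>2 - P3 z0 / 6 * (z - z0)^3 - D4 / 24 * (z - z0)^4)
      / (z - z0) ^ Suc 3) \<longlongrightarrow> 0 / Suc 3) (at z0)"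
  proof (rule quotient_limit_antiderivative[OF _ _ T1'])
    show "\<forall>\<^sub>F z in nhds z0. ((\<lambda>z. P z - P z0 - P2 z0 / 2 * (z - z0)\<^sup>2 - P3 z0 / 6 * (z - z0)^3 - D4 / 24 * (z - z0)^4)
        has_real_derivative (P1 z - P2 z0 * (z - z0) - P3 z0 / 2 * (z - z0)\<^sup>2 - D4 / 6 * (z - z0)^3)) (at z)"
      using ev by eventually_elim (auto intro!: derivative_eq_intros d0 simp: algebra_simps power2_eq_square power3_eq_cube add_divide_distrib diff_divide_distrib)
  qed simp
  define A where "A z = (P z - P z0 - P2 z0 / 2 * (z - z0)\<^sup>2 - P3 z0 / 6 * (z - z0)^3 - D4 / 24 * (z - z0)^4) / (z - z0) ^ 4" for z
  define B where "B z = (P1 z - P2 z0 * (z - z0) - P3 z0 / 2 * (z - z0)\<^sup>2 - D4 / 6 * (z - z0)^3) / (z - z0) ^ 3" for z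
  have A0: "(A \<longlongrightarrow> 0) (at z0)" using T0 by (simp add: A_def[abs_def] eval_nat_numeral)
  have B0: "(B \<longlongrightarrow> 0) (at z0)" using T1' by (simp add: B_def[abs_def])
  define y where "y x = H x - z0" for x
  have evx: "\<forall>\<^sub>F x in at 0. x \<noteq> 0 \<and> \<bar>x\<bar> < \<delta>"
    unfolding eventually_at dist_real_def using \<open>\<delta> > 0\<close> by auto
  have y0: "y x \<noteq> 0" if "x \<noteq> 0" "\<bar>x\<bar> < \<delta>" for x
    using PH[OF that(2)] that(1) by (auto simp: y_def)
  have dH0: "(H has_real_derivative h 0) (at 0)" using dH[of 0] \<open>\<delta> > 0\<close> by simp
  have Hlim: "(H \<longlongrightarrow> z0) (at 0)" using DERIV_isCont[OF dH0] by (simp add: isCont_def H0)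
  then have "filterlim H (at z0) (at 0)"
    unfolding filterlim_at using evx y0 by (auto simp: y_def elim!: eventually_mono)
  note comp = filterlim_compose[OF _ this]
  have a0: "((\<lambda>x. A (H x)) \<longlongrightarrow> 0) (at 0)" and b0: "((\<lambda>x. B (H x)) \<longlongrightarrow> 0) (at 0)"
    using comp[OF A0] comp[OF B0] by auto
  have ylim: "(y \<longlongrightarrow> 0) (at 0)" using tendsto_diff[OF Hlim tendsto_const[of z0]] by (simp add: y_def[abs_def])
  define S where "S x = x / y x" for x
  have h0': "h 0 = 1 / s0" by (simp add: h0 s0_def real_sqrt_divide)
  have "((\<lambda>x. y x / x) \<longlongrightarrow> h 0) (at 0)"
    using dH0 by (simp add: has_field_derivative_iff y_def H0)
  then have "((\<lambda>x. inverse (y x / x)) \<longlongrightarrow> inverse (h 0)) (at 0)"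
    using s0 by (intro tendsto_inverse) (auto simp: h0')
  then have Slim: "(S \<longlongrightarrow> s0) (at 0)" by (simp add: S_def[abs_def] h0')
  \<comment> \<open>The remainder \<open>(S - s0 - s1 y) / y^2\<close>, rationalised:
    \<open>S^2 - (s0 + s1 y)^2\<close> equals \<open>(D4/24 + A - s1^2) y^2\<close>. In this form
    its limit is visible.\<close>
  define R where "R x = (D4 / 24 + A (H x) - s1\<^sup>2) / (S x + s0 + s1 * y x)" for x
  have Rlim: "(R \<longlongrightarrow> (D4 / 24 + 0 - s1\<^sup>2) / (s0 + s0 + s1 * 0)) (at 0)"
    unfolding R_def[abs_def] using s0 by (intro tendsto_intros a0 Slim ylim) auto
  \<comment> \<open>This is \<open>P1 (H x) / y x\<close>, so that
    \<open>h x = 2 * S x / p x\<close>.\<close>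
  define p where "p x = 2 * s0\<^sup>2 + 6 * s0 * s1 * y x + (D4 / 6 + B (H x)) * (y x)\<^sup>2" for x
  have plim: "(p \<longlongrightarrow> 2 * s0\<^sup>2 + 6 * s0 * s1 * 0 + (D4 / 6 + 0) * 0\<^sup>2) (at 0)"
    unfolding p_def[abs_def] by (intro tendsto_intros b0 ylim)
  \<comment> \<open>The difference quotient \<open>(S p - 2 s0^3) / y\<close>, written without
    division by \<open>y\<close>.\<close>
  define G where "G x = S x * (6 * s0 * s1 + (D4 / 6 + B (H x)) * y x) + 2 * s0\<^sup>2 * (s1 + R x * y x)" for x
  have Glim: "(G \<longlongrightarrow> s0 * (6 * s0 * s1 + (D4 / 6 + 0) * 0) + 2 * s0\<^sup>2 * (s1 + (D4 / 24 + 0 - s1\<^sup>2) / (s0 + s0 + s1 * 0) * 0)) (at 0)"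
    unfolding G_def[abs_def] by (intro tendsto_intros b0 ylim Slim Rlim)
  \<comment> \<open>The second-order quotient of \<open>h\<close> after cancelling
    \<open>y^2\<close>. The linear coefficient of \<open>h\<close> is \<open>-2 s1 / s0^3\<close>:
    to first order \<open>h = 2 S / p\<close> is \<open>1/s0 - 2 s1 y / s0^2\<close>, and
    \<open>y\<close> is \<open>x / s0\<close>.\<close>
  define E where "E x = (2 * R x - (D4 / 6 + B (H x)) / s0 + 2 * s1 / s0^3 * G x) / (p x * (S x)\<^sup>2)" for x
  have "(E \<longlongrightarrow> (2 * ((D4 / 24 + 0 - s1\<^sup>2) / (s0 + s0 + s1 * 0)) - (D4 / 6 + 0) / s0
      + 2 * s1 / s0^3 * (s0 * (6 * s0 * s1 + (D4 / 6 + 0) * 0) + 2 * s0\<^sup>2 * (s1 + (D4 / 24 + 0 - s1\<^sup>2) / (s0 + s0 + s1 * 0) * 0)))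
      / ((2 * s0\<^sup>2 + 6 * s0 * s1 * 0 + (D4 / 6 + 0) * 0\<^sup>2) * s0\<^sup>2)) (at 0)"
    unfolding E_def[abs_def] using s0 by (intro tendsto_intros b0 Slim Rlim Glim plim) auto
  moreover have "(2 * ((D4 / 24 + 0 - s1\<^sup>2) / (s0 + s0 + s1 * 0)) - (D4 / 6 + 0) / s0
      + 2 * s1 / s0^3 * (s0 * (6 * s0 * s1 + (D4 / 6 + 0) * 0) + 2 * s0\<^sup>2 * (s1 + (D4 / 24 + 0 - s1\<^sup>2) / (s0 + s0 + s1 * 0) * 0)))
      / ((2 * s0\<^sup>2 + 6 * s0 * s1 * 0 + (D4 / 6 + 0) * 0\<^sup>2) * s0\<^sup>2) = (15 * s1\<^sup>2 - D4 / 8) / (2 * s0^5)"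
    using s0 by (simp add: divide_simps) algebra
  ultimately have Elim: "(E \<longlongrightarrow> (15 * s1\<^sup>2 - D4 / 8) / (2 * s0^5)) (at 0)" by simp
  have evSp: "\<forall>\<^sub>F x in at 0. S x + s0 + s1 * y x \<noteq> 0"
  proof -
    have "((\<lambda>x. S x + s0 + s1 * y x) \<longlongrightarrow> s0 + s0 + s1 * 0) (at 0)" by (intro tendsto_intros Slim ylim)
    then have "\<forall>\<^sub>F x in at 0. S x + s0 + s1 * y x > 0"
      using s0 by (intro order_tendstoD(1)[of _ "s0 + s0 + s1 * 0"]) auto
    then show ?thesis by eventually_elim simp
  qed
  have evp: "\<forall>\<^sub>F x in at 0. p x \<noteq> 0"
  proof -
    have "\<forall>\<^sub>F x in at 0. p x > 0"
      using plim s0 by (intro order_tendstoD(1)[of _ "2 * s0\<^sup>2"]) auto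
    then show ?thesis by eventually_elim simp
  qed
  have "\<forall>\<^sub>F x in at 0. E x = (h x - h 0 - (- 2 * s1 / s0^3) * x) / x\<^sup>2"
    using evx evSp evp
  proof eventually_elim
    case (elim x)
    then have x: "x \<noteq> 0" "\<bar>x\<bar> < \<delta>" and yx: "y x \<noteq> 0" using y0 by auto
    have xS: "x = S x * y x" "S x \<noteq> 0" using yx x by (auto simp: S_def)
    have x2: "x\<^sup>2 = (S x)\<^sup>2 * (y x)\<^sup>2" using arg_cong[OF xS(1), of "\<lambda>u. u\<^sup>2"] by (simp only: power_mult_distrib)
    have "A (H x) * (y x)^4 = x\<^sup>2 - s0\<^sup>2 * (y x)\<^sup>2 - 2 * s0 * s1 * (y x)^3 - D4 / 24 * (y x)^4"
      using yx PH[OF x(2)] by (simp add: A_def y_def p2 p3)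
    then have "(A (H x) * (y x)\<^sup>2) * (y x)\<^sup>2 = ((S x)\<^sup>2 - s0\<^sup>2 - 2 * s0 * s1 * y x - D4 / 24 * (y x)\<^sup>2) * (y x)\<^sup>2"
      unfolding x2 by (simp add: algebra_simps power2_eq_square power3_eq_cube power4_eq_xxxx)
    then have "A (H x) * (y x)\<^sup>2 = (S x)\<^sup>2 - s0\<^sup>2 - 2 * s0 * s1 * y x - D4 / 24 * (y x)\<^sup>2"
      using yx by (simp only: mult_right_cancel power_not_zero not_False_eq_True)
    then have Aq: "(S x)\<^sup>2 = s0\<^sup>2 + 2 * s0 * s1 * y x + (D4 / 24 + A (H x)) * (y x)\<^sup>2"
      by (simp add: algebra_simps)
    have "B (H x) * (y x)^3 = P1 (H x) - 2 * s0\<^sup>2 * y x - 6 * s0 * s1 * (y x)\<^sup>2 - D4 / 6 * (y x)^3"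
      using yx by (simp add: B_def y_def p2 p3)
    then have P1y: "P1 (H x) = p x * y x"
      by (simp add: p_def algebra_simps power2_eq_square power3_eq_cube)
    have "p x * y x * h x = 2 * (S x * y x)"
      using P1H[OF x(2)] unfolding P1y by (simp only: xS(1)[symmetric])
    then have ph: "h x = 2 * S x / p x" using yx elim by (simp add: field_simps)
    have "(S x - s0 - s1 * y x) * (S x + s0 + s1 * y x) = (D4 / 24 + A (H x) - s1\<^sup>2) * (y x)\<^sup>2"
      using Aq by (simp add: algebra_simps power2_eq_square)
    then have SR: "S x = s0 + s1 * y x + R x * (y x)\<^sup>2"
      using elim by (simp add: R_def field_simps)
    have SpG: "S x * p x = 2 * s0^3 + y x * G x"
    proof -
      have "S x * p x = S x * (2 * s0\<^sup>2) + y x * (S x * (6 * s0 * s1 + (D4 / 6 + B (H x)) * y x))"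
        by (simp add: p_def algebra_simps power2_eq_square)
      also have "S x * (2 * s0\<^sup>2) = 2 * s0^3 + y x * (2 * s0\<^sup>2 * (s1 + R x * y x))"
        by (subst SR) (simp add: algebra_simps power2_eq_square power3_eq_cube)
      finally show ?thesis by (simp add: G_def algebra_simps)
    qed
    \<comment> \<open>The terms linear in \<open>y\<close> cancel, which is what fixes the
      coefficient \<open>2 * s1 / s0^3\<close>; a factor \<open>y^2\<close> can be taken out of the
      rest.\<close>
    have *: "2 * S x - p x / s0 + 2 * s1 / s0^3 * (y x * (S x * p x))
        = (y x)\<^sup>2 * (2 * R x - (D4 / 6 + B (H x)) / s0 + 2 * s1 / s0^3 * G x)"
    proof -
      have "2 * S x - p x / s0 = - 4 * s1 * y x + (y x)\<^sup>2 * (2 * R x - (D4 / 6 + B (H x)) / s0)"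
        using s0 by (subst SR) (simp add: p_def field_simps power2_eq_square)
      moreover have "2 * s1 / s0^3 * (y x * (S x * p x)) = 4 * s1 * y x + (y x)\<^sup>2 * (2 * s1 / s0^3 * G x)"
        unfolding SpG using s0 by (simp add: field_simps power2_eq_square)
      ultimately show ?thesis by (simp add: algebra_simps)
    qed
    have "h x - h 0 - (- 2 * s1 / s0^3) * x
        = (2 * S x - p x / s0 + 2 * s1 / s0^3 * (y x * (S x * p x))) / p x"
    proof -
      have "(- 2 * s1 / s0^3) * x = (- 2 * s1 / s0^3) * (S x * y x)" by (simp only: xS(1)[symmetric])
      then show ?thesis unfolding ph h0' using elim s0 by (simp add: field_simps)
    qed
    also have "\<dots> = (y x)\<^sup>2 * (2 * R x - (D4 / 6 + B (H x)) / s0 + 2 * s1 / s0^3 * G x) / p x"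
      by (simp only: *)
    also have "\<dots> = E x * x\<^sup>2"
      unfolding x2 using elim xS(2) by (simp add: E_def field_simps)
    finally show ?case using x by simp
  qed
  then have "((\<lambda>x. (h x - h 0 - (- 2 * s1 / s0^3) * x) / x\<^sup>2) \<longlongrightarrow> (15 * s1\<^sup>2 - D4 / 8) / (2 * s0^5)) (at 0)"
    by (rule Lim_transform_eventually[OF Elim])
  then have "(15 * s1\<^sup>2 - D4 / 8) / (2 * s0^5) = 0"
    using isochronous_second_order[OF \<open>\<delta> > 0\<close> ch iso] by blast
  then have "D4 = 120 * s1\<^sup>2" using s0 by simp
  then show ?thesis by (simp add: p2 p3 power_mult_distrib)
qed

section \<open>The equations of motion\<close>

lemma central_potentialD:
  assumes "central_potential V" "r > 0"
  shows "(V has_real_derivative deriv V r) (at r)"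
    "(deriv V has_real_derivative deriv (deriv V) r) (at r)"
    "isCont (deriv (deriv V)) r"
proof -
  have "V differentiable (at r)" "deriv V differentiable (at r)" "deriv (deriv V) differentiable (at r)"
    using assms(1)[unfolded central_potential_def, THEN spec[of _ 0]]
      assms(1)[unfolded central_potential_def, THEN spec[of _ 1]]
      assms(1)[unfolded central_potential_def, THEN spec[of _ 2]] assms(2)
    by (auto simp: numeral_2_eq_2)
  then show "(V has_real_derivative deriv V r) (at r)"
    "(deriv V has_real_derivative deriv (deriv V) r) (at r)"
    "isCont (deriv (deriv V)) r"
    by (auto simp: DERIV_deriv_iff_real_differentiable differentiable_imp_continuous_within)
qed

lemma deriv_lagrangian:
  "deriv (\<lambda>v. lagrangian \<xi> V r p v w) v = v"
  "deriv (\<lambda>w. lagrangian \<xi> V r p v w) w = \<xi>\<^sup>2 * r\<^sup>2 * w"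
  "deriv (\<lambda>x. lagrangian \<xi> V r x v w) p = 0"
  "(V has_real_derivative V') (at r) \<Longrightarrow> deriv (\<lambda>x. lagrangian \<xi> V x p v w) r = \<xi>\<^sup>2 * r * w\<^sup>2 - V'"
  unfolding lagrangian_def cone_profile_def
  by (auto intro!: DERIV_imp_deriv derivative_eq_intros simp: power_mult_distrib power2_eq_square)

lemma solution_iff:
  assumes "central_potential V"
  shows "solution \<xi> V I r \<phi> \<longleftrightarrow> open I \<and> is_interval I \<and> I \<noteq> {} \<and>
     (\<forall>t\<in>I. r t > 0 \<and> r differentiable (at t) \<and> \<phi> differentiable (at t) \<and>
       (deriv r has_real_derivative \<xi>\<^sup>2 * r t * (deriv \<phi> t)\<^sup>2 - deriv V (r t)) (at t) \<and>
       ((\<lambda>s. \<xi>\<^sup>2 * (r s)\<^sup>2 * deriv \<phi> s) has_real_derivative 0) (at t))"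
  unfolding solution_def deriv_lagrangian(1-3)
  by (auto simp: deriv_lagrangian(4)[OF central_potentialD(1)[OF assms]])

text \<open>Conservation of \<open>K\<close> eliminates the angular velocity: the radius moves under
  the centrifugal force \<open>K^2/(\<xi>^2 r^3)\<close> minus \<open>V'\<close>, and the angle
  follows by integration. The equivalence serves both to analyse given motions and to certify
  constructed ones.\<close>

lemma reduced_iff:
  assumes "\<xi> > 0" "central_potential V"
  shows "solution \<xi> V I r \<phi> \<and> has_angular_momentum \<xi> I r \<phi> K \<longleftrightarrow>
    open I \<and> is_interval I \<and> I \<noteq> {} \<and>
     (\<forall>t\<in>I. r t > 0 \<and> (r has_real_derivative deriv r t) (at t) \<and>
       (\<phi> has_real_derivative K / (\<xi>\<^sup>2 * (r t)\<^sup>2)) (at t) \<and>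
       (deriv r has_real_derivative K\<^sup>2 / (\<xi>\<^sup>2 * (r t)^3) - deriv V (r t)) (at t))"
    (is "?L \<longleftrightarrow> ?R")
proof
  assume L: ?L
  then have I: "open I" "is_interval I" "I \<noteq> {}" by (auto simp: solution_def)
  have "r t > 0 \<and> (r has_real_derivative deriv r t) (at t) \<and>
       (\<phi> has_real_derivative K / (\<xi>\<^sup>2 * (r t)\<^sup>2)) (at t) \<and>
       (deriv r has_real_derivative K\<^sup>2 / (\<xi>\<^sup>2 * (r t)^3) - deriv V (r t)) (at t)" if "t \<in> I" for t
  proof -
    have t: "r t > 0" "r differentiable (at t)" "\<phi> differentiable (at t)"
      "(deriv r has_real_derivative \<xi>\<^sup>2 * r t * (deriv \<phi> t)\<^sup>2 - deriv V (r t)) (at t)"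
      "\<xi>\<^sup>2 * (r t)\<^sup>2 * deriv \<phi> t = K"
      using L that by (auto simp: solution_iff[OF assms(2)] has_angular_momentum_def cone_profile_def power_mult_distrib)
    have dp: "deriv \<phi> t = K / (\<xi>\<^sup>2 * (r t)\<^sup>2)" using t(1,5) assms(1) by (auto simp: field_simps)
    have "\<xi>\<^sup>2 * r t * (deriv \<phi> t)\<^sup>2 = K\<^sup>2 / (\<xi>\<^sup>2 * (r t)^3)"
      unfolding dp using t(1) assms(1) by (simp add: field_simps power2_eq_square power3_eq_cube)
    with t dp show ?thesis by (metis DERIV_deriv_iff_real_differentiable)
  qed
  with I show ?R by blast
next
  assume R: ?R
  have dp: "deriv \<phi> t = K / (\<xi>\<^sup>2 * (r t)\<^sup>2)" if "t \<in> I" for t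
    using R that by (auto intro: DERIV_imp_deriv)
  have am: "\<xi>\<^sup>2 * (r t)\<^sup>2 * deriv \<phi> t = K" if "t \<in> I" for t
    unfolding dp[OF that] using R that assms(1) by auto
  have "r t > 0 \<and> r differentiable (at t) \<and> \<phi> differentiable (at t) \<and>
       (deriv r has_real_derivative \<xi>\<^sup>2 * r t * (deriv \<phi> t)\<^sup>2 - deriv V (r t)) (at t) \<and>
       ((\<lambda>s. \<xi>\<^sup>2 * (r s)\<^sup>2 * deriv \<phi> s) has_real_derivative 0) (at t)" if t: "t \<in> I" for t
  proof -
    have rt: "r t > 0" using R t by auto
    have "\<xi>\<^sup>2 * r t * (deriv \<phi> t)\<^sup>2 = K\<^sup>2 / (\<xi>\<^sup>2 * (r t)^3)"
      unfolding dp[OF t] using rt assms(1) by (simp add: field_simps power2_eq_square power3_eq_cube)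
    moreover have "\<forall>\<^sub>F s in nhds t. K = \<xi>\<^sup>2 * (r s)\<^sup>2 * deriv \<phi> s"
      using eventually_nhds_in_open[of I t] R t by (auto elim!: eventually_mono simp: am)
    then have "((\<lambda>s. \<xi>\<^sup>2 * (r s)\<^sup>2 * deriv \<phi> s) has_real_derivative 0) (at t)"
      using DERIV_cong_ev[OF refl _ refl, of "\<lambda>_. K" "\<lambda>s. \<xi>\<^sup>2 * (r s)\<^sup>2 * deriv \<phi> s" t 0] by simp
    moreover have "r differentiable (at t)" "\<phi> differentiable (at t)"
      using R t by (auto simp: real_differentiable_def)
    ultimately show ?thesis using R t rt by simp
  qed
  with R am show ?L
    by (auto simp: solution_iff[OF assms(2)] has_angular_momentum_def cone_profile_def power_mult_distrib)
qed

text \<open>A construction supplies a velocity \<open>v\<close> that agrees with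
  \<open>deriv r\<close> on \<open>I\<close>; openness of \<open>I\<close> makes this agreement hold
  near each time, so the second derivative carries over.\<close>

lemma reduced_solutionI:
  assumes "\<xi> > 0" "central_potential V" and I: "open I" "is_interval I" "I \<noteq> {}"
    and pos: "\<And>t. t \<in> I \<Longrightarrow> r t > 0"
    and dr: "\<And>t. t \<in> I \<Longrightarrow> (r has_real_derivative v t) (at t)"
    and dphi: "\<And>t. t \<in> I \<Longrightarrow> (\<phi> has_real_derivative K / (\<xi>\<^sup>2 * (r t)\<^sup>2)) (at t)"
    and dv: "\<And>t. t \<in> I \<Longrightarrow> (v has_real_derivative K\<^sup>2 / (\<xi>\<^sup>2 * (r t)^3) - deriv V (r t)) (at t)"
  shows "solution \<xi> V I r \<phi>" "has_angular_momentum \<xi> I r \<phi> K"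
proof -
  have "(r has_real_derivative deriv r t) (at t) \<and>
     (deriv r has_real_derivative K\<^sup>2 / (\<xi>\<^sup>2 * (r t)^3) - deriv V (r t)) (at t)" if t: "t \<in> I" for t
  proof -
    have ev: "\<forall>\<^sub>F s in nhds t. deriv r s = v s"
      using eventually_nhds_in_open[OF I(1) t] by eventually_elim (auto intro: DERIV_imp_deriv dr)
    have "(deriv r has_real_derivative K\<^sup>2 / (\<xi>\<^sup>2 * (r t)^3) - deriv V (r t)) (at t)"
      using DERIV_cong_ev[OF refl ev refl] dv[OF t] by blast
    then show ?thesis using dr[OF t] DERIV_imp_deriv[OF dr[OF t]] by simp
  qed
  then show "solution \<xi> V I r \<phi>" "has_angular_momentum \<xi> I r \<phi> K"
    using reduced_iff[OF assms(1,2), of I r \<phi> K] I pos dphi by auto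
qed

lemma solution_UNIV_trajectory: "solution \<xi> V UNIV r \<phi> \<Longrightarrow> trajectory \<xi> V UNIV r \<phi>"
  by (auto simp: trajectory_def)

lemma solution_angular_momentum:
  assumes "central_potential V" "solution \<xi> V I r \<phi>"
  obtains K where "has_angular_momentum \<xi> I r \<phi> K"
proof -
  have I: "is_interval I" and
    d: "\<And>t. t \<in> I \<Longrightarrow> ((\<lambda>s. \<xi>\<^sup>2 * (r s)\<^sup>2 * deriv \<phi> s) has_real_derivative 0) (at t)"
    using assms by (auto simp: solution_iff)
  have "\<exists>c. \<forall>t\<in>I. \<xi>\<^sup>2 * (r t)\<^sup>2 * deriv \<phi> t = c"
    by (rule has_field_derivative_zero_constant)
      (use I d in \<open>auto simp: is_interval_convex_1 intro: has_field_derivative_at_within\<close>)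
  then show ?thesis using that by (auto simp: has_angular_momentum_def cone_profile_def power_mult_distrib)
qed

lemma range_cis_affine:
  assumes "k \<noteq> 0"
  shows "range (\<lambda>t::real. cis (k * t)) = sphere 0 1"
proof
  show "range (\<lambda>t. cis (k * t)) \<subseteq> sphere 0 1" by auto
  show "sphere 0 1 \<subseteq> range (\<lambda>t. cis (k * t))"
  proof
    fix z :: complex assume "z \<in> sphere 0 1"
    then have "z \<noteq> 0" "norm z = 1" by auto
    then have "cis (Arg z) = z" by (simp add: cis_Arg sgn_eq)
    then have "z = cis (k * (Arg z / k))" using assms by simp
    then show "z \<in> range (\<lambda>t. cis (k * t))" by blast
  qed
qed

text \<open>The condition on \<open>K\<close> is the balance of centrifugal and central force at
  \<open>r0\<close>.\<close>

lemma circular_solution: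
  assumes "\<xi> > 0" "central_potential V" "r0 > 0" "K\<^sup>2 = \<xi>\<^sup>2 * r0^3 * deriv V r0" "K \<noteq> 0"
  defines "\<phi> \<equiv> \<lambda>t. K / (\<xi>\<^sup>2 * r0\<^sup>2) * t"
  shows "trajectory \<xi> V UNIV (\<lambda>_. r0) \<phi>" "orbit UNIV (\<lambda>_. r0) \<phi> = circle r0"
    "has_angular_momentum \<xi> UNIV (\<lambda>_. r0) \<phi> K" "closed_motion UNIV (\<lambda>_. r0) \<phi>"
proof -
  have K: "K\<^sup>2 / (\<xi>\<^sup>2 * r0^3) = deriv V r0" unfolding assms(4) using assms(1,3) by simp
  have d: "(\<phi> has_real_derivative K / (\<xi>\<^sup>2 * r0\<^sup>2)) (at t)" for t
    unfolding \<phi>_def by (rule DERIV_cmult_Id)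
  have *: "solution \<xi> V UNIV (\<lambda>_. r0) \<phi>" "has_angular_momentum \<xi> UNIV (\<lambda>_. r0) \<phi> K"
    using reduced_solutionI[OF assms(1,2), of UNIV "\<lambda>_. r0" "\<lambda>_. 0" \<phi> K] assms(3) d by (simp_all add: K)
  then show "trajectory \<xi> V UNIV (\<lambda>_. r0) \<phi>" "has_angular_momentum \<xi> UNIV (\<lambda>_. r0) \<phi> K"
    using solution_UNIV_trajectory by auto
  have k: "K / (\<xi>\<^sup>2 * r0\<^sup>2) \<noteq> 0" using assms by simp
  show "orbit UNIV (\<lambda>_. r0) \<phi> = circle r0"
    unfolding orbit_def circle_def \<phi>_def range_cis_affine[OF k, symmetric] by auto
  define a where "a = K / (\<xi>\<^sup>2 * r0\<^sup>2)"
  define T where "T = 2 * pi / \<bar>a\<bar>"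
  have T: "T > 0" using k by (auto simp: T_def a_def)
  \<comment> \<open>The two alternatives are the two senses of rotation.\<close>
  have "a * T = 2 * pi \<or> a * T = - (2 * pi)" using k by (cases "a > 0") (auto simp: T_def a_def[symmetric])
  then have "cis (a * T) = 1" by (metis cis_2pi cis_cnj complex_cnj_one)
  then have "cis (\<phi> (t + T)) = cis (\<phi> t)" for t
    by (simp add: \<phi>_def distrib_left flip: cis_mult a_def)
  then show "closed_motion UNIV (\<lambda>_. r0) \<phi>" using T(1) by (auto simp: closed_motion_def)
qed

section \<open>Motion in a nondegenerate well\<close>

text \<open>In terms of \<open>z = 1/r\<close> and with \<open>\<phi>\<close> as time, the motion with angular momentum \<open>K\<close> is that of a
  unit mass in the potential \<open>P(z) = \<xi>\<^sup>2 z\<^sup>2 / 2 + \<xi>\<^sup>4 V(1/z) / K\<^sup>2\<close>; \<open>force\<close> says that \<open>x\<close> with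
  \<open>z = H x\<close> is the coordinate for which \<open>P = const + x\<^sup>2\<close>. Orbits are \<open>x = \<mu> sin \<theta>\<close>.\<close>

locale cone_well =
  fixes \<xi> :: real and V :: "real \<Rightarrow> real" and r0 K \<delta> :: real and H h :: "real \<Rightarrow> real"
  assumes xi: "\<xi> > 0" and central: "central_potential V" and r0: "r0 > 0" and K: "K > 0"
    and delta: "\<delta> > 0" and H0: "H 0 = 1 / r0"
    and ch: "continuous_on {-\<delta><..<\<delta>} h"
    and dH: "\<And>x. \<bar>x\<bar> < \<delta> \<Longrightarrow> (H has_real_derivative h x) (at x)"
    and hpos: "\<And>x. \<bar>x\<bar> < \<delta> \<Longrightarrow> h x > 0"
    and Hpos: "\<And>x. \<bar>x\<bar> < \<delta> \<Longrightarrow> H x > 0"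
    and force: "\<And>x. \<bar>x\<bar> < \<delta> \<Longrightarrow>
      (\<xi>\<^sup>2 * H x - \<xi>^4 / K\<^sup>2 * deriv V (1 / H x) / (H x)\<^sup>2) * h x = 2 * x"
begin

text \<open>The angle swept during one radial oscillation, while the phase grows by
  \<open>2 pi\<close>. The square root comes from the energy law
  \<open>z'^2 / 2 + x^2 = \<mu>^2\<close> with \<open>z' = h x'\<close> and
  \<open>x = \<mu> sin \<theta>\<close>, which gives
  \<open>d\<phi>/d\<theta> = h / sqrt 2\<close>.\<close>

definition period :: "real \<Rightarrow> real" where
  "period \<mu> = integral {0..2*pi} (\<lambda>s. h (\<mu> * sin s)) / sqrt 2"

lemma H_less:
  assumes "\<bar>x\<bar> < \<delta>" "\<bar>y\<bar> < \<delta>" "x < y"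
  shows "H x < H y"
proof (rule DERIV_pos_imp_increasing[OF \<open>x < y\<close>, of H])
  fix t assume "x \<le> t" "t \<le> y"
  then have "\<bar>t\<bar> < \<delta>" using assms by auto
  then show "\<exists>y. (H has_real_derivative y) (at t) \<and> y > 0" using dH hpos by blast
qed

lemma H_inj: "\<bar>x\<bar> < \<delta> \<Longrightarrow> \<bar>y\<bar> < \<delta> \<Longrightarrow> H x = H y \<Longrightarrow> x = y"
  using H_less[of x y] H_less[of y x] by (cases x y rule: linorder_cases) simp_all

text \<open>The phase \<open>\<theta>\<close> is the independent variable: angle and time are
  antiderivatives in it, and inverting time gives the motion. Amplitude 0, that is the circle, is
  included, and the initial phase and angle are free, so that any initial state near the circle can
  be matched.\<close>

lemma well_orbit:
  assumes mu: "0 \<le> \<mu>" "\<mu> < \<delta>"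
  obtains \<theta> r \<phi> F where
    "\<And>t. r t = 1 / H (\<mu> * sin (\<theta> t))"
    "\<And>t. (r has_real_derivative - (sqrt 2 * K / \<xi>\<^sup>2 * \<mu> * cos (\<theta> t))) (at t)"
    "solution \<xi> V UNIV r \<phi>" "has_angular_momentum \<xi> UNIV r \<phi> K"
    "\<theta> t0 = \<theta>0" "\<phi> t0 = \<phi>0" "strict_mono \<theta>" "surj \<theta>"
    "\<And>t. \<phi> t = F (\<theta> t)" "\<And>x. F (x + 2 * pi) = F x + period \<mu>"
proof -
  have ms: "\<bar>\<mu> * sin x\<bar> < \<delta>" for x using mu by (intro abs_mult_sin_less) auto
  have cH: "continuous_on {-\<delta><..<\<delta>} H"
    using dH by (meson DERIV_isCont abs_less_iff continuous_at_imp_continuous_on greaterThanLessThan_iff minus_less_iff)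
  have ms': "\<mu> * sin x \<in> {-\<delta><..<\<delta>}" for x using ms[of x] by auto
  have chs: "continuous_on A (\<lambda>x. h (\<mu> * sin x))" and cHs: "continuous_on A (\<lambda>x. H (\<mu> * sin x))" for A
    by (rule continuous_on_compose2[OF ch] continuous_on_compose2[OF cH];
        use ms' in \<open>auto intro!: continuous_intros\<close>)+
  \<comment> \<open>\<open>f\<close> is \<open>d\<phi>/d\<theta>\<close>, and \<open>g\<close> below
    is \<open>dt/d\<theta>\<close>, obtained from \<open>f\<close> through
    \<open>d\<phi>/dt = K z^2 / \<xi>^2\<close>.\<close>
  define f where "f x = h (\<mu> * sin x) / sqrt 2" for x
  define g where "g x = f x * \<xi>\<^sup>2 / (K * (H (\<mu> * sin x))\<^sup>2)" for x
  have cf: "continuous_on A f" for A unfolding f_def by (intro continuous_intros chs) auto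
  have cg: "continuous_on A g" for A unfolding g_def
    using Hpos[OF ms] K by (intro continuous_intros cf cHs) (auto simp: less_imp_neq[THEN not_sym])
  obtain F where F: "\<And>x. (F has_real_derivative f x) (at x)" "F \<theta>0 = \<phi>0"
    using antiderivative_exists[OF cf[of UNIV]] by blast
  obtain G where G: "\<And>x. (G has_real_derivative g x) (at x)" "G \<theta>0 = t0"
    using antiderivative_exists[OF cg[of UNIV]] by blast
  have gpos: "g x > 0" for x
    unfolding g_def f_def by (intro divide_pos_pos mult_pos_pos hpos[OF ms] zero_less_power Hpos[OF ms] K xi) simp
  \<comment> \<open>A positive continuous periodic function has a positive minimum, so time runs
    over the whole line.\<close>
  have "\<exists>x\<in>{0..2*pi}. \<forall>y\<in>{0..2*pi}. g x \<le> g y"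
    by (rule continuous_attains_inf[OF compact_Icc _ cg]) simp
  then obtain x1 where x1: "\<And>x. x \<in> {0..2*pi} \<Longrightarrow> g x1 \<le> g x" by blast
  have "g x1 \<le> g x" for x
  proof -
    obtain n where "x - 2 * pi * of_int n \<in> {0..2*pi}"
    proof
      show "x - 2 * pi * of_int \<lfloor>x / (2*pi)\<rfloor> \<in> {0..2*pi}"
        using floor_divide_lower[of "2*pi" x] floor_divide_upper[of "2*pi" x] by (auto simp: algebra_simps)
    qed
    moreover have "\<exists>m. x - 2 * pi * of_int n = x + 2 * pi * of_int m" by (rule exI[of _ "- n"]) simp
    then have "sin (x - 2 * pi * of_int n) = sin x" using sin_cos_eq_iff by blast
    then have "g (x - 2 * pi * of_int n) = g x" by (simp add: g_def f_def)
    ultimately show ?thesis using x1 by metis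
  qed
  then have surjG: "range G = UNIV" using increasing_surj[OF G(1) gpos] by blast
  note diffeo = increasing_diffeo[OF G(1) gpos]
  define \<theta> where "\<theta> = inv G"
  have G\<theta>: "G (\<theta> t) = t" for t using surjG by (simp add: \<theta>_def f_inv_into_f)
  have \<theta>G: "\<theta> (G x) = x" for x using diffeo(2) by (simp add: \<theta>_def inv_f_f)
  have d\<theta>: "(\<theta> has_real_derivative inverse (g (\<theta> t))) (at t)" for t
    using diffeo(5)[of "\<theta> t"] by (simp add: G\<theta> flip: \<theta>_def)
  define r where "r t = 1 / H (\<mu> * sin (\<theta> t))" for t
  define \<phi> where "\<phi> t = F (\<theta> t)" for t
  \<comment> \<open>From \<open>z = 1/r\<close> the radial velocity is \<open>- K / \<xi>^2\<close>
    times \<open>dz/d\<phi>\<close>, and the energy law gives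
    \<open>dz/d\<phi> = sqrt 2 * \<mu> * cos \<theta>\<close>.\<close>
  define v where "v t = - (sqrt 2 * K / \<xi>\<^sup>2 * \<mu> * cos (\<theta> t))" for t
  have sq2: "sqrt 2 * sqrt 2 = (2::real)" by simp
  have inv_g: "inverse (g x) = sqrt 2 * K * (H (\<mu> * sin x))\<^sup>2 / (h (\<mu> * sin x) * \<xi>\<^sup>2)" for x
    using hpos[OF ms[of x]] Hpos[OF ms[of x]] K xi by (simp add: g_def f_def field_simps)
  have dr: "(r has_real_derivative v t) (at t)" for t
  proof -
    let ?x = "\<mu> * sin (\<theta> t)"
    have x: "\<bar>?x\<bar> < \<delta>" by (rule ms)
    have 1: "((\<lambda>t. \<mu> * sin (\<theta> t)) has_real_derivative \<mu> * (cos (\<theta> t) * inverse (g (\<theta> t)))) (at t)"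
      by (auto intro!: derivative_eq_intros d\<theta>)
    have 2: "((\<lambda>t. H (\<mu> * sin (\<theta> t))) has_real_derivative h ?x * (\<mu> * (cos (\<theta> t) * inverse (g (\<theta> t))))) (at t)"
      using DERIV_chain2[OF dH[OF x] 1] .
    have 3: "((\<lambda>t. inverse (H (\<mu> * sin (\<theta> t)))) has_real_derivative
       - (inverse (H ?x) * (h ?x * (\<mu> * (cos (\<theta> t) * inverse (g (\<theta> t))))) * inverse (H ?x))) (at t)"
      using DERIV_inverse'[OF 2] Hpos[OF x] by simp
    have "- (inverse (H ?x) * (h ?x * (\<mu> * (cos (\<theta> t) * inverse (g (\<theta> t))))) * inverse (H ?x)) = v t"
      unfolding inv_g v_def using hpos[OF x] Hpos[OF x] xi by (simp add: field_simps power2_eq_square)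
    with 3 show ?thesis by (simp add: r_def[abs_def] inverse_eq_divide)
  qed
  have dphi: "(\<phi> has_real_derivative K / (\<xi>\<^sup>2 * (r t)\<^sup>2)) (at t)" for t
  proof -
    let ?x = "\<mu> * sin (\<theta> t)"
    have "(\<phi> has_real_derivative f (\<theta> t) * inverse (g (\<theta> t))) (at t)"
      unfolding \<phi>_def[abs_def] using DERIV_chain2[OF F(1) d\<theta>] .
    moreover have "f (\<theta> t) * inverse (g (\<theta> t)) = K / (\<xi>\<^sup>2 * (r t)\<^sup>2)"
      unfolding inv_g f_def r_def using hpos[OF ms[of "\<theta> t"]] Hpos[OF ms[of "\<theta> t"]] xi by (simp add: field_simps)
    ultimately show ?thesis by simp
  qed
  have dv: "(v has_real_derivative K\<^sup>2 / (\<xi>\<^sup>2 * (r t)^3) - deriv V (r t)) (at t)" for t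
  proof -
    let ?x = "\<mu> * sin (\<theta> t)"
    have x: "\<bar>?x\<bar> < \<delta>" by (rule ms)
    have "(v has_real_derivative sqrt 2 * K / \<xi>\<^sup>2 * \<mu> * (sin (\<theta> t) * inverse (g (\<theta> t)))) (at t)"
    proof -
      have "((\<lambda>t. - cos (\<theta> t)) has_real_derivative sin (\<theta> t) * inverse (g (\<theta> t))) (at t)"
        by (auto intro!: derivative_eq_intros d\<theta>)
      from DERIV_cmult[OF this, of "sqrt 2 * K / \<xi>\<^sup>2 * \<mu>"] show ?thesis
        by (simp add: v_def[abs_def] mult.assoc)
    qed
    moreover have "sqrt 2 * K / \<xi>\<^sup>2 * \<mu> * (sin (\<theta> t) * inverse (g (\<theta> t)))
        = (2 * ?x / h ?x) * (K\<^sup>2 * (H ?x)\<^sup>2 / \<xi>^4)"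
      unfolding inv_g using hpos[OF x] xi by (simp add: field_simps power2_eq_square eval_nat_numeral)
    moreover have "2 * ?x / h ?x = \<xi>\<^sup>2 * H ?x - \<xi>^4 / K\<^sup>2 * deriv V (1 / H ?x) / (H ?x)\<^sup>2"
      using force[OF x] hpos[OF x] by (simp add: field_simps)
    moreover have "(\<xi>\<^sup>2 * H ?x - \<xi>^4 / K\<^sup>2 * deriv V (1 / H ?x) / (H ?x)\<^sup>2) * (K\<^sup>2 * (H ?x)\<^sup>2 / \<xi>^4)
        = K\<^sup>2 / (\<xi>\<^sup>2 * (r t)^3) - deriv V (r t)"
      unfolding r_def using Hpos[OF x] K xi by (simp add: field_simps eval_nat_numeral)
    ultimately show ?thesis by simp
  qed
  have sol: "solution \<xi> V UNIV r \<phi>" "has_angular_momentum \<xi> UNIV r \<phi> K"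
    using reduced_solutionI[OF xi central, of UNIV r v \<phi> K] dr dphi dv Hpos[OF ms] by (simp_all add: r_def)
  have "strict_mono \<theta>"
    by (rule strict_monoI) (metis G\<theta> diffeo(1) strict_mono_less)
  moreover have "surj \<theta>" using \<theta>G by (metis surjI)
  moreover have "F (x + 2 * pi) = F x + period \<mu>" for x
  proof -
    have "((\<lambda>x. F (x + 2 * pi) - F x) has_real_derivative 0) (at x)" for x
    proof -
      have "((\<lambda>x. F (x + 2 * pi)) has_real_derivative f (x + 2 * pi) * 1) (at x)"
        by (rule DERIV_chain2[OF F(1)]) (auto intro!: derivative_eq_intros)
      from DERIV_diff[OF this F(1)[of x]] show ?thesis by (simp add: f_def)
    qed
    then have "F (x + 2 * pi) - F x = F (0 + 2 * pi) - F 0"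
      by (intro DERIV_isconst_all[of "\<lambda>x. F (x + 2 * pi) - F x"]) blast
    moreover have "(f has_integral F (2 * pi) - F 0) {0..2*pi}"
      by (rule fundamental_theorem_of_calculus)
        (use F(1) in \<open>auto intro: has_field_derivative_at_within simp flip: has_real_derivative_iff_has_vector_derivative\<close>)
    then have "F (2 * pi) - F 0 = period \<mu>"
      unfolding period_def by (simp add: f_def[abs_def] integral_unique flip: integral_divide)
    ultimately show ?thesis by simp
  qed
  ultimately show ?thesis
    using that[of r \<theta> \<phi> F] r_def dr sol G(2) \<theta>G F(2) by (metis \<phi>_def v_def)
qed

text \<open>Over a closing time the motion performs \<open>n > 0\<close> complete oscillations while
  the angle turns by an integer multiple of \<open>2 pi\<close>.\<close>

lemma closed_period_rational:
  assumes mu: "0 < \<mu>" "\<mu> < \<delta>"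
    and r: "\<And>t. r t = 1 / H (\<mu> * sin (\<theta> t))" and "strict_mono \<theta>" "surj \<theta>"
    and \<phi>: "\<And>t. \<phi> t = F (\<theta> t)" and F: "\<And>x. F (x + 2 * pi) = F x + period \<mu>"
    and "closed_motion UNIV r \<phi>"
  shows "period \<mu> / (2 * pi) \<in> \<rat>"
proof -
  obtain T where T: "T > 0" "\<And>t. r (t + T) = r t" "\<And>t. cis (\<phi> (t + T)) = cis (\<phi> t)"
    using assms by (auto simp: closed_motion_def)
  \<comment> \<open>The pericentre, where \<open>sin \<theta>\<close> is maximal. Intermediate radii
    occur at two phases of an oscillation, but this one at a single phase, so its return means a
    whole number of oscillations.\<close>
  obtain t where t: "\<theta> t = pi / 2" using \<open>surj \<theta>\<close> by (metis surjD)
  have ms: "\<bar>\<mu> * sin x\<bar> < \<delta>" for x using mu by (intro abs_mult_sin_less) auto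
  have "H (\<mu> * sin (\<theta> (t + T))) = H (\<mu> * sin (\<theta> t))" using T(2)[of t] by (simp add: r)
  then have "\<mu> * sin (\<theta> (t + T)) = \<mu> * sin (\<theta> t)" by (rule H_inj[OF ms ms])
  moreover have "sin (\<theta> t) = 1" unfolding t by simp
  ultimately have "sin (\<theta> (t + T)) = 1" using mu by simp
  then obtain n where "\<theta> (t + T) = (2 * real_of_int n + 1 / 2) * pi"
    by (auto simp: sin_eq_1)
  then have n: "\<theta> (t + T) = pi / 2 + 2 * pi * real_of_int n" by (simp add: algebra_simps)
  have "\<theta> (t + T) > \<theta> t" using \<open>strict_mono \<theta>\<close> T(1) by (simp add: strict_mono_def)
  then have "n > 0" using n t by (simp add: zero_less_mult_iff)
  have shift: "F (x + 2 * pi * real m) = F x + real m * period \<mu>" for x m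
  proof (induction m)
    case (Suc m)
    have "F (x + 2 * pi * real (Suc m)) = F (x + 2 * pi * real m + 2 * pi)" by (simp add: algebra_simps)
    also have "\<dots> = F (x + 2 * pi * real m) + period \<mu>" by (rule F)
    finally show ?case unfolding Suc by (simp add: algebra_simps)
  qed simp
  have "\<phi> (t + T) = \<phi> t + real_of_int n * period \<mu>"
    using shift[of "pi / 2" "nat n"] \<open>n > 0\<close> by (simp add: \<phi> n t)
  moreover obtain k where "\<phi> (t + T) = \<phi> t + 2 * pi * real_of_int k"
    using T(3)[of t] sin_cos_eq_iff[of "\<phi> (t + T)" "\<phi> t"] by (auto simp: complex_eq_iff)
  ultimately have "real_of_int n * period \<mu> = 2 * pi * real_of_int k" by simp
  then have "period \<mu> / (2 * pi) = real_of_int k / real_of_int n"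
    using \<open>n > 0\<close> by (simp add: field_simps)
  then show ?thesis by simp
qed

lemma well_orbit_trajectory:
  assumes mu: "0 < \<mu>" "\<mu> < \<delta>" and r: "\<And>t. r t = 1 / H (\<mu> * sin (\<theta> t))" and "surj \<theta>"
    and sol: "solution \<xi> V UNIV r \<phi>" "has_angular_momentum \<xi> UNIV r \<phi> K"
  shows "nonsingular_bounded \<xi> V UNIV r \<phi>" "\<not> circular UNIV r \<phi>"
    "orbit UNIV r \<phi> \<subseteq> annulus (1 / H \<mu>) (1 / H (- \<mu>))"
proof -
  have m: "\<bar>\<mu>\<bar> < \<delta>" "\<bar>- \<mu>\<bar> < \<delta>" using mu by auto
  have ms: "\<bar>\<mu> * sin x\<bar> < \<delta>" for x using mu by (intro abs_mult_sin_less) auto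
  have rb: "1 / H \<mu> \<le> r t \<and> r t \<le> 1 / H (- \<mu>)" for t
  proof -
    have "\<mu> * sin (\<theta> t) \<le> \<mu>" "- \<mu> \<le> \<mu> * sin (\<theta> t)"
      using mu sin_le_one[of "\<theta> t"] sin_ge_minus_one[of "\<theta> t"] mult_left_mono[of "sin (\<theta> t)" 1 \<mu>]
        mult_left_mono[of "-1" "sin (\<theta> t)" \<mu>] by auto
    then have "H (\<mu> * sin (\<theta> t)) \<le> H \<mu>" "H (- \<mu>) \<le> H (\<mu> * sin (\<theta> t))"
      using H_less[OF ms m(1), of "\<theta> t"] H_less[OF m(2) ms, of "\<theta> t"] by fastforce+
    then show ?thesis
      unfolding r using Hpos[OF m(1)] Hpos[OF m(2)] Hpos[OF ms, of "\<theta> t"] by (auto intro!: divide_left_mono mult_pos_pos)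
  qed
  then show sub: "orbit UNIV r \<phi> \<subseteq> annulus (1 / H \<mu>) (1 / H (- \<mu>))"
    by (auto simp: orbit_def annulus_def)
  have pos: "0 < 1 / H \<mu>" "1 / H \<mu> \<le> 1 / H (- \<mu>)" using Hpos[OF m(1)] rb[of 0] by auto
  have "\<not> singular \<xi> UNIV r \<phi>" using sol(2) K by (auto simp: singular_def has_angular_momentum_def)
  with sol sub pos show "nonsingular_bounded \<xi> V UNIV r \<phi>"
    unfolding nonsingular_bounded_def bounded_motion_def using solution_UNIV_trajectory by blast
  show "\<not> circular UNIV r \<phi>"
  proof
    assume "circular UNIV r \<phi>"
    then obtain c where "orbit UNIV r \<phi> = circle c" by (auto simp: circular_def)
    then have c: "r t = c" for t by (force simp: orbit_def circle_def)
    obtain t1 t2 where t: "\<theta> t1 = pi / 2" "\<theta> t2 = 0" using \<open>surj \<theta>\<close> by (metis surjD)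
    have "sin (\<theta> t1) = 1" "sin (\<theta> t2) = 0" unfolding t by simp_all
    then have "1 / H \<mu> = 1 / H 0" using c[of t1] c[of t2] by (simp add: r)
    then have "H \<mu> = H 0" by simp
    then show False using H_inj[of \<mu> 0] mu by auto
  qed
qed

text \<open>All well orbits carry the same \<open>K\<close> as the central circle, so the momentum
  window of \<open>closed_near\<close> is met automatically; continuity of \<open>H\<close> at 0
  puts small amplitudes into the annulus.\<close>

lemma closed_near_period_rational:
  assumes K2: "K\<^sup>2 = \<xi>\<^sup>2 * r0^3 * deriv V r0" and cn: "closed_near \<xi> V r0"
  obtains d where "0 < d" "d \<le> \<delta>" "\<And>\<mu>. 0 < \<mu> \<Longrightarrow> \<mu> < d \<Longrightarrow> period \<mu> / (2 * pi) \<in> \<rat>"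
proof -
  have "K \<noteq> 0" using K by simp
  note circ = circular_solution[OF xi central r0 K2 \<open>K \<noteq> 0\<close>]
  obtain \<epsilon> where \<epsilon>: "\<epsilon> > 0" "\<And>I r \<phi> K'. nonsingular_bounded \<xi> V I r \<phi> \<Longrightarrow>
      orbit I r \<phi> \<subseteq> annulus (r0 - \<epsilon>) (r0 + \<epsilon>) \<Longrightarrow> has_angular_momentum \<xi> I r \<phi> K' \<Longrightarrow>
      K' \<in> {K - \<epsilon><..<K + \<epsilon>} \<Longrightarrow> closed_motion I r \<phi>"
    using cn circ unfolding closed_near_def by meson
  have "isCont H 0" using dH[of 0] delta DERIV_isCont by auto
  then have "isCont (\<lambda>x. 1 / H x) 0" using H0 r0 by (intro continuous_intros) auto
  then obtain d where d: "d > 0" "\<And>x. \<bar>x\<bar> < d \<Longrightarrow> \<bar>1 / H x - r0\<bar> < \<epsilon>"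
    using \<open>\<epsilon> > 0\<close> unfolding continuous_at_eps_delta by (auto simp: H0 dist_real_def)
  show ?thesis
  proof (rule that[of "min d \<delta>"])
    fix \<mu> assume "0 < \<mu>" "\<mu> < min d \<delta>"
    then have mu: "0 < \<mu>" "0 \<le> \<mu>" "\<mu> < \<delta>" "\<mu> < d" by auto
    obtain \<theta> r \<phi> F where o: "\<And>t. r t = 1 / H (\<mu> * sin (\<theta> t))"
      "solution \<xi> V UNIV r \<phi>" "has_angular_momentum \<xi> UNIV r \<phi> K"
      "strict_mono \<theta>" "surj \<theta>"
      "\<And>t. \<phi> t = F (\<theta> t)" "\<And>x. F (x + 2 * pi) = F x + period \<mu>"
      by (rule well_orbit[OF mu(2,3)]) blast
    note tr = well_orbit_trajectory[OF mu(1,3) o(1,5,2,3)]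
    have "annulus (1 / H \<mu>) (1 / H (- \<mu>)) \<subseteq> annulus (r0 - \<epsilon>) (r0 + \<epsilon>)"
      using d(2)[of \<mu>] d(2)[of "-\<mu>"] mu by (auto simp: annulus_def)
    with tr(3) have "orbit UNIV r \<phi> \<subseteq> annulus (r0 - \<epsilon>) (r0 + \<epsilon>)" by blast
    then have "closed_motion UNIV r \<phi>" using \<epsilon>(2)[OF tr(1) _ o(3)] \<epsilon>(1) by auto
    then show "period \<mu> / (2 * pi) \<in> \<rat>"
      using closed_period_rational[OF mu(1,3) o(1,4,5,6,7)] by blast
  qed (use d delta in auto)
qed

text \<open>The admissible values of the integral are rational multiples of one fixed number, hence
  countable. Being constant, the period has its small-amplitude limit
  \<open>2 * pi * h 0 / sqrt 2\<close> as value, and that inherits rationality.\<close>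

lemma period_const:
  assumes d: "0 < d" "d \<le> \<delta>" and rat: "\<And>\<mu>. 0 < \<mu> \<Longrightarrow> \<mu> < d \<Longrightarrow> period \<mu> / (2 * pi) \<in> \<rat>"
    and mu: "0 < \<mu>" "\<mu> < d"
  shows "integral {0..2*pi} (\<lambda>s. h (\<mu> * sin s)) = 2 * pi * h 0" "h 0 / sqrt 2 \<in> \<rat>"
proof -
  define C where "C = (\<lambda>q. sqrt 2 * (2 * pi) * q) ` \<rat>"
  have C: "countable C" unfolding C_def by (intro countable_image countable_rat)
  have "integral {0..2*pi} (\<lambda>s. h (\<mu> * sin s)) \<in> C" if "0 < \<mu>" "\<mu> < d" for \<mu>
    unfolding C_def by (rule image_eqI[OF _ rat[OF that]]) (simp add: period_def)
  moreover have "continuous_on {-d<..<d} h" using ch by (rule continuous_on_subset) (use d in auto)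
  ultimately show *: "integral {0..2*pi} (\<lambda>s. h (\<mu> * sin s)) = 2 * pi * h 0"
    using period_integral_const[OF d(1) _ C _ mu] by blast
  show "h 0 / sqrt 2 \<in> \<rat>" using rat[OF mu] unfolding period_def * by simp
qed

end

section \<open>Stable circles, the power law and the two exponents\<close>

text \<open>\<open>r^3 V'\<close> is \<open>K^2/\<xi>^2\<close> for the circular motion of radius
  \<open>r\<close>. The conditions say that it is positive and, after division of its derivative by
  \<open>r^2\<close>, that it increases.\<close>

definition stable_radius :: "(real \<Rightarrow> real) \<Rightarrow> real \<Rightarrow> bool" where
  "stable_radius V r \<longleftrightarrow> r > 0 \<and> deriv V r > 0 \<and> r * deriv (deriv V) r + 3 * deriv V r > 0"

lemma well_potential_deriv:
  assumes V: "central_potential V" and "z > 0"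
  shows "((\<lambda>z. \<xi>\<^sup>2 * z\<^sup>2 / 2 + a * V (1 / z)) has_real_derivative \<xi>\<^sup>2 * z - a * deriv V (1 / z) / z\<^sup>2) (at z)"
proof -
  have "((\<lambda>z. V (1 / z)) has_real_derivative deriv V (1 / z) * (- 1 / z\<^sup>2)) (at z)"
    by (rule DERIV_chain2[OF central_potentialD(1)[OF V]])
      (use assms(2) in \<open>auto intro!: derivative_eq_intros simp: power2_eq_square\<close>)
  moreover have "((\<lambda>z. \<xi>\<^sup>2 * z\<^sup>2 / 2) has_real_derivative \<xi>\<^sup>2 * z) (at z)"
    by (auto intro!: derivative_eq_intros)
  ultimately have "((\<lambda>z. \<xi>\<^sup>2 * z\<^sup>2 / 2 + a * V (1 / z)) has_real_derivative
      \<xi>\<^sup>2 * z + a * (deriv V (1 / z) * (- 1 / z\<^sup>2))) (at z)"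
    by (intro DERIV_add DERIV_cmult)
  then show ?thesis by simp
qed

text \<open>For this \<open>K\<close> the point \<open>1/r0\<close> is critical for
  \<open>P\<close>, and the second derivative there is \<open>\<xi>^2 (3 + r0 V''/V')\<close>, which
  stability of the radius makes positive.\<close>

lemma cone_well_exists:
  assumes xi: "\<xi> > 0" and V: "central_potential V" and st: "stable_radius V r0"
  defines "K \<equiv> \<xi> * sqrt (r0^3 * deriv V r0)"
  defines "P \<equiv> \<lambda>z. \<xi>\<^sup>2 * z\<^sup>2 / 2 + \<xi>^4 / K\<^sup>2 * V (1 / z)"
  obtains \<delta> H h where "cone_well \<xi> V r0 K \<delta> H h"
    "h 0 = sqrt (2 / (\<xi>\<^sup>2 * (3 + r0 * deriv (deriv V) r0 / deriv V r0)))"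
    "\<And>x. \<bar>x\<bar> < \<delta> \<Longrightarrow> P (H x) = P (1 / r0) + x\<^sup>2" "K\<^sup>2 = \<xi>\<^sup>2 * r0^3 * deriv V r0" "K > 0"
proof -
  have r0: "r0 > 0" and V1: "deriv V r0 > 0" and V2: "r0 * deriv (deriv V) r0 + 3 * deriv V r0 > 0"
    using st by (auto simp: stable_radius_def)
  have K: "K > 0" "K\<^sup>2 = \<xi>\<^sup>2 * r0^3 * deriv V r0"
    using xi r0 V1 by (auto simp: K_def power_mult_distrib)
  define P1 where "P1 z = \<xi>\<^sup>2 * z - \<xi>^4 / K\<^sup>2 * deriv V (1 / z) / z\<^sup>2" for z
  define D where "D = \<xi>\<^sup>2 * (3 + r0 * deriv (deriv V) r0 / deriv V r0)"
  have "3 + r0 * deriv (deriv V) r0 / deriv V r0 = (r0 * deriv (deriv V) r0 + 3 * deriv V r0) / deriv V r0"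
    using V1 by (simp add: field_simps)
  then have D: "D > 0" unfolding D_def using xi V1 V2 by simp
  have dP: "(P has_real_derivative P1 z) (at z)" if "z > 0" for z
    unfolding P_def P1_def by (rule well_potential_deriv[OF V that])
  have dP1: "(P1 has_real_derivative \<xi>\<^sup>2 + \<xi>^4 / K\<^sup>2 * (deriv (deriv V) (1 / z) / z^4 + 2 * deriv V (1 / z) / z^3)) (at z)"
    if "z > 0" for z
  proof -
    have 1: "((\<lambda>z. deriv V (1 / z)) has_real_derivative deriv (deriv V) (1 / z) * (- 1 / z\<^sup>2)) (at z)"
      by (rule DERIV_chain2[OF central_potentialD(2)[OF V]])
        (use that in \<open>auto intro!: derivative_eq_intros simp: power2_eq_square\<close>)
    have "((\<lambda>z. deriv V (1 / z) / z\<^sup>2) has_real_derivative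
       (deriv (deriv V) (1 / z) * (- 1 / z\<^sup>2) * z\<^sup>2 - deriv V (1 / z) * (2 * z)) / (z\<^sup>2 * z\<^sup>2)) (at z)"
      by (rule DERIV_divide[OF 1]) (use that in \<open>auto intro!: derivative_eq_intros\<close>)
    from DERIV_diff[OF DERIV_cmult_Id[of "\<xi>\<^sup>2"] DERIV_cmult[OF this, of "\<xi>^4 / K\<^sup>2"]]
    have "((\<lambda>z. \<xi>\<^sup>2 * z - \<xi>^4 / K\<^sup>2 * (deriv V (1 / z) / z\<^sup>2)) has_real_derivative
      \<xi>\<^sup>2 - \<xi>^4 / K\<^sup>2 * ((deriv (deriv V) (1 / z) * (- 1 / z\<^sup>2) * z\<^sup>2 - deriv V (1 / z) * (2 * z)) / (z\<^sup>2 * z\<^sup>2))) (at z)" .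
    moreover have "(deriv (deriv V) (1 / z) * (- 1 / z\<^sup>2) * z\<^sup>2 - deriv V (1 / z) * (2 * z)) / (z\<^sup>2 * z\<^sup>2)
        = - (deriv (deriv V) (1 / z) / z^4 + 2 * deriv V (1 / z) / z^3)"
      using that by (simp add: field_simps eval_nat_numeral)
    moreover have "P1 = (\<lambda>z. \<xi>\<^sup>2 * z - \<xi>^4 / K\<^sup>2 * (deriv V (1 / z) / z\<^sup>2))" by (simp add: P1_def[abs_def])
    ultimately show ?thesis by (simp only: mult_minus_right diff_minus_eq_add)
  qed
  define z0 where "z0 = 1 / r0"
  have z0: "z0 > 0" "1 / z0 = r0" using r0 by (auto simp: z0_def)
  have P10: "P1 z0 = 0" unfolding P1_def z0(2) K(2) using xi r0 V1 by (simp add: z0_def field_simps eval_nat_numeral)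
  have "\<xi>\<^sup>2 + \<xi>^4 / K\<^sup>2 * (deriv (deriv V) (1 / z0) / z0^4 + 2 * deriv V (1 / z0) / z0^3) = D"
    unfolding z0(2) K(2) D_def using xi r0 V1 by (simp add: z0_def field_simps eval_nat_numeral)
  then have dP10: "(P1 has_real_derivative D) (at z0)" using dP1[OF z0(1)] by simp
  \<comment> \<open>Choosing \<open>z0\<close> itself as the size of the neighbourhood keeps
    \<open>z = 1/r\<close> positive.\<close>
  have near: "z > 0" if "\<bar>z - z0\<bar> < z0" for z using that by auto
  obtain \<delta> H h where w: "\<delta> > 0" "H 0 = z0" "h 0 = sqrt (2 / D)"
    "continuous_on {-\<delta><..<\<delta>} h"
    "\<And>x. \<bar>x\<bar> < \<delta> \<Longrightarrow> (H has_real_derivative h x) (at x)"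
    "\<And>x. \<bar>x\<bar> < \<delta> \<Longrightarrow> h x > 0"
    "\<And>x. \<bar>x\<bar> < \<delta> \<Longrightarrow> \<bar>H x - z0\<bar> < z0"
    "\<And>x. \<bar>x\<bar> < \<delta> \<Longrightarrow> P (H x) = P z0 + x\<^sup>2"
    "\<And>x. \<bar>x\<bar> < \<delta> \<Longrightarrow> P1 (H x) * h x = 2 * x"
    using well_coordinate[OF z0(1) dP[OF near] DERIV_isCont[OF dP1[OF near]] dP10 P10 D] by blast
  show ?thesis
  proof (rule that[of \<delta> H h])
    show "cone_well \<xi> V r0 K \<delta> H h"
      by unfold_locales (use xi V r0 K w near in \<open>auto simp: z0_def P1_def\<close>)
  qed (use w K in \<open>auto simp: D_def z0_def\<close>)
qed

text \<open>A critical point of the effective potential forces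
  \<open>K^2 = \<xi>^2 r0^3 V'(r0)\<close>, and then \<open>r0\<close> times its second derivative
  is \<open>r0 V'' + 3 V'\<close>.\<close>

lemma strongly_stable_iff:
  assumes xi: "\<xi> > 0" and V: "central_potential V"
  shows "strongly_stable \<xi> V r0 \<longleftrightarrow> stable_radius V r0"
proof -
  define U1 where "U1 K r = deriv V r - K\<^sup>2 / (\<xi>\<^sup>2 * r^3)" for K r
  define D where "D K = deriv (deriv V) r0 + 3 * K\<^sup>2 / (\<xi>\<^sup>2 * r0^4)" for K
  have dU: "(effective_potential \<xi> V K has_real_derivative U1 K r) (at r)" if "r > 0" for r K
    unfolding effective_potential_def[abs_def] cone_profile_def U1_def
    using central_potentialD(1)[OF V that] that xi
    by (auto intro!: derivative_eq_intros simp: field_simps eval_nat_numeral)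
  have dU1: "(U1 K has_real_derivative D K) (at r0)" if "r0 > 0" for K
    unfolding U1_def[abs_def] D_def
    using central_potentialD(2)[OF V that] that xi
    by (auto intro!: derivative_eq_intros simp: field_simps eval_nat_numeral)
  have ev: "\<forall>\<^sub>F r in nhds r0. (effective_potential \<xi> V K has_real_derivative U1 K r) (at r)" if "r0 > 0" for K
    using eventually_nhds_in_open[of "{0<..}" r0] that dU by (auto elim!: eventually_mono)
  have dd: "deriv (deriv (effective_potential \<xi> V K)) r0 = D K" if "r0 > 0" for K
  proof -
    have "\<forall>\<^sub>F r in nhds r0. deriv (effective_potential \<xi> V K) r = U1 K r"
      using ev[OF that, of K] by eventually_elim (rule DERIV_imp_deriv)
    then have "deriv (deriv (effective_potential \<xi> V K)) r0 = deriv (U1 K) r0"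
      by (intro deriv_cong_ev) auto
    then show ?thesis using DERIV_imp_deriv[OF dU1[OF that]] by simp
  qed
  show ?thesis
  proof
    assume "strongly_stable \<xi> V r0"
    then obtain K where r0: "r0 > 0" and "K \<noteq> 0"
      and n: "nondegenerate_local_min (effective_potential \<xi> V K) r0"
      by (auto simp: strongly_stable_def circular_orbit_def)
    from n have "D K \<noteq> 0" "\<forall>\<^sub>F y in at r0. effective_potential \<xi> V K r0 \<le> effective_potential \<xi> V K y"
      by (auto simp: nondegenerate_local_min_def dd[OF r0])
    then have U: "U1 K r0 = 0" "D K > 0"
      using local_min_iff_deriv[OF ev[OF r0] dU1[OF r0]] by auto
    then have V1: "deriv V r0 = K\<^sup>2 / (\<xi>\<^sup>2 * r0^3)" by (simp add: U1_def)
    then have "deriv V r0 > 0" using r0 xi \<open>K \<noteq> 0\<close> by simp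
    moreover have "r0 * D K = r0 * deriv (deriv V) r0 + 3 * deriv V r0"
      unfolding D_def V1 using r0 xi by (simp add: field_simps eval_nat_numeral)
    ultimately show "stable_radius V r0" using U(2) r0 by (metis stable_radius_def mult_pos_pos)
  next
    assume st: "stable_radius V r0"
    then have r0: "r0 > 0" and V1: "deriv V r0 > 0" by (auto simp: stable_radius_def)
    define K where "K = \<xi> * sqrt (r0^3 * deriv V r0)"
    have K: "K \<noteq> 0" "K\<^sup>2 = \<xi>\<^sup>2 * r0^3 * deriv V r0"
      using xi r0 V1 by (auto simp: K_def power_mult_distrib)
    have "U1 K r0 = 0" unfolding U1_def K(2) using xi r0 by simp
    moreover have "r0 * D K = r0 * deriv (deriv V) r0 + 3 * deriv V r0"
      unfolding D_def K(2) using r0 xi by (simp add: field_simps eval_nat_numeral)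
    then have "D K > 0" using st r0 by (metis stable_radius_def zero_less_mult_pos)
    ultimately have "nondegenerate_local_min (effective_potential \<xi> V K) r0"
      using local_min_iff_deriv[OF ev[OF r0] dU1[OF r0], of K]
      by (auto simp: nondegenerate_local_min_def dd[OF r0])
    moreover have "circular_orbit \<xi> V r0"
      unfolding circular_orbit_def using circular_solution[OF xi V r0 K(2,1)] r0 by blast
    ultimately show "strongly_stable \<xi> V r0" using K(1) by (auto simp: strongly_stable_def)
  qed
qed

lemma closed_near_rational:
  assumes xi: "\<xi> > 0" and V: "central_potential V" and st: "stable_radius V r0"
    and cn: "closed_near \<xi> V r0"
  shows "sqrt (\<xi>\<^sup>2 * (3 + r0 * deriv (deriv V) r0 / deriv V r0)) \<in> \<rat>"
proof -
  let ?D = "\<xi>\<^sup>2 * (3 + r0 * deriv (deriv V) r0 / deriv V r0)"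
  obtain \<delta> H h where w: "cone_well \<xi> V r0 (\<xi> * sqrt (r0^3 * deriv V r0)) \<delta> H h"
    and h0: "h 0 = sqrt (2 / ?D)" and K2: "(\<xi> * sqrt (r0^3 * deriv V r0))\<^sup>2 = \<xi>\<^sup>2 * r0^3 * deriv V r0"
    using cone_well_exists[OF xi V st] by metis
  interpret cone_well \<xi> V r0 "\<xi> * sqrt (r0^3 * deriv V r0)" \<delta> H h by fact
  obtain d where d: "0 < d" "d \<le> \<delta>" "\<And>\<mu>. 0 < \<mu> \<Longrightarrow> \<mu> < d \<Longrightarrow> period \<mu> / (2 * pi) \<in> \<rat>"
    using closed_near_period_rational[OF K2 cn] by metis
  have "h 0 / sqrt 2 \<in> \<rat>" using period_const(2)[OF d, of "d / 2"] d(1) by simp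
  moreover have "h 0 / sqrt 2 = inverse (sqrt ?D)"
    by (simp add: h0 real_sqrt_divide inverse_eq_divide)
  ultimately show ?thesis using Rats_inverse by fastforce
qed

text \<open>The rational-valued continuous frequency is constant on the component \<open>J\<close>
  of stable radii. There \<open>r V'' = (b - 3) V'\<close>, so \<open>V'\<close> is a power; this
  relation survives at positive limit points of \<open>J\<close>, which are therefore stable, so
  \<open>J\<close> is open and closed in the half-line.\<close>

lemma power_law_component:
  assumes V: "central_potential V" and st: "stable_radius V r1" and xi: "\<xi> > 0"
    and rat: "\<And>r. stable_radius V r \<Longrightarrow> sqrt (\<xi>\<^sup>2 * (3 + r * deriv (deriv V) r / deriv V r)) \<in> \<rat>"
  obtains b c where "c > 0" "\<And>r. r > 0 \<Longrightarrow> stable_radius V r"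
    "\<And>r. r > 0 \<Longrightarrow> deriv V r = c * r powr (b - 3)"
    "\<And>r. r > 0 \<Longrightarrow> deriv (deriv V) r = (b - 3) * deriv V r / r" "sqrt (\<xi>\<^sup>2 * b) \<in> \<rat>" "b > 0"
proof -
  define \<Omega> where "\<Omega> = Collect (stable_radius V)"
  define J where "J = connected_component_set \<Omega> r1"
  have c0: "continuous_on {0<..} (deriv V)" "continuous_on {0<..} (deriv (deriv V))"
    using DERIV_isCont[OF central_potentialD(2)[OF V]] central_potentialD(3)[OF V]
    by (auto intro!: continuous_at_imp_continuous_on)
  have cW: "continuous_on {0<..} (\<lambda>r. r * deriv (deriv V) r + 3 * deriv V r)"
    by (intro continuous_intros c0)
  have "\<Omega> = ({0<..} \<inter> deriv V -` {0<..}) \<inter>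
      ({0<..} \<inter> (\<lambda>r. r * deriv (deriv V) r + 3 * deriv V r) -` {0<..})"
    by (auto simp: \<Omega>_def stable_radius_def)
  then have "open \<Omega>"
    using open_Int[OF continuous_open_preimage[OF c0(1) open_greaterThan open_greaterThan[of 0]]
      continuous_open_preimage[OF cW open_greaterThan open_greaterThan[of 0]]] by (simp only:)
  then have "open J" unfolding J_def by (rule open_connected_component)
  have "r1 \<in> J" using st by (simp add: J_def \<Omega>_def connected_component_refl)
  have J\<Omega>: "J \<subseteq> \<Omega>" unfolding J_def by (rule connected_component_subset)
  have conn: "connected J" unfolding J_def by simp
  have Jst: "r > 0" "deriv V r > 0" "r * deriv (deriv V) r + 3 * deriv V r > 0" if "r \<in> J" for r
    using J\<Omega> that by (auto simp: \<Omega>_def stable_radius_def)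
  define \<beta> where "\<beta> r = sqrt (\<xi>\<^sup>2 * (3 + r * deriv (deriv V) r / deriv V r))" for r
  have "J \<subseteq> {0<..}" using Jst by auto
  have "continuous_on J \<beta>" unfolding \<beta>_def
    using Jst(2) by (intro continuous_intros continuous_on_subset[OF c0(1) \<open>J \<subseteq> {0<..}\<close>]
      continuous_on_subset[OF c0(2) \<open>J \<subseteq> {0<..}\<close>]) (auto simp: less_imp_neq[THEN not_sym])
  then have "\<beta> constant_on J"
    by (rule continuous_on_countable_values_const[OF conn _ _ countable_rat])
      (use rat J\<Omega> in \<open>auto simp: \<beta>_def \<Omega>_def\<close>)
  then obtain \<beta>0 where \<beta>0: "\<And>r. r \<in> J \<Longrightarrow> \<beta> r = \<beta>0" by (auto simp: constant_on_def)
  \<comment> \<open>The common value of \<open>3 + r V''/V'\<close> on \<open>J\<close>, recovered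
    from the frequency \<open>\<beta>0\<close>.\<close>
  define b where "b = (\<beta>0 / \<xi>)\<^sup>2"
  have pos3: "3 + r * deriv (deriv V) r / deriv V r > 0" if "r \<in> J" for r
  proof -
    have "3 + r * deriv (deriv V) r / deriv V r = (r * deriv (deriv V) r + 3 * deriv V r) / deriv V r"
      using Jst[OF that] by (simp add: field_simps)
    then show ?thesis using Jst[OF that] by simp
  qed
  have b: "3 + r * deriv (deriv V) r / deriv V r = b" if "r \<in> J" for r
  proof -
    have "\<beta>0\<^sup>2 = \<xi>\<^sup>2 * (3 + r * deriv (deriv V) r / deriv V r)"
      using pos3[OF that] xi unfolding \<beta>0[OF that, symmetric] \<beta>_def by simp
    then show ?thesis using xi by (simp add: b_def power_divide)
  qed
  have "b > 0" using pos3[OF \<open>r1 \<in> J\<close>] b[OF \<open>r1 \<in> J\<close>] by simp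
  have V2: "deriv (deriv V) r = (b - 3) * deriv V r / r" if "r \<in> J" for r
    using b[OF that] Jst[OF that] by (simp add: field_simps)
  have "\<exists>c. \<forall>r\<in>J. deriv V r * r powr (3 - b) = c"
  proof (rule has_field_derivative_zero_constant)
    show "convex J" using conn by (simp add: is_interval_connected_1 flip: is_interval_convex_1)
    fix r assume r: "r \<in> J"
    have "((\<lambda>r. deriv V r * r powr (3 - b)) has_real_derivative
        deriv (deriv V) r * r powr (3 - b) + deriv V r * ((3 - b) * r powr (3 - b - 1))) (at r)"
      using Jst(1)[OF r] central_potentialD(2)[OF V Jst(1)[OF r]] by (auto intro!: derivative_eq_intros)
    moreover have "deriv (deriv V) r * r powr (3 - b) + deriv V r * ((3 - b) * r powr (3 - b - 1)) = 0"
      unfolding V2[OF r] powr_diff[of r "3 - b" 1] using Jst(1)[OF r] by (simp add: field_simps)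
    ultimately show "((\<lambda>r. deriv V r * r powr (3 - b)) has_real_derivative 0) (at r within J)"
      by (simp add: has_field_derivative_at_within)
  qed
  then obtain c where c: "\<And>r. r \<in> J \<Longrightarrow> deriv V r * r powr (3 - b) = c" by blast
  have "c > 0" using c[OF \<open>r1 \<in> J\<close>] Jst[OF \<open>r1 \<in> J\<close>] by (metis powr_gt_zero mult_pos_pos less_irrefl)
  have V1: "deriv V r = c * r powr (b - 3)" if "r \<in> J" for r
  proof -
    have "c * r powr (b - 3) = deriv V r * (r powr (3 - b) * r powr (b - 3))"
      unfolding c[OF that, symmetric] by simp
    also have "r powr (3 - b) * r powr (b - 3) = 1" using Jst(1)[OF that] by (simp flip: powr_add)
    finally show ?thesis by simp
  qed
  \<comment> \<open>Both formulas extend to a limit point \<open>s > 0\<close> by continuity; with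
    \<open>c > 0\<close> and \<open>b > 0\<close> they make \<open>s\<close> a stable radius, and
    adding a limit point keeps \<open>J\<close> connected.\<close>
  have "closure J \<inter> {0<..} \<subseteq> J"
  proof
    fix s assume s: "s \<in> closure J \<inter> {0<..}"
    have "s > 0" using s by simp
    have cont: "isCont (\<lambda>r. deriv V r - c * r powr (b - 3)) s"
      "isCont (\<lambda>r. r * deriv (deriv V) r - (b - 3) * deriv V r) s"
      using central_potentialD(2,3)[OF V \<open>s > 0\<close>] \<open>s > 0\<close> DERIV_isCont by (auto intro!: continuous_intros)
    have lim0: "f s = 0" if "isCont f s" "\<And>r. r \<in> J \<Longrightarrow> f r = 0" for f :: "real \<Rightarrow> real"
    proof -
      obtain x where x: "\<And>n. x n \<in> J" "x \<longlonglongrightarrow> s" using s by (auto simp: closure_sequential)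
      have "(\<lambda>n. f (x n)) \<longlonglongrightarrow> f s" using isCont_tendsto_compose[OF that(1) x(2)] .
      moreover have "(\<lambda>n. f (x n)) = (\<lambda>n. 0)" using that(2) x(1) by auto
      ultimately show ?thesis by (simp add: LIMSEQ_const_iff)
    qed
    have "deriv V s - c * s powr (b - 3) = 0" by (rule lim0[OF cont(1)]) (simp add: V1)
    then have V1s: "deriv V s = c * s powr (b - 3)" by simp
    have e: "r * deriv (deriv V) r - (b - 3) * deriv V r = 0" if "r \<in> J" for r
      unfolding V2[OF that] using Jst(1)[OF that] by simp
    have "s * deriv (deriv V) s - (b - 3) * deriv V s = 0" by (rule lim0[OF cont(2) e])
    then have "s * deriv (deriv V) s + 3 * deriv V s = b * deriv V s" by (simp add: algebra_simps)
    moreover have "deriv V s > 0" using V1s \<open>s > 0\<close> \<open>c > 0\<close> by simp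
    ultimately have "stable_radius V s"
      using \<open>s > 0\<close> \<open>b > 0\<close> by (simp add: stable_radius_def)
    then have "insert s J \<subseteq> \<Omega>" using J\<Omega> by (simp add: \<Omega>_def)
    moreover have "connected (insert s J)"
      by (rule connected_intermediate_closure[OF conn]) (use s closure_subset[of J] in auto)
    ultimately have "insert s J \<subseteq> connected_component_set \<Omega> r1"
      using \<open>r1 \<in> J\<close> by (intro connected_component_maximal) auto
    then show "s \<in> J" by (simp flip: J_def)
  qed
  then have "J = closure J \<inter> {0<..}" using \<open>J \<subseteq> {0<..}\<close> closure_subset[of J] by blast
  then have "closedin (top_of_set {0<..}) J" by (metis closed_closure closedin_closed_Int inf_commute)
  moreover have "openin (top_of_set {0<..}) J" using \<open>open J\<close> \<open>J \<subseteq> {0<..}\<close> by (simp add: openin_open_eq)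
  ultimately have "J = {0<..}" using connected_clopen[of "{0::real<..}"] \<open>r1 \<in> J\<close> by auto
  moreover have "sqrt (\<xi>\<^sup>2 * b) \<in> \<rat>"
    using rat[OF st] b[OF \<open>r1 \<in> J\<close>] by simp
  ultimately show ?thesis
    using that[of c b] \<open>c > 0\<close> \<open>b > 0\<close> V1 V2 J\<Omega> by (auto simp: \<Omega>_def)
qed

text \<open>One circle suffices for a power law. At radius 1 the derivative of the well potential is
  \<open>\<xi>^2 (z - z^(1 - b))\<close>, so the isochrony condition becomes a polynomial equation
  in \<open>b\<close>.\<close>

lemma closing_exponent:
  assumes xi: "\<xi> > 0" and V: "central_potential V" and "c > 0" "b > 0"
    and V1: "\<And>r. r > 0 \<Longrightarrow> deriv V r = c * r powr (b - 3)"
    and V2: "\<And>r. r > 0 \<Longrightarrow> deriv (deriv V) r = (b - 3) * deriv V r / r"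
    and cn: "closed_near \<xi> V 1"
  shows "b = 1 \<or> b = 4"
proof -
  have st: "stable_radius V 1" using V1[of 1] V2[of 1] assms by (simp add: stable_radius_def algebra_simps)
  define K where "K = \<xi> * sqrt (1^3 * deriv V 1)"
  define P where "P z = \<xi>\<^sup>2 * z\<^sup>2 / 2 + \<xi>^4 / K\<^sup>2 * V (1 / z)" for z
  obtain \<delta> H h where w: "cone_well \<xi> V 1 K \<delta> H h"
    and h0: "h 0 = sqrt (2 / (\<xi>\<^sup>2 * (3 + 1 * deriv (deriv V) 1 / deriv V 1)))"
    and PH: "\<And>x. \<bar>x\<bar> < \<delta> \<Longrightarrow> P (H x) = P (1 / 1) + x\<^sup>2"
    and K2: "K\<^sup>2 = \<xi>\<^sup>2 * 1^3 * deriv V 1"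
    using cone_well_exists[OF xi V st] unfolding P_def K_def by metis
  interpret cone_well \<xi> V 1 K \<delta> H h by fact
  obtain d where d: "0 < d" "d \<le> \<delta>" "\<And>\<mu>. 0 < \<mu> \<Longrightarrow> \<mu> < d \<Longrightarrow> period \<mu> / (2 * pi) \<in> \<rat>"
    using closed_near_period_rational[OF K2 cn] by metis
  \<comment> \<open>At radius 1 one has \<open>K^2 = \<xi>^2 c\<close>, so the strength
    \<open>c\<close> cancels from the normalised well.\<close>
  define P1 where "P1 z = \<xi>\<^sup>2 * (z - z powr (1 - b))" for z
  define P2 where "P2 z = \<xi>\<^sup>2 * (1 - (1 - b) * z powr (- b))" for z
  define P3 where "P3 z = \<xi>\<^sup>2 * ((1 - b) * b * z powr (- b - 1))" for z
  have P1V: "P1 z = \<xi>\<^sup>2 * z - \<xi>^4 / K\<^sup>2 * deriv V (1 / z) / z\<^sup>2" if "z > 0" for z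
  proof -
    have "\<xi>^4 / K\<^sup>2 = \<xi>\<^sup>2 / c" using K2 V1[of 1] xi \<open>c > 0\<close> by (simp add: eval_nat_numeral)
    moreover have "deriv V (1 / z) / z\<^sup>2 = c * z powr (1 - b)"
    proof -
      have "(1 / z) powr (b - 3) = z powr (3 - b)" using that by (simp add: powr_divide powr_minus_divide[symmetric])
      moreover have "z powr (3 - b) / z\<^sup>2 = z powr (1 - b)"
        using that by (simp flip: powr_numeral powr_diff)
      moreover have "deriv V (1 / z) / z\<^sup>2 = c * ((1 / z) powr (b - 3) / z\<^sup>2)" using V1[of "1 / z"] that by simp
      ultimately show ?thesis by (simp only:)
    qed
    ultimately show ?thesis using \<open>c > 0\<close> unfolding P1_def times_divide_eq_right[symmetric] by (simp add: algebra_simps)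
  qed
  have near: "z > 0" if "\<bar>z - 1\<bar> < 1" for z :: real using that by auto
  have d0: "(P has_real_derivative P1 z) (at z)" if "\<bar>z - 1\<bar> < 1" for z
    unfolding P1V[OF near[OF that]] P_def[abs_def] using well_potential_deriv[OF V near[OF that]] .
  have d1: "(P1 has_real_derivative P2 z) (at z)" if "\<bar>z - 1\<bar> < 1" for z
    unfolding P1_def[abs_def] P2_def using near[OF that] by (auto intro!: derivative_eq_intros)
  have d2: "(P2 has_real_derivative P3 z) (at z)" if "\<bar>z - 1\<bar> < 1" for z
    unfolding P2_def[abs_def] P3_def using near[OF that] by (auto intro!: derivative_eq_intros)
  have d3: "(P3 has_real_derivative \<xi>\<^sup>2 * ((1 - b) * b * (- b - 1))) (at 1)"
    unfolding P3_def[abs_def] by (auto intro!: derivative_eq_intros)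
  have P2: "P2 1 = \<xi>\<^sup>2 * b" by (simp add: P2_def)
  have h0': "h 0 = sqrt (2 / P2 1)" using h0 V1[of 1] V2[of 1] \<open>c > 0\<close> by (simp add: P2)
  have iso: "integral {0..2*pi} (\<lambda>s. h (\<mu> * sin s)) = 2 * pi * h 0" if "0 < \<mu>" "\<mu> < d" for \<mu>
    using period_const(1)[OF d that] .
  \<comment> \<open>shrinking the well keeps \<open>H\<close> inside the interval where \<open>P\<close> was differentiated\<close>
  have "isCont H 0" using dH[of 0] delta DERIV_isCont by auto
  then obtain e where e: "e > 0" "\<And>x. dist x 0 < e \<Longrightarrow> dist (H x) (H 0) < 1"
    unfolding continuous_at_eps_delta using zero_less_one by blast
  then have eH: "\<bar>H x - 1\<bar> < 1" if "\<bar>x\<bar> < e" for x using that H0 e(2)[of x] by (simp add: dist_real_def)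
  define m where "m = min d e"
  have m: "m > 0" "m \<le> d" "m \<le> e" "m \<le> \<delta>" using d e by (auto simp: m_def)
  have chm: "continuous_on {- m<..<m} h" by (rule continuous_on_subset[OF ch]) (use m in auto)
  have fm: "P1 (H x) * h x = 2 * x" if "\<bar>x\<bar> < m" for x
    using force[of x] P1V[OF Hpos[of x]] that m by simp
  have P10: "P1 1 = 0" by (simp add: P1_def)
  have P2pos: "P2 1 > 0" using xi \<open>b > 0\<close> by (simp add: P2)
  have Hm: "H 0 = 1" using H0 by simp
  have E: "5 * (P3 1)\<^sup>2 = 3 * P2 1 * (\<xi>\<^sup>2 * ((1 - b) * b * (- b - 1)))"
  proof (rule isochronous_well[of m H 1 h P2 1 P P1 P3])
    show "(P3 has_real_derivative \<xi>\<^sup>2 * ((1 - b) * b * (- b - 1))) (at 1)" by (rule d3)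
    show "P (H x) = P 1 + x\<^sup>2" if "\<bar>x\<bar> < m" for x using PH[of x] that m by simp
    show "(H has_real_derivative h x) (at x)" if "\<bar>x\<bar> < m" for x using dH[of x] that m by simp
    show "h x > 0" if "\<bar>x\<bar> < m" for x using hpos[of x] that m by simp
    show "\<bar>H x - 1\<bar> < 1" if "\<bar>x\<bar> < m" for x using eH[of x] that m by simp
    show "integral {0..2*pi} (\<lambda>s. h (\<mu> * sin s)) = 2 * pi * h 0" if "0 < \<mu>" "\<mu> < m" for \<mu>
      using iso[of \<mu>] that m by simp
  qed (fact m(1) Hm h0' chm fm zero_less_one d0 d1 d2 P10 P2pos)+
  have "5 * (\<xi>\<^sup>2 * ((1 - b) * b))\<^sup>2 = 3 * (\<xi>\<^sup>2 * b) * (\<xi>\<^sup>2 * ((1 - b) * b * (- b - 1)))"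
    using E by (simp add: P2 P3_def)
  \<comment> \<open>After the common factor \<open>(1 - b)\<close> is taken out,
    \<open>8 - 2 b\<close> is \<open>5 (1 - b) + 3 (b + 1)\<close>.\<close>
  then have "(\<xi>\<^sup>2 * b)\<^sup>2 * ((1 - b) * (8 - 2 * b)) = 0"
    by (simp add: algebra_simps power2_eq_square)
  then show ?thesis using xi \<open>b > 0\<close> by simp
qed

text \<open>The rational frequency \<open>\<xi> sqrt b\<close> is \<open>\<xi>\<close> or
  \<open>2 \<xi>\<close>, so it carries rationality to \<open>\<xi>\<close> in either case;
  integrating \<open>V'\<close> introduces the constant \<open>B\<close>.\<close>

lemma locally_closing_rigid:
  assumes xi: "\<xi> > 0" and V: "central_potential V" and "locally_closing \<xi> V"
  shows "\<xi> \<in> \<rat>" "\<exists>i\<in>{1, 2}. \<exists>A>0. \<exists>B. \<forall>r>0. V r = bertrand_potential i A B r"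
proof -
  obtain r1 where st: "stable_radius V r1" and
    cn: "\<And>r. stable_radius V r \<Longrightarrow> closed_near \<xi> V r"
    using assms by (auto simp: locally_closing_def cond_ex_loc_def cond_all_loc_def strongly_stable_iff)
  obtain b c where "c > 0" and all: "\<And>r. r > 0 \<Longrightarrow> stable_radius V r"
    and V1: "\<And>r. r > 0 \<Longrightarrow> deriv V r = c * r powr (b - 3)"
    and V2: "\<And>r. r > 0 \<Longrightarrow> deriv (deriv V) r = (b - 3) * deriv V r / r"
    and rat: "sqrt (\<xi>\<^sup>2 * b) \<in> \<rat>" and "b > 0"
    using power_law_component[OF V st xi closed_near_rational[OF xi V _ cn]] by metis
  have b: "b = 1 \<or> b = 4"
    using closing_exponent[OF xi V \<open>c > 0\<close> \<open>b > 0\<close> V1 V2] cn[OF all[of 1]] by simp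
  then have "sqrt (\<xi>\<^sup>2 * b) = \<xi> \<or> sqrt (\<xi>\<^sup>2 * b) = 2 * \<xi>"
    using xi by (auto simp: real_sqrt_mult)
  then show "\<xi> \<in> \<rat>"
  proof
    assume "sqrt (\<xi>\<^sup>2 * b) = 2 * \<xi>"
    then have "2 * \<xi> / 2 \<in> \<rat>" using rat by (intro Rats_divide) auto
    then show ?thesis by simp
  qed (use rat in simp)
  have const: "\<exists>B. \<forall>r>0. V r = W r + B"
    if W: "\<And>r. r > 0 \<Longrightarrow> (W has_real_derivative deriv V r) (at r)" for W
  proof -
    have "\<exists>B. \<forall>r\<in>{0<..}. V r - W r = B"
    proof (rule has_field_derivative_zero_constant)
      fix r :: real assume "r \<in> {0<..}"
      then have "((\<lambda>r. V r - W r) has_real_derivative deriv V r - deriv V r) (at r)"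
        by (intro DERIV_diff central_potentialD(1)[OF V] W) auto
      then show "((\<lambda>r. V r - W r) has_real_derivative 0) (at r within {0<..})"
        by (simp add: has_field_derivative_at_within)
    qed simp
    then obtain B where "\<And>r. r > 0 \<Longrightarrow> V r - W r = B" by auto
    then show ?thesis by (intro exI[of _ B]) (auto simp: algebra_simps)
  qed
  from b show "\<exists>i\<in>{1, 2}. \<exists>A>0. \<exists>B. \<forall>r>0. V r = bertrand_potential i A B r"
  proof
    assume "b = 1"
    then have "((\<lambda>r. - c / r) has_real_derivative deriv V r) (at r)" if "r > 0" for r
      using that V1[OF that]
      by (auto intro!: derivative_eq_intros simp: powr_minus_divide power2_eq_square)
    from const[OF this] obtain B where "\<And>r. r > 0 \<Longrightarrow> V r = - c / r + B" by auto
    then show ?thesis using \<open>c > 0\<close>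
      by (intro bexI[of _ 1] exI[of _ c] conjI exI[of _ B]) (auto simp: bertrand_potential_def divide_inverse)
  next
    assume "b = 4"
    then have "((\<lambda>r. c * r\<^sup>2 / 2) has_real_derivative deriv V r) (at r)" if "r > 0" for r
      using that V1[OF that] by (auto intro!: derivative_eq_intros)
    from const[OF this] obtain B where "\<And>r. r > 0 \<Longrightarrow> V r = c * r\<^sup>2 / 2 + B" by auto
    then show ?thesis using \<open>c > 0\<close>
      by (intro bexI[of _ 2] exI[of _ c] conjI exI[of _ B]) (auto simp: bertrand_potential_def)
  qed
qed

section \<open>Finding a strongly stable circle\<close>

text \<open>Beyond the last radius where \<open>r^3 V'\<close> is at most \<open>m\<close> it stays
  above \<open>m > 0\<close>, so \<open>V' > 0\<close> there; since it has to climb to its value at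
  \<open>y\<close>, the mean value theorem provides a point where it also increases.\<close>

lemma stable_radius_if_crossing:
  assumes V: "central_potential V" and "0 < x" "x < y" "0 < m"
    and lo: "x^3 * deriv V x < m" and hi: "m < y^3 * deriv V y"
  shows "\<exists>r. stable_radius V r"
proof -
  define M where "M r = r^3 * deriv V r" for r
  have dM: "(M has_real_derivative r\<^sup>2 * (r * deriv (deriv V) r + 3 * deriv V r)) (at r)" if "r > 0" for r
    unfolding M_def[abs_def] using central_potentialD(2)[OF V that]
    by (auto intro!: derivative_eq_intros simp: algebra_simps eval_nat_numeral)
  have cM: "continuous_on {x..y} M"
    using \<open>0 < x\<close> DERIV_isCont[OF dM] by (auto intro!: continuous_at_imp_continuous_on)
  \<comment> \<open>Its supremum is the last radius at or below the level; to the right of it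
    \<open>M\<close> exceeds \<open>m\<close>.\<close>
  define S where "S = {x..y} \<inter> M -` {..m}"
  have "closed S" unfolding S_def by (rule continuous_closed_preimage[OF cM]) auto
  moreover have "x \<in> S" using lo \<open>x < y\<close> by (simp add: S_def M_def)
  moreover have bdd: "bdd_above S" by (auto simp: S_def bdd_above_def)
  ultimately have s: "Sup S \<in> S" using closed_contains_Sup by blast
  define s where "s = Sup S"
  have sx: "x \<le> s" "s \<le> y" "M s \<le> m" using s by (auto simp: s_def S_def)
  have "s \<noteq> y" using sx hi by (auto simp: M_def)
  then have "s < y" using sx by simp
  then obtain r where r: "s < r" "r < y" "M y - M s = (y - s) * (r\<^sup>2 * (r * deriv (deriv V) r + 3 * deriv V r))"
    using MVT2[of s y M "\<lambda>r. r\<^sup>2 * (r * deriv (deriv V) r + 3 * deriv V r)"] dM sx \<open>0 < x\<close> by force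
  have "r \<notin> S"
    using cSup_upper[OF _ bdd, of r] r(1) by (auto simp: s_def)
  then have "M r > m" using r sx by (auto simp: S_def)
  then have "r^3 * deriv V r > 0" using \<open>0 < m\<close> by (simp add: M_def)
  moreover have "r > 0" using r sx \<open>0 < x\<close> by simp
  moreover have "(y - s) * (r\<^sup>2 * (r * deriv (deriv V) r + 3 * deriv V r)) > 0"
    using r(3) sx hi by (simp add: M_def)
  then have "r\<^sup>2 * (r * deriv (deriv V) r + 3 * deriv V r) > 0" using \<open>s < y\<close> by (simp add: zero_less_mult_iff)
  ultimately have "stable_radius V r" by (simp add: stable_radius_def zero_less_mult_iff)
  then show ?thesis by blast
qed

text \<open>If the motion is inward at \<open>t0\<close>, the time-reversed motion is outward and
  obeys the same energy law.\<close>

lemma escape_above_either: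
  fixes r v U :: "real \<Rightarrow> real"
  assumes d: "\<And>t. (r has_real_derivative v t) (at t)" and c: "continuous_on UNIV v"
    and e: "\<And>t. (v t)\<^sup>2 / 2 + U (r t) = E" and v: "v t0 \<noteq> 0"
    and U: "\<And>y. y \<ge> r t0 \<Longrightarrow> U y \<le> U (r t0)"
  shows "\<exists>t. r t > b"
proof (cases "v t0 > 0")
  case True
  show ?thesis by (rule escape_above[OF d c e True U])
next
  case False
  have "(uminus has_real_derivative - 1) (at t)" for t :: real by (auto intro!: derivative_eq_intros)
  from DERIV_chain2[OF d this]
  have "((\<lambda>t. r (- t)) has_real_derivative - v (- t)) (at t)" for t by simp
  moreover have "continuous_on UNIV (\<lambda>t. - v (- t))"
    by (intro continuous_intros continuous_on_compose2[OF c]) auto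
  ultimately have "\<exists>t. r (- t) > b"
    using escape_above[of "\<lambda>t. r (- t)" "\<lambda>t. - v (- t)" U E "- t0" b] e U v False by auto
  then show ?thesis by blast
qed

lemma reduced_energy:
  assumes xi: "\<xi> > 0" and V: "central_potential V" and I: "is_interval I"
    and pos: "\<And>t. t \<in> I \<Longrightarrow> r t > 0"
    and dr: "\<And>t. t \<in> I \<Longrightarrow> (r has_real_derivative v t) (at t)"
    and dv: "\<And>t. t \<in> I \<Longrightarrow> (v has_real_derivative K\<^sup>2 / (\<xi>\<^sup>2 * (r t)^3) - deriv V (r t)) (at t)"
  obtains E where "\<And>t. t \<in> I \<Longrightarrow> (v t)\<^sup>2 / 2 + (V (r t) + K\<^sup>2 / (2 * \<xi>\<^sup>2 * (r t)\<^sup>2)) = E"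
proof -
  have "\<exists>E. \<forall>t\<in>I. (v t)\<^sup>2 / 2 + (V (r t) + K\<^sup>2 / (2 * \<xi>\<^sup>2 * (r t)\<^sup>2)) = E"
  proof (rule has_field_derivative_zero_constant)
    show "convex I" using I by (simp add: is_interval_convex_1)
    fix t assume t: "t \<in> I"
    have 1: "((\<lambda>t. (v t)\<^sup>2 / 2) has_real_derivative v t * (K\<^sup>2 / (\<xi>\<^sup>2 * (r t)^3) - deriv V (r t))) (at t)"
      using dv[OF t] by (auto intro!: derivative_eq_intros)
    have 2: "((\<lambda>t. V (r t)) has_real_derivative deriv V (r t) * v t) (at t)"
      by (rule DERIV_chain2[OF central_potentialD(1)[OF V pos[OF t]] dr[OF t]])
    have 3: "((\<lambda>t. K\<^sup>2 / (2 * \<xi>\<^sup>2 * (r t)\<^sup>2)) has_real_derivative - (K\<^sup>2 / (\<xi>\<^sup>2 * (r t)^3)) * v t) (at t)"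
      using dr[OF t] pos[OF t] xi
      by (auto intro!: derivative_eq_intros simp: field_simps eval_nat_numeral)
    have eq: "v t * (a - b) + (b * v t + - a * v t) = 0" for a b by (simp add: algebra_simps)
    show "((\<lambda>t. (v t)\<^sup>2 / 2 + (V (r t) + K\<^sup>2 / (2 * \<xi>\<^sup>2 * (r t)\<^sup>2))) has_real_derivative 0) (at t within I)"
      using DERIV_add[OF 1 DERIV_add[OF 2 3]] unfolding eq by (rule has_field_derivative_at_within)
  qed
  then show ?thesis using that by blast
qed

text \<open>In this form, monotonicity of the effective potential is decided by comparing
  \<open>r^3 V'\<close> with the fixed level \<open>K^2/\<xi>^2\<close>.\<close>

lemma effective_deriv:
  assumes xi: "\<xi> > 0" and V: "central_potential V" and "r > 0"
  shows "((\<lambda>r. V r + K\<^sup>2 / (2 * \<xi>\<^sup>2 * r\<^sup>2)) has_real_derivative (r^3 * deriv V r - K\<^sup>2 / \<xi>\<^sup>2) / r^3) (at r)"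
  using central_potentialD(1)[OF V \<open>r > 0\<close>] assms
  by (auto intro!: derivative_eq_intros simp: field_simps eval_nat_numeral)

lemma effective_less_eq:
  fixes K :: real
  assumes xi: "\<xi> > 0" and V: "central_potential V" and "0 < a" "a \<le> b"
  defines "U \<equiv> \<lambda>r. V r + K\<^sup>2 / (2 * \<xi>\<^sup>2 * r\<^sup>2)"
  shows "(\<And>z. a < z \<Longrightarrow> z < b \<Longrightarrow> z^3 * deriv V z \<le> K\<^sup>2 / \<xi>\<^sup>2) \<Longrightarrow> U b \<le> U a"
    and "(\<And>z. a < z \<Longrightarrow> z < b \<Longrightarrow> K\<^sup>2 / \<xi>\<^sup>2 \<le> z^3 * deriv V z) \<Longrightarrow> U a \<le> U b"
proof -
  have "\<exists>z>a. z < b \<and> U b - U a = (b - a) * ((z^3 * deriv V z - K\<^sup>2 / \<xi>\<^sup>2) / z^3)" if "a < b"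
    unfolding U_def by (rule MVT2[OF that]) (use effective_deriv[OF xi V] \<open>0 < a\<close> in auto)
  then have "a = b \<or> (\<exists>z>a. z < b \<and> U b - U a = (b - a) * ((z^3 * deriv V z - K\<^sup>2 / \<xi>\<^sup>2) / z^3))"
    using \<open>a \<le> b\<close> by (cases "a = b") simp_all
  then consider "a = b" | z where "a < z" "z < b" "z > 0"
    "U b - U a = (b - a) * ((z^3 * deriv V z - K\<^sup>2 / \<xi>\<^sup>2) / z^3)"
    using \<open>0 < a\<close> by (meson less_trans)
  note cases = this
  show "U b \<le> U a" if "\<And>z. a < z \<Longrightarrow> z < b \<Longrightarrow> z^3 * deriv V z \<le> K\<^sup>2 / \<xi>\<^sup>2"
  proof (cases rule: cases)
    case (2 z)
    then have "(z^3 * deriv V z - K\<^sup>2 / \<xi>\<^sup>2) / z^3 \<le> 0" using that[of z] by (simp add: divide_le_0_iff)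
    then have "U b - U a \<le> 0" unfolding 2(4) using \<open>a \<le> b\<close> by (intro mult_nonneg_nonpos) auto
    then show ?thesis by simp
  qed simp
  show "U a \<le> U b" if "\<And>z. a < z \<Longrightarrow> z < b \<Longrightarrow> K\<^sup>2 / \<xi>\<^sup>2 \<le> z^3 * deriv V z"
  proof (cases rule: cases)
    case (2 z)
    then have "(z^3 * deriv V z - K\<^sup>2 / \<xi>\<^sup>2) / z^3 \<ge> 0" using that[of z] by simp
    then have "U b - U a \<ge> 0" unfolding 2(4) using \<open>a \<le> b\<close> by (intro mult_nonneg_nonneg) auto
    then show ?thesis by simp
  qed simp
qed

lemma nonsingular_reduced:
  assumes xi: "\<xi> > 0" and V: "central_potential V" and "nonsingular_bounded \<xi> V I r \<phi>"
  obtains K where "I = UNIV" "K \<noteq> 0" "solution \<xi> V UNIV r \<phi>" "has_angular_momentum \<xi> UNIV r \<phi> K"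
    "\<And>t. r t > 0" "\<And>t. (r has_real_derivative deriv r t) (at t)"
    "\<And>t. (\<phi> has_real_derivative K / (\<xi>\<^sup>2 * (r t)\<^sup>2)) (at t)"
    "\<And>t. (deriv r has_real_derivative K\<^sup>2 / (\<xi>\<^sup>2 * (r t)^3) - deriv V (r t)) (at t)"
proof -
  have I: "I = UNIV" and sol: "solution \<xi> V UNIV r \<phi>" and ns: "\<not> singular \<xi> UNIV r \<phi>"
    using assms by (auto simp: nonsingular_bounded_def bounded_motion_def trajectory_def)
  obtain K where K: "has_angular_momentum \<xi> UNIV r \<phi> K" using solution_angular_momentum[OF V sol] .
  have "K \<noteq> 0" using K ns by (auto simp: singular_def)
  then show ?thesis using that[of K] I sol K reduced_iff[OF xi V, of UNIV r \<phi> K] by auto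
qed

text \<open>\<open>circular\<close> asks for the whole circle as orbit; a constant nonzero angular
  velocity sweeps it out.\<close>

lemma circular_if_const_radius:
  assumes "\<And>t. r t = c" "K \<noteq> 0" "c > 0" "\<xi> > 0"
    and d: "\<And>t. (\<phi> has_real_derivative K / (\<xi>\<^sup>2 * (r t)\<^sup>2)) (at t)"
  shows "circular UNIV r \<phi>"
proof -
  define k where "k = K / (\<xi>\<^sup>2 * c\<^sup>2)"
  have "k \<noteq> 0" using assms by (simp add: k_def)
  have "((\<lambda>t. \<phi> t - k * t) has_real_derivative 0) (at t)" for t
  proof -
    have "(\<phi> has_real_derivative k) (at t)" using d[of t] by (simp add: assms(1) k_def)
    from DERIV_diff[OF this DERIV_cmult_Id[of k]] show ?thesis by simp
  qed
  then have "\<phi> t - k * t = \<phi> 0 - k * 0" for t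
    by (intro DERIV_isconst_all[of "\<lambda>t. \<phi> t - k * t"]) blast
  then have *: "\<phi> t = k * t + \<phi> 0" for t by (metis diff_eq_eq diff_zero mult_zero_right add.commute)
  define a where "a = \<phi> 0 / k"
  have \<phi>: "\<phi> = (\<lambda>t. k * (t + a))"
    by (rule ext, subst *) (use \<open>k \<noteq> 0\<close> in \<open>simp add: a_def distrib_left\<close>)
  have "range (\<lambda>t. cis (\<phi> t)) = sphere 0 1"
  proof -
    have "range (\<lambda>t. cis (\<phi> t)) = (\<lambda>t. cis (k * t)) ` range (\<lambda>t. t + a)"
      by (simp only: \<phi> image_image)
    also have "range (\<lambda>t. t + a) = UNIV" by (rule surjI[of _ "\<lambda>t. t - a"]) simp
    finally show ?thesis using range_cis_affine[OF \<open>k \<noteq> 0\<close>] by simp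
  qed
  then have "orbit UNIV r \<phi> = circle c" by (auto simp: orbit_def circle_def assms(1))
  then show ?thesis by (auto simp: circular_def)
qed

text \<open>Take a time with nonzero radial velocity. If \<open>r^3 V'\<close> never exceeded the
  level \<open>m\<close> further out, the effective potential would fall outwards and the motion
  would leave every annulus; if it were never below \<open>m\<close> further in, the motion would
  reach radius 0. So \<open>r^3 V'\<close> crosses \<open>m\<close> upwards.\<close>

lemma stable_radius_if_noncircular:
  assumes xi: "\<xi> > 0" and V: "central_potential V"
    and nb: "nonsingular_bounded \<xi> V I r \<phi>" and nc: "\<not> circular I r \<phi>"
  shows "\<exists>r. stable_radius V r"
proof -
  obtain K where I: "I = UNIV" and "K \<noteq> 0" and pos: "\<And>t. r t > 0"
    and dr: "\<And>t. (r has_real_derivative deriv r t) (at t)"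
    and dphi: "\<And>t. (\<phi> has_real_derivative K / (\<xi>\<^sup>2 * (r t)\<^sup>2)) (at t)"
    and dv: "\<And>t. (deriv r has_real_derivative K\<^sup>2 / (\<xi>\<^sup>2 * (r t)^3) - deriv V (r t)) (at t)"
    using nonsingular_reduced[OF xi V nb] by blast
  obtain t0 where t0: "deriv r t0 \<noteq> 0"
  proof (rule ccontr)
    assume "\<not> thesis"
    then have "deriv r t = 0" for t using that by blast
    then have "(r has_real_derivative 0) (at t)" for t using dr[of t] by simp
    then have "r t = r 0" for t by (intro DERIV_isconst_all) blast
    then have "circular UNIV r \<phi>"
      using circular_if_const_radius[OF _ \<open>K \<noteq> 0\<close> pos[of 0] xi dphi] by blast
    with nc I show False by simp
  qed
  define U where "U r = V r + K\<^sup>2 / (2 * \<xi>\<^sup>2 * r\<^sup>2)" for r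
  define m where "m = K\<^sup>2 / \<xi>\<^sup>2"
  have "m > 0" using \<open>K \<noteq> 0\<close> xi by (simp add: m_def)
  obtain E where E: "\<And>t. (deriv r t)\<^sup>2 / 2 + U (r t) = E"
    unfolding U_def by (rule reduced_energy[OF xi V is_interval_univ pos dr dv]) auto
  have cv: "continuous_on UNIV (deriv r)"
    using DERIV_isCont[OF dv] by (auto intro!: continuous_at_imp_continuous_on)
  obtain r1 r2 where "orbit UNIV r \<phi> \<subseteq> annulus r1 r2"
    using nb I by (auto simp: nonsingular_bounded_def bounded_motion_def)
  then have "(r t, cis (\<phi> t)) \<in> annulus r1 r2" for t unfolding orbit_def by blast
  then have r2: "r t \<le> r2" for t by (simp add: annulus_def)
  have "\<exists>y>r t0. m < y^3 * deriv V y"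
  proof (rule ccontr)
    assume "\<not> ?thesis"
    then have le: "y^3 * deriv V y \<le> m" if "y > r t0" for y using that by force
    have "U y \<le> U (r t0)" if "y \<ge> r t0" for y
      unfolding U_def by (rule effective_less_eq(1)[OF xi V pos that]) (use le in \<open>simp add: m_def\<close>)
    then obtain t where "r t > r2" using escape_above_either[OF dr cv E t0] by blast
    with r2 show False by (simp add: not_less[symmetric])
  qed
  then obtain y where y: "y > r t0" "m < y^3 * deriv V y" by blast
  have "\<exists>x. 0 < x \<and> x < r t0 \<and> x^3 * deriv V x < m"
  proof (rule ccontr)
    assume "\<not> ?thesis"
    then have le: "x^3 * deriv V x \<ge> m" if "0 < x" "x < r t0" for x using that by force
    have Ule: "U x \<le> U (r t0)" if "0 < x" "x \<le> r t0" for x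
      unfolding U_def by (rule effective_less_eq(2)[OF xi V that]) (use le \<open>0 < x\<close> in \<open>simp add: m_def\<close>)
    \<comment> \<open>The inward escape is the outward one for \<open>-r\<close>. The escape lemma
      needs a potential on the whole ray from \<open>- r t0\<close>, so it is continued by a
      constant past the vertex, where the motion never is.\<close>
    define W where "W s = (if s < 0 then U (- s) else U (r t0))" for s
    have "((\<lambda>t. - r t) has_real_derivative - deriv r t) (at t)" for t by (rule DERIV_minus[OF dr])
    moreover have "continuous_on UNIV (\<lambda>t. - deriv r t)" by (intro continuous_intros cv)
    moreover have "(- deriv r t)\<^sup>2 / 2 + W (- r t) = E" for t using E[of t] pos[of t] by (simp add: W_def)
    moreover have "W s \<le> W (- r t0)" if "s \<ge> - r t0" for s
      using Ule[of "- s"] that pos[of t0] by (auto simp: W_def)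
    ultimately obtain t where "- r t > 0"
      using escape_above_either[of "\<lambda>t. - r t" "\<lambda>t. - deriv r t" W E t0 0] t0 by auto
    with pos[of t] show False by simp
  qed
  then obtain x where "0 < x" "x < r t0" "x^3 * deriv V x < m" by blast
  with y \<open>m > 0\<close> show ?thesis using stable_radius_if_crossing[OF V, of x y m] by auto
qed

text \<open>The radial coordinate is parametrised as \<open>r = e\<^sup>x\<close>, so that the maximal motion is the inverse
  of an antiderivative on the whole line.\<close>

lemma barrier_trajectory:
  fixes K :: real
  assumes xi: "\<xi> > 0" and V: "central_potential V" and "\<epsilon> > 0"
  defines "U \<equiv> \<lambda>r. V r + K\<^sup>2 / (2 * \<xi>\<^sup>2 * r\<^sup>2)"
  assumes top: "\<And>r. r > 0 \<Longrightarrow> U r \<le> U 1"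
  obtains J r \<phi> where "trajectory \<xi> V J r \<phi>" "has_angular_momentum \<xi> J r \<phi> K" "0 \<in> J"
    "r 0 = 1" "\<phi> 0 = \<phi>0" "deriv r 0 = \<epsilon>" "\<And>t. t \<in> J \<Longrightarrow> (r has_real_derivative deriv r t) (at t)"
    "\<And>t. t \<in> J \<Longrightarrow> deriv r t \<ge> \<epsilon>"
proof -
  define U1 where "U1 r = deriv V r - K\<^sup>2 / (\<xi>\<^sup>2 * r^3)" for r
  have dU: "(U has_real_derivative U1 r) (at r)" if "r > 0" for r
  proof -
    have "(r^3 * deriv V r - K\<^sup>2 / \<xi>\<^sup>2) / r^3 = U1 r" using that xi by (simp add: U1_def field_simps)
    then show ?thesis using effective_deriv[OF xi V that, of K] by (simp add: U_def)
  qed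
  \<comment> \<open>The squared radial velocity at radius \<open>exp x\<close> of the motion that
    leaves radius 1 with velocity \<open>\<epsilon>\<close>; as the potential is maximal at 1, it
    never drops below \<open>\<epsilon>\<^sup>2\<close>.\<close>
  define q where "q x = \<epsilon>\<^sup>2 + 2 * (U 1 - U (exp x))" for x
  define w where "w x = sqrt (q x)" for x
  have q: "q x \<ge> \<epsilon>\<^sup>2" for x using top[of "exp x"] by (simp add: q_def)
  have qpos: "q x > 0" for x using q[of x] \<open>\<epsilon> > 0\<close> by (smt (verit) zero_less_power)
  have w: "w x \<ge> \<epsilon>" for x unfolding w_def using q[of x] \<open>\<epsilon> > 0\<close> by (intro real_le_rsqrt)
  have wpos: "w x > 0" for x using w[of x] \<open>\<epsilon> > 0\<close> by simp
  have dw: "(w has_real_derivative - (U1 (exp x) * exp x / w x)) (at x)" for x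
  proof -
    have "((\<lambda>x. U (exp x)) has_real_derivative U1 (exp x) * exp x) (at x)"
      by (rule DERIV_chain2[OF dU DERIV_exp]) simp
    then have "(q has_real_derivative - 2 * (U1 (exp x) * exp x)) (at x)"
      unfolding q_def[abs_def] by (auto intro!: derivative_eq_intros)
    from DERIV_chain2[OF DERIV_real_sqrt[OF qpos] this]
    show ?thesis unfolding w_def[abs_def] by (simp add: field_simps)
  qed
  have cw: "continuous_on UNIV w" using DERIV_isCont[OF dw] by (auto intro!: continuous_at_imp_continuous_on)
  \<comment> \<open>\<open>f\<close> is \<open>dt/dx\<close> and \<open>g\<close> is
    \<open>d\<phi>/dx\<close> for \<open>r = exp x\<close>. The time function \<open>F\<close> may
    have bounded range, since the point may reach infinity or the vertex in finite time.\<close>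
  define f where "f x = exp x / w x" for x
  define g where "g x = f x * K / (\<xi>\<^sup>2 * (exp x)\<^sup>2)" for x
  have cf: "continuous_on UNIV f" unfolding f_def
    using wpos by (intro continuous_intros cw) (auto simp: less_imp_neq[THEN not_sym])
  have cg: "continuous_on UNIV g" unfolding g_def
    using xi by (intro continuous_intros cf) auto
  have fpos: "f x > 0" for x using wpos by (simp add: f_def)
  obtain F where F: "\<And>x. (F has_real_derivative f x) (at x)" "F 0 = 0"
    using antiderivative_exists[OF cf] by blast
  obtain G where G: "\<And>x. (G has_real_derivative g x) (at x)" "G 0 = \<phi>0"
    using antiderivative_exists[OF cg] by blast
  note diffeo = increasing_diffeo[OF F(1) fpos]
  define J where "J = range F"
  define X where "X = inv F"
  have XF: "X (F x) = x" for x using diffeo(2) by (simp add: X_def inv_f_f)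
  have dX: "(X has_real_derivative inverse (f (X t))) (at t)" if "t \<in> J" for t
    using that diffeo(5) by (auto simp: J_def X_def inv_f_f[OF diffeo(2)])
  define r where "r t = exp (X t)" for t
  define \<phi> where "\<phi> t = G (X t)" for t
  have inv: "inverse (f x) = w x / exp x" for x by (simp add: f_def)
  have dr: "(r has_real_derivative w (X t)) (at t)" if "t \<in> J" for t
  proof -
    have "(r has_real_derivative exp (X t) * inverse (f (X t))) (at t)"
      unfolding r_def[abs_def] by (rule DERIV_chain2[OF DERIV_exp dX[OF that]])
    then show ?thesis by (simp add: inv)
  qed
  have dphi: "(\<phi> has_real_derivative K / (\<xi>\<^sup>2 * (r t)\<^sup>2)) (at t)" if "t \<in> J" for t
  proof -
    have "(\<phi> has_real_derivative g (X t) * inverse (f (X t))) (at t)"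
      unfolding \<phi>_def[abs_def] by (rule DERIV_chain2[OF G(1) dX[OF that]])
    moreover have "f (X t) \<noteq> 0" using fpos[of "X t"] by simp
    then have "g (X t) * inverse (f (X t)) = K / (\<xi>\<^sup>2 * (r t)\<^sup>2)" by (simp add: g_def r_def)
    ultimately show ?thesis by simp
  qed
  have dv: "((\<lambda>t. w (X t)) has_real_derivative K\<^sup>2 / (\<xi>\<^sup>2 * (r t)^3) - deriv V (r t)) (at t)" if "t \<in> J" for t
    using DERIV_chain2[OF dw dX[OF that]] wpos[of "X t"] by (simp add: inv U1_def r_def)
  have J: "open J" "is_interval J" "J \<noteq> {}" using diffeo(3,4) by (auto simp: J_def)
  have rpos: "r t > 0" for t by (simp add: r_def)
  have sol: "solution \<xi> V J r \<phi>" "has_angular_momentum \<xi> J r \<phi> K"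
    using reduced_solutionI[OF xi V J rpos dr dphi dv] by auto
  have J0: "0 \<in> J" "X 0 = 0" using F(2) XF[of 0] by (auto simp: J_def intro: range_eqI[of _ _ 0])
  have mono: "F x < F y \<longleftrightarrow> x < y" for x y using diffeo(1) by (simp add: strict_mono_less)
  have "trajectory \<xi> V J r \<phi>"
    unfolding trajectory_def
  proof (intro conjI allI impI)
    fix J' r' \<phi>' assume A: "solution \<xi> V J' r' \<phi>' \<and> J \<subseteq> J' \<and> (\<forall>t\<in>J. r' t = r t \<and> \<phi>' t = \<phi> t)"
    have J': "is_interval J'" and pos': "\<And>t. t \<in> J' \<Longrightarrow> r' t > 0"
      and cr': "\<And>t. t \<in> J' \<Longrightarrow> isCont r' t"
      using A by (auto simp: solution_def real_differentiable_def DERIV_isCont)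
    have rF: "r' (F x) = exp x" for x using A by (simp add: J_def r_def XF)
    have r'0: "r' 0 = 1" using rF[of 0] F(2) by simp
    \<comment> \<open>Maximality: on \<open>J\<close> the radius runs through all positive reals. A
      proper extension would be continuous and positive on a compact interval reaching from 0 past
      an end of \<open>J\<close>, hence bounded above and away from 0 there.\<close>
    have "s \<in> J" if "s \<in> J'" for s
    proof (rule ccontr)
      assume "s \<notin> J"
      have J'I: "t \<in> J'" if "s \<le> t \<and> t \<le> 0 \<or> 0 \<le> t \<and> t \<le> s" for t
        using J' \<open>s \<in> J'\<close> J0(1) A that unfolding is_interval_1 by blast
      have JI: "t \<in> J" if "a \<in> J" "b \<in> J" "a \<le> t" "t \<le> b" for a b t
        using J(2) that unfolding is_interval_1 by blast
      show False
      proof (cases "s \<ge> 0")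
        case True
        have "continuous_on {0..s} r'" using cr' J'I by (auto intro!: continuous_at_imp_continuous_on)
        then obtain u where u: "u \<in> {0..s}" "\<And>t. t \<in> {0..s} \<Longrightarrow> r' t \<le> r' u"
          using continuous_attains_sup[of "{0..s}" r'] True by auto
        have u1: "r' u \<ge> 1" using u(2)[of 0] True r'0 by simp
        \<comment> \<open>The time in \<open>J\<close> at which the radius exceeds the supposed
          maximum by 1; on the other side half of the minimum is used.\<close>
        define t where "t = F (ln (r' u + 1))"
        have "t \<ge> 0" using mono[of 0 "ln (r' u + 1)"] u1 F(2) by (simp add: t_def)
        moreover have "t \<le> s"
          using JI[of 0 t s] J0(1) \<open>s \<notin> J\<close> True by (force simp: t_def J_def)
        moreover have "r' t = r' u + 1" using u1 by (simp add: t_def rF)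
        ultimately show False using u(2)[of t] by simp
      next
        case False
        have "continuous_on {s..0} r'" using cr' J'I by (auto intro!: continuous_at_imp_continuous_on)
        then obtain u where u: "u \<in> {s..0}" "\<And>t. t \<in> {s..0} \<Longrightarrow> r' t \<ge> r' u"
          using continuous_attains_inf[of "{s..0}" r'] False by auto
        have u1: "r' u \<le> 1" "r' u > 0" using u(1) u(2)[of 0] J'I[of u] pos'[of u] False r'0 by auto
        define t where "t = F (ln (r' u / 2))"
        have "t \<le> 0" using mono[of "ln (r' u / 2)" 0] u1 F(2) by (simp add: t_def)
        moreover have "t \<ge> s"
          using JI[of t 0 s] J0(1) \<open>s \<notin> J\<close> False by (force simp: t_def J_def)
        moreover have "r' t = r' u / 2" using u1 by (simp add: t_def rF)
        ultimately show False using u(2)[of t] u1 by simp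
      qed
    qed
    with A show "J' = J" by blast
  qed (use sol in simp)
  moreover have "deriv r t = w (X t)" if "t \<in> J" for t using DERIV_imp_deriv[OF dr[OF that]] .
  moreover have "w 0 = \<epsilon>" using \<open>\<epsilon> > 0\<close> by (simp add: w_def q_def)
  ultimately show ?thesis
    using that[of J r \<phi>] sol(2) J0 G(2) dr w by (simp add: r_def \<phi>_def)
qed

text \<open>Circular motions on all circles give \<open>V' > 0\<close> everywhere. Without a stable
  radius \<open>r^3 V'\<close> would be nonincreasing, so the effective potential belonging to the
  circle of radius 1 would have its maximum there, and an arbitrarily small radial push would carry
  the point away.\<close>

lemma stable_radius_if_weakly_closing:
  assumes xi: "\<xi> > 0" and V: "central_potential V"
    and os: "\<And>r0. r0 > 0 \<Longrightarrow> orbitally_stable \<xi> V r0"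
  shows "\<exists>r. stable_radius V r"
proof (rule ccontr)
  assume no: "\<nexists>r. stable_radius V r"
  have motion: "\<exists>r \<phi> K. (\<forall>t. r t = r0) \<and> has_angular_momentum \<xi> UNIV r \<phi> K \<and>
      orbitally_stable_motion \<xi> V UNIV r \<phi> \<and> K \<noteq> 0 \<and> K\<^sup>2 / (\<xi>\<^sup>2 * r0^3) = deriv V r0" if r0: "r0 > 0" for r0
  proof -
    obtain I r \<phi> where tr: "trajectory \<xi> V I r \<phi>" "orbit I r \<phi> = circle r0" "closed_motion I r \<phi>"
      "orbitally_stable_motion \<xi> V I r \<phi>"
      using os[OF r0] by (auto simp: orbitally_stable_def)
    have I: "I = UNIV" and sol: "solution \<xi> V UNIV r \<phi>"
      using tr by (auto simp: closed_motion_def trajectory_def)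
    have r: "r t = r0" for t using tr(2) I by (force simp: orbit_def circle_def)
    obtain K where K: "has_angular_momentum \<xi> UNIV r \<phi> K" using solution_angular_momentum[OF V sol] .
    have red: "(\<phi> has_real_derivative K / (\<xi>\<^sup>2 * (r t)\<^sup>2)) (at t)"
      "(r has_real_derivative deriv r t) (at t)"
      "(deriv r has_real_derivative K\<^sup>2 / (\<xi>\<^sup>2 * (r t)^3) - deriv V (r t)) (at t)" for t
      using reduced_iff[OF xi V, of UNIV r \<phi> K] sol K by auto
    have r': "r = (\<lambda>_. r0)" using r by auto
    have "deriv r = (\<lambda>_. 0)" by (simp add: r')
    then have "((\<lambda>_. 0) has_real_derivative K\<^sup>2 / (\<xi>\<^sup>2 * r0^3) - deriv V r0) (at 0)"
      using red(3)[of 0] r by simp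
    then have V1: "K\<^sup>2 / (\<xi>\<^sup>2 * r0^3) = deriv V r0" using DERIV_unique[OF _ DERIV_const] by fastforce
    \<comment> \<open>With zero momentum the angle is constant, and a single point is not a
      circle.\<close>
    have "K \<noteq> 0"
    proof
      assume "K = 0"
      then have "\<phi> t = \<phi> 0" for t using red(1) by (intro DERIV_isconst_all) simp
      then have "cis (\<phi> t) = cis (\<phi> 0)" for t by metis
      then have "orbit I r \<phi> \<subseteq> {(r0, cis (\<phi> 0))}" by (auto simp: orbit_def r)
      moreover have "(r0, 1) \<in> circle r0" "(r0, -1) \<in> circle r0" by (auto simp: circle_def)
      ultimately have "(1::complex) = -1" using tr(2) by (metis prod.inject singletonD subsetD)
      then show False by simp
    qed
    then show ?thesis using r K tr(4) I V1 by blast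
  qed
  have Vpos: "deriv V r0 > 0" if r0: "r0 > 0" for r0
  proof -
    obtain K where "K \<noteq> 0" "K\<^sup>2 / (\<xi>\<^sup>2 * r0^3) = deriv V r0" using motion[OF r0] by blast
    moreover have "K\<^sup>2 / (\<xi>\<^sup>2 * r0^3) > 0" using \<open>K \<noteq> 0\<close> xi r0 by simp
    ultimately show ?thesis by simp
  qed
  obtain r \<phi> K where r: "\<And>t. r t = 1" and K: "has_angular_momentum \<xi> UNIV r \<phi> K"
    and osm: "orbitally_stable_motion \<xi> V UNIV r \<phi>" and V1: "K\<^sup>2 / (\<xi>\<^sup>2 * 1^3) = deriv V 1"
    using motion[of 1] by auto
  define m where "m = K\<^sup>2 / \<xi>\<^sup>2"
  have m: "m = 1^3 * deriv V 1" using V1 by (simp add: m_def)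
  have anti: "b^3 * deriv V b \<le> a^3 * deriv V a" if "0 < a" "a < b" for a b
  proof (rule ccontr)
    assume n: "\<not> ?thesis"
    \<comment> \<open>Were \<open>r^3 V'\<close> larger at \<open>b\<close> than at
      \<open>a\<close>, it would cross the midpoint of the two values upwards.\<close>
    define c where "c = (a^3 * deriv V a + b^3 * deriv V b) / 2"
    have "0 < c" using Vpos[of a] Vpos[of b] that by (simp add: c_def add_pos_pos)
    then have "\<exists>r. stable_radius V r"
      using stable_radius_if_crossing[OF V that, of c] n by (simp add: c_def field_simps)
    with no show False by blast
  qed
  define U where "U r = V r + K\<^sup>2 / (2 * \<xi>\<^sup>2 * r\<^sup>2)" for r
  have top: "U r \<le> U 1" if "r > 0" for r
  proof (cases "r \<le> 1")
    case True
    show ?thesis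
      unfolding U_def by (rule effective_less_eq(2)[OF xi V that True]) (use anti[of _ 1] that m in \<open>simp add: m_def\<close>)
  next
    case False
    then have "1 \<le> r" by simp
    show ?thesis
      unfolding U_def by (rule effective_less_eq(1)[OF xi V zero_less_one \<open>1 \<le> r\<close>])
        (use anti[of 1] m in \<open>simp add: m_def\<close>)
  qed
  \<comment> \<open>Radius below 2: a neighbourhood of the phase orbit of the circle of radius 1
    which the pushed motion is bound to leave.\<close>
  define S where "S = {p :: real \<times> complex \<times> real \<times> real. fst p < 2}"
  have "open S" unfolding S_def by (intro open_Collect_less continuous_intros)
  moreover have "phase_point r \<phi> ` UNIV \<subseteq> S" by (auto simp: phase_point_def S_def r)
  ultimately obtain W where "open W" "phase_point r \<phi> ` UNIV \<subseteq> W"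
    and W: "\<And>J r1 \<phi>1 t0. trajectory \<xi> V J r1 \<phi>1 \<Longrightarrow> has_angular_momentum \<xi> J r1 \<phi>1 K \<Longrightarrow>
       t0 \<in> J \<Longrightarrow> phase_point r1 \<phi>1 t0 \<in> W \<Longrightarrow> {t0..} \<subseteq> J \<and> (\<forall>t\<ge>t0. phase_point r1 \<phi>1 t \<in> S)"
    using osm K unfolding orbitally_stable_motion_def by meson
  then have "phase_point r \<phi> 0 \<in> W" by blast
  have "r = (\<lambda>_. 1)" using r by auto
  then have "deriv r 0 = 0" by simp
  have "deriv \<phi> 0 = K / \<xi>\<^sup>2"
    using K xi r by (auto simp: has_angular_momentum_def cone_profile_def field_simps)
  then have p0: "(1, cis (\<phi> 0), 0, K / \<xi>\<^sup>2) \<in> W"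
    using \<open>phase_point r \<phi> 0 \<in> W\<close> \<open>deriv r 0 = 0\<close> by (simp add: phase_point_def r)
  \<comment> \<open>Only the radial velocity is varied, so the angular momentum remains
    \<open>K\<close> and the perturbed state stays in the level set used for orbital
    stability.\<close>
  define e where "e s = (1 :: real, cis (\<phi> 0), s :: real, K / \<xi>\<^sup>2)" for s
  have "continuous_on UNIV e" unfolding e_def by (intro continuous_intros)
  then have "open (e -` W)" using \<open>open W\<close> by (rule open_vimage[rotated])
  moreover have "0 \<in> e -` W" using p0 by (simp add: e_def)
  ultimately obtain d where d: "d > 0" "ball 0 d \<subseteq> e -` W" using open_contains_ball by metis
  define \<epsilon> where "\<epsilon> = d / 2"
  have "\<epsilon> \<in> ball 0 d" using d(1) by (simp add: \<epsilon>_def)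
  then have "e \<epsilon> \<in> W" using d(2) by blast
  then have \<epsilon>: "\<epsilon> > 0" "e \<epsilon> \<in> W" using d(1) by (simp_all add: \<epsilon>_def)
  obtain J r1 \<phi>1 where tr: "trajectory \<xi> V J r1 \<phi>1" "has_angular_momentum \<xi> J r1 \<phi>1 K" "0 \<in> J"
    "r1 0 = 1" "\<phi>1 0 = \<phi> 0" "deriv r1 0 = \<epsilon>" "\<And>t. t \<in> J \<Longrightarrow> (r1 has_real_derivative deriv r1 t) (at t)"
    "\<And>t. t \<in> J \<Longrightarrow> deriv r1 t \<ge> \<epsilon>"
    using barrier_trajectory[OF xi V \<epsilon>(1), of K "\<phi> 0"] top unfolding U_def by blast
  have "deriv \<phi>1 0 = K / \<xi>\<^sup>2"
    using tr(2,3,4) xi by (auto simp: has_angular_momentum_def cone_profile_def field_simps)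
  then have "phase_point r1 \<phi>1 0 \<in> W" using \<epsilon>(2) tr by (simp add: phase_point_def e_def)
  from W[OF tr(1,2,3) this] have J: "{0..} \<subseteq> J" and S: "\<And>t. t \<ge> 0 \<Longrightarrow> r1 t < 2"
    by (auto simp: S_def phase_point_def)
  have grow: "r1 0 - \<epsilon> * 0 \<le> r1 t - \<epsilon> * t" if "t \<ge> 0" for t
  proof (rule DERIV_nonneg_imp_nondecreasing[OF that, of "\<lambda>t. r1 t - \<epsilon> * t"])
    fix s :: real assume "0 \<le> s"
    then have "s \<in> J" using J by auto
    then have "((\<lambda>t. r1 t - \<epsilon> * t) has_real_derivative deriv r1 s - \<epsilon>) (at s)"
      using tr(7) by (auto intro!: derivative_eq_intros)
    then show "\<exists>y. ((\<lambda>t. r1 t - \<epsilon> * t) has_real_derivative y) (at s) \<and> 0 \<le> y"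
      using tr(8)[OF \<open>s \<in> J\<close>] by auto
  qed
  have "r1 (1 / \<epsilon>) \<ge> 2" using grow[of "1 / \<epsilon>"] \<epsilon>(1) tr(4) by simp
  with S[of "1 / \<epsilon>"] \<epsilon>(1) show False by simp
qed

section \<open>Orbital stability\<close>

text \<open>\<open>D s * exp (- C * s)\<close> is nonincreasing and starts at 0.\<close>

lemma gronwall_zero_right:
  fixes D D' :: "real \<Rightarrow> real"
  assumes "a \<le> b" and d: "\<And>s. a \<le> s \<Longrightarrow> s \<le> b \<Longrightarrow> (D has_real_derivative D' s) (at s)"
    and le: "\<And>s. a \<le> s \<Longrightarrow> s \<le> b \<Longrightarrow> D' s \<le> C * D s" and "D a = 0"
  shows "D b \<le> 0"
proof -
  have "D b * exp (- C * b) \<le> D a * exp (- C * a)"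
  proof (rule DERIV_nonpos_imp_nonincreasing[OF \<open>a \<le> b\<close>, of "\<lambda>s. D s * exp (- C * s)"])
    fix s assume s: "a \<le> s" "s \<le> b"
    have "((\<lambda>s. D s * exp (- C * s)) has_real_derivative (D' s - C * D s) * exp (- C * s)) (at s)"
      using d[OF s] by (auto intro!: derivative_eq_intros simp: algebra_simps)
    moreover have "(D' s - C * D s) * exp (- C * s) \<le> 0"
      using le[OF s] by (intro mult_nonpos_nonneg) auto
    ultimately show "\<exists>y. ((\<lambda>s. D s * exp (- C * s)) has_real_derivative y) (at s) \<and> y \<le> 0" by blast
  qed
  then show ?thesis using \<open>D a = 0\<close> by (simp add: mult_le_0_iff not_le)
qed

text \<open>The two-sided bound on \<open>D'\<close> lets the estimate run backwards in time as
  well, through the substitution of \<open>-s\<close> for \<open>s\<close>.\<close>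

lemma gronwall_zero:
  fixes D D' :: "real \<Rightarrow> real"
  assumes d: "\<And>s. s \<in> closed_segment a b \<Longrightarrow> (D has_real_derivative D' s) (at s)"
    and le: "\<And>s. s \<in> closed_segment a b \<Longrightarrow> \<bar>D' s\<bar> \<le> C * D s" and "D a = 0"
  shows "D b \<le> 0"
proof (cases "a \<le> b")
  case True
  then show ?thesis
    using d le \<open>D a = 0\<close> by (intro gronwall_zero_right[of a b D D' C]) (auto simp: closed_segment_eq_real_ivl abs_le_iff)
next
  case False
  have "D (- (- b)) \<le> 0"
  proof (rule gronwall_zero_right[of "- a" "- b" "\<lambda>s. D (- s)" "\<lambda>s. - D' (- s)" C])
    show "((\<lambda>s. D (- s)) has_real_derivative - D' (- s)) (at s)" if "- a \<le> s" "s \<le> - b" for s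
    proof -
      have "(uminus has_real_derivative - 1) (at s)" by (auto intro!: derivative_eq_intros)
      from DERIV_chain2[OF d this] show ?thesis using that False by (simp add: closed_segment_eq_real_ivl)
    qed
    show "- D' (- s) \<le> C * D (- s)" if "- a \<le> s" "s \<le> - b" for s
      using le[of "- s"] that False by (simp add: closed_segment_eq_real_ivl abs_le_iff)
  qed (use False \<open>D a = 0\<close> in auto)
  then show ?thesis by simp
qed

text \<open>Between \<open>t0\<close> and \<open>t\<close> both radii stay in a compact part of the
  half-line, where the radial force is Lipschitz; Gronwall's estimate for the squared distance in
  the phase plane does the rest.\<close>

lemma motion_unique:
  assumes xi: "\<xi> > 0" and V: "central_potential V" and J: "is_interval J" "t0 \<in> J" "t \<in> J"
    and pos1: "\<And>t. t \<in> J \<Longrightarrow> r1 t > 0" and pos2: "\<And>t. t \<in> J \<Longrightarrow> r2 t > 0"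
    and dr1: "\<And>t. t \<in> J \<Longrightarrow> (r1 has_real_derivative v1 t) (at t)"
    and dr2: "\<And>t. t \<in> J \<Longrightarrow> (r2 has_real_derivative v2 t) (at t)"
    and dv1: "\<And>t. t \<in> J \<Longrightarrow> (v1 has_real_derivative K\<^sup>2 / (\<xi>\<^sup>2 * (r1 t)^3) - deriv V (r1 t)) (at t)"
    and dv2: "\<And>t. t \<in> J \<Longrightarrow> (v2 has_real_derivative K\<^sup>2 / (\<xi>\<^sup>2 * (r2 t)^3) - deriv V (r2 t)) (at t)"
    and init: "r1 t0 = r2 t0" "v1 t0 = v2 t0"
  shows "r1 t = r2 t"
proof -
  define S where "S = closed_segment t0 t"
  have SJ: "S \<subseteq> J" unfolding S_def
    using J by (simp add: closed_segment_subset is_interval_convex_1)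
  \<comment> \<open>All radii met by the two motions; by compactness they lie in some
    \<open>{l..u}\<close> with \<open>l > 0\<close>, away from the singularity of the force.\<close>
  define A where "A = r1 ` S \<union> r2 ` S"
  have "compact A" unfolding A_def S_def
    using SJ DERIV_isCont[OF dr1] DERIV_isCont[OF dr2]
    by (intro compact_Un compact_continuous_image continuous_at_imp_continuous_on) (auto simp: S_def)
  have "A \<noteq> {}" by (auto simp: A_def S_def)
  obtain l where l: "l \<in> A" "\<And>x. x \<in> A \<Longrightarrow> l \<le> x" using compact_attains_inf[OF \<open>compact A\<close> \<open>A \<noteq> {}\<close>] by blast
  obtain u where u: "u \<in> A" "\<And>x. x \<in> A \<Longrightarrow> x \<le> u" using compact_attains_sup[OF \<open>compact A\<close> \<open>A \<noteq> {}\<close>] by blast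
  have "l > 0" using l(1) SJ pos1 pos2 by (auto simp: A_def)
  define g where "g \<rho> = K\<^sup>2 / (\<xi>\<^sup>2 * \<rho>^3) - deriv V \<rho>" for \<rho>
  define g1 where "g1 \<rho> = - (3 * K\<^sup>2 / (\<xi>\<^sup>2 * \<rho>^4)) - deriv (deriv V) \<rho>" for \<rho>
  have dg: "(g has_real_derivative g1 \<rho>) (at \<rho>)" if "\<rho> > 0" for \<rho>
    unfolding g_def[abs_def] g1_def using central_potentialD(2)[OF V that] that xi
    by (auto intro!: derivative_eq_intros simp: field_simps eval_nat_numeral)
  have "isCont g1 \<rho>" if "\<rho> > 0" for \<rho>
    unfolding g1_def[abs_def] using that xi central_potentialD(3)[OF V that] by (auto intro!: continuous_intros)
  then have "continuous_on {l..u} g1" using \<open>l > 0\<close> by (auto intro!: continuous_at_imp_continuous_on)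
  then have "compact (g1 ` {l..u})" by (intro compact_continuous_image) auto
  then have "bounded (g1 ` {l..u})" by (rule compact_imp_bounded)
  then obtain L where L: "\<forall>x\<in>g1 ` {l..u}. \<bar>x\<bar> \<le> L" unfolding bounded_real by blast
  have "l \<le> u" using l(2)[OF u(1)] .
  then have "\<bar>g1 l\<bar> \<le> L" using L by simp
  then have "L \<ge> 0" by linarith
  have lip: "\<bar>g x - g y\<bar> \<le> L * \<bar>x - y\<bar>" if "x \<in> A" "y \<in> A" for x y
  proof -
    have in_lu: "l \<le> x" "x \<le> u" "l \<le> y" "y \<le> u" using l u that by auto
    have "norm (g x - g y) \<le> L * norm (x - y)"
    proof (rule field_differentiable_bound[of "{l..u}" g g1])
      show "(g has_real_derivative g1 z) (at z within {l..u})" if "z \<in> {l..u}" for z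
        by (rule has_field_derivative_at_within[OF dg]) (use that \<open>l > 0\<close> in simp)
      show "norm (g1 z) \<le> L" if "z \<in> {l..u}" for z using L that by simp
    qed (use in_lu in auto)
    then show ?thesis by simp
  qed
  \<comment> \<open>With \<open>L\<close> the Lipschitz constant of the force and
    \<open>2 a b \<le> a^2 + b^2\<close>, its derivative is bounded by
    \<open>(1 + L) D\<close>.\<close>
  define D where "D s = (r1 s - r2 s)\<^sup>2 + (v1 s - v2 s)\<^sup>2" for s
  define D' where "D' s = 2 * (r1 s - r2 s) * (v1 s - v2 s) + 2 * (v1 s - v2 s) * (g (r1 s) - g (r2 s))" for s
  have "D t \<le> 0"
  proof (rule gronwall_zero[of t0 t D D' "1 + L"])
    fix s assume "s \<in> closed_segment t0 t"
    then have s: "s \<in> S" "s \<in> J" using SJ by (auto simp: S_def)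
    show "(D has_real_derivative D' s) (at s)"
      unfolding D_def[abs_def] D'_def g_def
      using dr1[OF s(2)] dr2[OF s(2)] dv1[OF s(2)] dv2[OF s(2)]
      by (auto intro!: derivative_eq_intros simp: algebra_simps)
    define a where "a = \<bar>r1 s - r2 s\<bar>"
    define b where "b = \<bar>v1 s - v2 s\<bar>"
    have "\<bar>D' s\<bar> \<le> \<bar>2 * (r1 s - r2 s) * (v1 s - v2 s)\<bar> + \<bar>2 * (v1 s - v2 s) * (g (r1 s) - g (r2 s))\<bar>"
      unfolding D'_def by (rule abs_triangle_ineq)
    also have "\<dots> = 2 * a * b + 2 * b * \<bar>g (r1 s) - g (r2 s)\<bar>" by (simp only: abs_mult a_def b_def abs_numeral)
    also have "\<dots> \<le> 2 * a * b + 2 * b * (L * a)"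
      using lip[of "r1 s" "r2 s"] s by (intro add_left_mono mult_left_mono) (auto simp: A_def a_def b_def)
    also have "\<dots> = (1 + L) * (2 * a * b)" by (simp add: algebra_simps)
    also have "\<dots> \<le> (1 + L) * (a\<^sup>2 + b\<^sup>2)"
      using sum_squares_bound[of a b] \<open>L \<ge> 0\<close> by (intro mult_left_mono) auto
    finally show "\<bar>D' s\<bar> \<le> (1 + L) * D s" by (simp add: D_def a_def b_def)
  qed (simp add: D_def init)
  then have "(r1 t - r2 t)\<^sup>2 \<le> 0" unfolding D_def by (smt (verit) zero_le_power2)
  then show ?thesis by simp
qed

text \<open>In the phase coordinates \<open>x\<close> and \<open>y\<close>, the rescaled radial
  velocity, well orbits are circles \<open>x = \<mu> sin \<theta>\<close>,
  \<open>y = \<mu> cos \<theta>\<close> about the circular motion. By uniqueness every trajectory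
  with momentum \<open>K\<close> starting nearby is such an orbit, so its distance
  \<open>\<mu>\<close> from the centre is preserved.\<close>

lemma orbitally_stable_if_stable_radius:
  assumes xi: "\<xi> > 0" and V: "central_potential V" and st: "stable_radius V r0"
  shows "orbitally_stable \<xi> V r0"
proof -
  define K where "K = \<xi> * sqrt (r0^3 * deriv V r0)"
  obtain \<delta> H h where w: "cone_well \<xi> V r0 K \<delta> H h"
    and K2: "K\<^sup>2 = \<xi>\<^sup>2 * r0^3 * deriv V r0"
    using cone_well_exists[OF xi V st] unfolding K_def by metis
  interpret cone_well \<xi> V r0 K \<delta> H h by fact
  define \<omega> where "\<omega> = K / (\<xi>\<^sup>2 * r0\<^sup>2)"
  have "K \<noteq> 0" "\<omega> \<noteq> 0" using K xi r0 by (auto simp: \<omega>_def)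
  note circ = circular_solution[OF xi V r0 K2 \<open>K \<noteq> 0\<close>, folded \<omega>_def]
  have "deriv (\<lambda>t. \<omega> * t) t = \<omega>" for t by (rule DERIV_imp_deriv[OF DERIV_cmult_Id])
  then have pp: "phase_point (\<lambda>_. r0) (\<lambda>t. \<omega> * t) t = (r0, cis (\<omega> * t), 0, \<omega>)" for t
    by (simp add: phase_point_def)
  define \<Gamma> where "\<Gamma> = (\<lambda>c. (r0, c, 0 :: real, \<omega>)) ` sphere (0 :: complex) 1"
  have \<Gamma>: "phase_point (\<lambda>_. r0) (\<lambda>t. \<omega> * t) ` UNIV = \<Gamma>"
    unfolding \<Gamma>_def range_cis_affine[OF \<open>\<omega> \<noteq> 0\<close>, symmetric] image_image pp ..
  have "compact \<Gamma>" unfolding \<Gamma>_def by (intro compact_continuous_image continuous_intros) auto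
  have "orbitally_stable_motion \<xi> V UNIV (\<lambda>_. r0) (\<lambda>t. \<omega> * t)"
    unfolding orbitally_stable_motion_def \<Gamma>
  proof (intro allI impI)
    fix K' U assume K': "has_angular_momentum \<xi> UNIV (\<lambda>_. r0) (\<lambda>t. \<omega> * t) K'" and U: "open U \<and> \<Gamma> \<subseteq> U"
    have "K' = K" using K' circ(3) by (auto simp: has_angular_momentum_def)
    obtain e where e: "e > 0" "(\<Union>x\<in>\<Gamma>. ball x e) \<subseteq> U"
      using compact_subset_open_imp_ball_epsilon_subset[OF \<open>compact \<Gamma>\<close>] U by blast
    define \<kappa> where "\<kappa> = sqrt 2 * K / \<xi>\<^sup>2"
    have "\<kappa> > 0" using K xi by (simp add: \<kappa>_def)
    \<comment> \<open>The phase point with circle coordinate \<open>c\<close>, oscillator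
      coordinates \<open>x\<close>, \<open>y\<close> and the angular velocity dictated by
      \<open>K\<close>.\<close>
    define p where "p c x y = (1 / H x, c :: complex, - (\<kappa> * y), K / (\<xi>\<^sup>2 * (1 / H x)\<^sup>2))" for c x y
    have p0: "p c 0 0 = (r0, c, 0, \<omega>)" for c using r0 by (simp add: p_def H0 \<omega>_def)
    have "isCont H 0" using dH[of 0] delta DERIV_isCont by auto
    have "isCont (\<lambda>q. H (fst q)) (0, 0 :: real)"
      using continuous_at_compose[of "(0, 0 :: real)" fst H] \<open>isCont H 0\<close> by (simp add: o_def continuous_fst)
    then have "isCont (\<lambda>q. p 1 (fst q) (snd q)) (0, 0)"
      unfolding p_def using H0 r0 xi by (intro continuous_intros) auto
    then obtain d where d: "d > 0" "\<And>q. dist q (0, 0) < d \<Longrightarrow> dist (p 1 (fst q) (snd q)) (p 1 0 0) < e"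
      unfolding continuous_at_eps_delta using e(1) by fastforce
    have inU: "p c x y \<in> U" if "c \<in> sphere 0 1" "x\<^sup>2 + y\<^sup>2 < d\<^sup>2" for c x y
    proof -
      have "dist (x, y) (0, 0) < d"
        using real_sqrt_less_mono[OF that(2)] d(1) by (simp add: dist_Pair_Pair dist_real_def)
      then have "dist (p 1 x y) (p 1 0 0) < e" using d(2)[of "(x, y)"] by simp
      \<comment> \<open>Rotation invariance: the distance to the circular motion does not involve
        \<open>c\<close>, so continuity at \<open>c = 1\<close> gives an estimate uniform over the
        circle.\<close>
      moreover have "dist (p 1 x y) (p 1 0 0) = dist (p c x y) (p c 0 0)"
        by (simp add: p_def dist_Pair_Pair)
      moreover have "p c 0 0 \<in> \<Gamma>" using that(1) by (simp add: p0 \<Gamma>_def)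
      ultimately have "p c x y \<in> ball (p c 0 0) e" "p c 0 0 \<in> \<Gamma>" by (simp_all add: dist_commute)
      then show ?thesis using e(2) by blast
    qed
    \<comment> \<open>From \<open>\<bar>x\<bar> \<le> m\<close> and \<open>\<bar>y\<bar> < m\<close>
      the amplitude is below \<open>2 m\<close>, hence below both \<open>d\<close> and
      \<open>\<delta>\<close>.\<close>
    define m where "m = min d \<delta> / 2"
    have m: "m > 0" "m < \<delta>" "2 * m \<le> d" "2 * m \<le> \<delta>" using d delta by (auto simp: m_def)
    have m': "\<bar>m\<bar> < \<delta>" "\<bar>- m\<bar> < \<delta>" using m by auto
    \<comment> \<open>For positive radii this says \<open>H (- m) < 1/r < H m\<close>, that is
      \<open>\<bar>x\<bar> < m\<close>, and \<open>\<bar>y\<bar> < m\<close>; multiplied out, it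
      defines an open set without dividing by \<open>r\<close>.\<close>
    define W where "W = {q :: real \<times> complex \<times> real \<times> real. fst q * H (- m) < 1} \<inter>
      {q. 1 < fst q * H m} \<inter> {q. \<bar>fst (snd (snd q))\<bar> < \<kappa> * m}"
    show "\<exists>W. open W \<and> \<Gamma> \<subseteq> W \<and>
            (\<forall>J r1 \<phi>1 t0.
              trajectory \<xi> V J r1 \<phi>1 \<and> has_angular_momentum \<xi> J r1 \<phi>1 K' \<and>
              t0 \<in> J \<and> phase_point r1 \<phi>1 t0 \<in> W \<longrightarrow>
              {t0..} \<subseteq> J \<and> (\<forall>t\<ge>t0. phase_point r1 \<phi>1 t \<in> U))"
    proof (intro exI[of _ W] conjI allI impI)
      show "open W" unfolding W_def by (intro open_Int open_Collect_less continuous_intros)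
      have "H (- m) < 1 / r0" "1 / r0 < H m" using H_less[of "-m" 0] H_less[of 0 m] m H0 by auto
      then show "\<Gamma> \<subseteq> W" using r0 \<open>\<kappa> > 0\<close> m(1) by (auto simp: W_def \<Gamma>_def field_simps)
    next
      fix J r1 \<phi>1 t0
      assume A: "trajectory \<xi> V J r1 \<phi>1 \<and> has_angular_momentum \<xi> J r1 \<phi>1 K' \<and> t0 \<in> J \<and> phase_point r1 \<phi>1 t0 \<in> W"
      have red: "open J" "is_interval J" "\<And>t. t \<in> J \<Longrightarrow> r1 t > 0"
        "\<And>t. t \<in> J \<Longrightarrow> (r1 has_real_derivative deriv r1 t) (at t)"
        "\<And>t. t \<in> J \<Longrightarrow> (\<phi>1 has_real_derivative K / (\<xi>\<^sup>2 * (r1 t)\<^sup>2)) (at t)"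
        "\<And>t. t \<in> J \<Longrightarrow> (deriv r1 has_real_derivative K\<^sup>2 / (\<xi>\<^sup>2 * (r1 t)^3) - deriv V (r1 t)) (at t)"
        using A reduced_iff[OF xi V, of J r1 \<phi>1 K] by (auto simp: \<open>K' = K\<close> trajectory_def)
      have r1: "r1 t0 > 0" using red(3) A by blast
      have W1: "H (- m) < 1 / r1 t0" "1 / r1 t0 < H m" "\<bar>deriv r1 t0\<bar> < \<kappa> * m"
        using A r1 by (auto simp: W_def phase_point_def field_simps)
      have "\<exists>x\<ge>- m. x \<le> m \<and> H x = 1 / r1 t0"
      proof (rule IVT)
        show "\<forall>x. - m \<le> x \<and> x \<le> m \<longrightarrow> isCont H x" using DERIV_isCont[OF dH] m by auto
      qed (use W1 m in auto)
      then obtain x where x: "- m \<le> x" "x \<le> m" "H x = 1 / r1 t0" by blast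
      then have x: "\<bar>x\<bar> \<le> m" "H x = 1 / r1 t0" by auto
      define y where "y = - deriv r1 t0 / \<kappa>"
      have y: "\<bar>y\<bar> < m" "deriv r1 t0 = - (\<kappa> * y)" using W1(3) \<open>\<kappa> > 0\<close> by (auto simp: y_def field_simps)
      define \<mu> where "\<mu> = sqrt (x\<^sup>2 + y\<^sup>2)"
      have "x\<^sup>2 \<le> m\<^sup>2" "y\<^sup>2 \<le> m\<^sup>2" "m\<^sup>2 > 0"
        using abs_le_square_iff[of x m] abs_le_square_iff[of y m] x(1) y(1) m(1) by simp_all
      then have "x\<^sup>2 + y\<^sup>2 < 4 * m\<^sup>2" by linarith
      then have "x\<^sup>2 + y\<^sup>2 < (2 * m)\<^sup>2" by (simp add: power_mult_distrib)
      then have "\<mu> < sqrt ((2 * m)\<^sup>2)" unfolding \<mu>_def by (rule real_sqrt_less_mono)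
      also have "sqrt ((2 * m)\<^sup>2) = 2 * m" using m(1) by (intro real_sqrt_unique) auto
      finally have "\<mu> < 2 * m" .
      then have mu: "0 \<le> \<mu>" "\<mu> < \<delta>" "\<mu> < d" using m by (auto simp: \<mu>_def)
      \<comment> \<open>Polar coordinates of the initial state; for amplitude 0 any phase will
        do.\<close>
      obtain \<theta>0 where \<theta>0: "x = \<mu> * sin \<theta>0" "y = \<mu> * cos \<theta>0"
      proof (cases "\<mu> = 0")
        case True
        then have "x = 0" "y = 0" by (auto simp: \<mu>_def)
        then show ?thesis using that[of 0] True by simp
      next
        case False
        have "\<mu>\<^sup>2 = x\<^sup>2 + y\<^sup>2" by (simp add: \<mu>_def)
        moreover have "(y / \<mu>)\<^sup>2 + (x / \<mu>)\<^sup>2 = (x\<^sup>2 + y\<^sup>2) / \<mu>\<^sup>2"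
          by (simp add: power_divide add_divide_distrib)
        ultimately have "(y / \<mu>)\<^sup>2 + (x / \<mu>)\<^sup>2 = 1"
          using False by (metis divide_self power_not_zero)
        then obtain s where "y / \<mu> = cos s" "x / \<mu> = sin s" using sincos_total_2pi by blast
        then show ?thesis using that[of s] False by (simp add: field_simps)
      qed
      obtain \<theta> r2 \<phi>2 F where o: "\<And>t. r2 t = 1 / H (\<mu> * sin (\<theta> t))"
        "\<And>t. (r2 has_real_derivative - (sqrt 2 * K / \<xi>\<^sup>2 * \<mu> * cos (\<theta> t))) (at t)"
        "solution \<xi> V UNIV r2 \<phi>2" "has_angular_momentum \<xi> UNIV r2 \<phi>2 K"
        "\<theta> t0 = \<theta>0" "\<phi>2 t0 = \<phi>1 t0"
        by (rule well_orbit[OF mu(1,2), of t0 \<theta>0 "\<phi>1 t0"]) blast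
      have d2: "deriv r2 t = - (\<kappa> * (\<mu> * cos (\<theta> t)))" for t
        using DERIV_imp_deriv[OF o(2)] by (simp add: \<kappa>_def)
      have red2: "r2 t > 0" "(r2 has_real_derivative deriv r2 t) (at t)"
        "(\<phi>2 has_real_derivative K / (\<xi>\<^sup>2 * (r2 t)\<^sup>2)) (at t)"
        "(deriv r2 has_real_derivative K\<^sup>2 / (\<xi>\<^sup>2 * (r2 t)^3) - deriv V (r2 t)) (at t)" for t
        using o(3,4) reduced_iff[OF xi V, of UNIV r2 \<phi>2 K] by auto
      have "t0 \<in> J" using A by blast
      have init: "r1 t0 = r2 t0" "deriv r1 t0 = deriv r2 t0"
        using x(2) y(2) by (simp_all add: o(1,5) d2 \<theta>0[symmetric])
      have r12: "r1 t = r2 t" if "t \<in> J" for t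
        by (rule motion_unique[OF xi V red(2) \<open>t0 \<in> J\<close> that red(3) red2(1) red(4) red2(2) red(6) red2(4) init])
      have "\<exists>c. \<forall>t\<in>J. \<phi>1 t - \<phi>2 t = c"
      proof (rule has_field_derivative_zero_constant)
        show "convex J" using red(2) by (simp add: is_interval_convex_1)
        show "((\<lambda>t. \<phi>1 t - \<phi>2 t) has_real_derivative 0) (at t within J)" if "t \<in> J" for t
          using DERIV_diff[OF red(5)[OF that] red2(3)[of t]] r12[OF that] by (simp add: has_field_derivative_at_within)
      qed
      then obtain c where c: "\<forall>t\<in>J. \<phi>1 t - \<phi>2 t = c" by blast
      have "c = 0" using bspec[OF c \<open>t0 \<in> J\<close>] o(6) by simp
      then have p12: "\<phi>1 t = \<phi>2 t" if "t \<in> J" for t using bspec[OF c that] by simp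
      \<comment> \<open>The well orbit extends the given trajectory to all times, so maximality
        forces the two to coincide.\<close>
      have "\<forall>J' r' \<phi>'. solution \<xi> V J' r' \<phi>' \<and> J \<subseteq> J' \<and> (\<forall>t\<in>J. r' t = r1 t \<and> \<phi>' t = \<phi>1 t) \<longrightarrow> J' = J"
        using A by (simp add: trajectory_def)
      then have "J = UNIV" using o(3) r12 p12 by (metis subset_UNIV)
      then have eq: "r1 = r2" "\<phi>1 = \<phi>2" using r12 p12 by auto
      have dp: "deriv \<phi>2 t = K / (\<xi>\<^sup>2 * (r2 t)\<^sup>2)" for t by (rule DERIV_imp_deriv[OF red2(3)])
      have "phase_point r1 \<phi>1 t = p (cis (\<phi>2 t)) (\<mu> * sin (\<theta> t)) (\<mu> * cos (\<theta> t))" for t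
        by (simp only: phase_point_def eq p_def d2 dp o(1))
      moreover have "(\<mu> * sin s)\<^sup>2 + (\<mu> * cos s)\<^sup>2 < d\<^sup>2" for s
      proof -
        have "(\<mu> * sin s)\<^sup>2 + (\<mu> * cos s)\<^sup>2 = \<mu>\<^sup>2" by (simp add: power_mult_distrib flip: distrib_left)
        also have "\<dots> < d\<^sup>2" using mu by (intro power_strict_mono) auto
        finally show ?thesis .
      qed
      ultimately show "{t0..} \<subseteq> J" "phase_point r1 \<phi>1 t \<in> U" for t
        using \<open>J = UNIV\<close> inU by auto
    qed
  qed
  then show ?thesis using circ r0 unfolding orbitally_stable_def by blast
qed

section \<open>The gravitational and oscillator potentials\<close>

lemma powi_iterated_deriv:
  fixes V :: "real \<Rightarrow> real"
  assumes "\<And>r. r > 0 \<Longrightarrow> V r = c * r powi k + d"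
  shows "\<exists>c k d. \<forall>r>0. (deriv ^^ n) V r = c * r powi k + d"
proof (induction n)
  case 0
  show ?case using assms by auto
next
  case (Suc n)
  then obtain c k d where IH: "\<And>r. r > 0 \<Longrightarrow> (deriv ^^ n) V r = c * r powi k + d" by blast
  have "(deriv ^^ Suc n) V r = (c * of_int k) * r powi (k - 1) + 0" if "r > 0" for r
  proof -
    have "\<forall>\<^sub>F s in nhds r. s \<in> {0<..}" using that by (intro eventually_nhds_in_open) auto
    then have "\<forall>\<^sub>F s in nhds r. (deriv ^^ n) V s = c * s powi k + d"
      by eventually_elim (simp add: IH)
    then have "deriv ((deriv ^^ n) V) r = deriv (\<lambda>s. c * s powi k + d) r" by (rule deriv_cong_ev) simp
    also have "\<dots> = c * of_int k * r powi (k - 1)"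
      using that by (intro DERIV_imp_deriv) (auto intro!: derivative_eq_intros)
    finally show ?thesis by simp
  qed
  then show ?case by blast
qed

lemma bertrand_potential_1: "bertrand_potential 1 A B r = - A / r + B"
  by (simp add: bertrand_potential_def divide_inverse)

lemma bertrand_potential_2: "bertrand_potential 2 A B r = A * r\<^sup>2 / 2 + B"
  by (simp add: bertrand_potential_def)

lemma central_bertrand:
  assumes "i \<in> {1, 2}" and V: "\<And>r. r > 0 \<Longrightarrow> V r = bertrand_potential i A B r"
  shows "central_potential V"
  unfolding central_potential_def
proof (intro allI impI)
  fix n and x :: real assume "x > 0"
  have "V r = ((-1) ^ i * A / real i) * r powi (int i ^ 2 - 2) + B" if "r > 0" for r
    using V[OF that] by (simp add: bertrand_potential_def)
  from powi_iterated_deriv[of V, OF this] obtain c k d where D: "\<And>r. r > 0 \<Longrightarrow> (deriv ^^ n) V r = c * r powi k + d" by blast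
  have "((\<lambda>s. c * s powi k + d) has_real_derivative c * of_int k * x powi (k - 1)) (at x)"
    using \<open>x > 0\<close> by (auto intro!: derivative_eq_intros)
  moreover have "\<forall>\<^sub>F s in nhds x. s \<in> {0<..}" using \<open>x > 0\<close> by (intro eventually_nhds_in_open) auto
  then have ev: "\<forall>\<^sub>F s in nhds x. c * s powi k + d = (deriv ^^ n) V s"
    by eventually_elim (simp add: D)
  ultimately have "((deriv ^^ n) V has_real_derivative c * of_int k * x powi (k - 1)) (at x)"
    using DERIV_cong_ev[OF refl ev refl] by blast
  then show "(deriv ^^ n) V differentiable (at x)" by (auto simp: real_differentiable_def)
qed

lemma deriv_eq_on_pos:
  assumes "\<And>r::real. r > 0 \<Longrightarrow> f r = g r" "r > 0" "(g has_real_derivative D) (at r)"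
  shows "deriv f r = D"
proof -
  have "\<forall>\<^sub>F s in nhds r. s \<in> {0<..}" using assms(2) by (intro eventually_nhds_in_open) auto
  then have "\<forall>\<^sub>F s in nhds r. f s = g s" by eventually_elim (simp add: assms(1))
  then have "deriv f r = deriv g r" by (rule deriv_cong_ev) simp
  then show ?thesis using DERIV_imp_deriv[OF assms(3)] by simp
qed

lemma deriv_gravity:
  assumes "\<And>r. r > 0 \<Longrightarrow> V r = bertrand_potential 1 A B r" "r > 0"
  shows "deriv V r = A / r\<^sup>2"
  by (rule deriv_eq_on_pos[of V "\<lambda>r. - A / r + B"])
    (use assms bertrand_potential_1 in \<open>auto intro!: derivative_eq_intros simp: power2_eq_square\<close>)

lemma deriv_oscillator:
  assumes "\<And>r. r > 0 \<Longrightarrow> V r = bertrand_potential 2 A B r" "r > 0"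
  shows "deriv V r = A * r"
  by (rule deriv_eq_on_pos[of V "\<lambda>r. A * r\<^sup>2 / 2 + B"])
    (use assms bertrand_potential_2 in \<open>auto intro!: derivative_eq_intros\<close>)

lemma stable_radius_bertrand:
  assumes "i \<in> {1, 2}" "A > 0" and V: "\<And>r. r > 0 \<Longrightarrow> V r = bertrand_potential i A B r" and "r > 0"
  shows "stable_radius V r"
  using assms(1)
proof (elim insertE emptyE)
  assume i: "i = 1"
  have V1: "deriv V r = A / r\<^sup>2" if "r > 0" for r using deriv_gravity V that unfolding i by blast
  have "deriv (deriv V) r = - 2 * A / r^3"
    by (rule deriv_eq_on_pos[OF V1 \<open>r > 0\<close>])
      (use \<open>r > 0\<close> in \<open>auto intro!: derivative_eq_intros simp: field_simps eval_nat_numeral\<close>)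
  then have "r * deriv (deriv V) r + 3 * deriv V r = A / r\<^sup>2"
    using V1[OF \<open>r > 0\<close>] \<open>r > 0\<close> by (simp add: field_simps eval_nat_numeral)
  then show ?thesis using V1[OF \<open>r > 0\<close>] \<open>r > 0\<close> \<open>A > 0\<close> by (simp add: stable_radius_def)
next
  assume i: "i = 2"
  have V1: "deriv V r = A * r" if "r > 0" for r using deriv_oscillator V that unfolding i by blast
  have "deriv (deriv V) r = A"
    by (rule deriv_eq_on_pos[OF V1 \<open>r > 0\<close>]) (auto intro!: derivative_eq_intros)
  then show ?thesis using V1[OF \<open>r > 0\<close>] \<open>r > 0\<close> \<open>A > 0\<close> by (simp add: stable_radius_def add_pos_pos)
qed

text \<open>The constants \<open>X\<close>, \<open>Y\<close> form the analogue of the Laplace--Runge--Lenz vector.\<close>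

lemma harmonic_in_angle:
  fixes u w \<phi> :: "real \<Rightarrow> real"
  assumes "n \<noteq> 0" and p: "\<And>t. (\<phi> has_real_derivative p t) (at t)"
    and u: "\<And>t. (u has_real_derivative w t * p t) (at t)"
    and w: "\<And>t. (w has_real_derivative - n\<^sup>2 * u t * p t) (at t)"
  obtains X Y where "\<And>t. u t = X * cos (n * \<phi> t) + Y * sin (n * \<phi> t)"
proof -
  define x where "x t = u t * cos (n * \<phi> t) - w t / n * sin (n * \<phi> t)" for t
  define y where "y t = u t * sin (n * \<phi> t) + w t / n * cos (n * \<phi> t)" for t
  have "(x has_real_derivative 0) (at t)" for t
    unfolding x_def[abs_def] using assms by (auto intro!: derivative_eq_intros p u w simp: field_simps power2_eq_square)
  then have x: "x t = x 0" for t by (intro DERIV_isconst_all) blast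
  have "(y has_real_derivative 0) (at t)" for t
    unfolding y_def[abs_def] using assms by (auto intro!: derivative_eq_intros p u w simp: field_simps power2_eq_square)
  then have y: "y t = y 0" for t by (intro DERIV_isconst_all) blast
  have "u t = x t * cos (n * \<phi> t) + y t * sin (n * \<phi> t)" for t
  proof -
    have "(u t * b - c * a) * b + (u t * a + c * b) * a = u t * (a\<^sup>2 + b\<^sup>2)" for a b c
      by (simp add: algebra_simps power2_eq_square)
    from this[of "cos (n * \<phi> t)" "w t / n" "sin (n * \<phi> t)"] show ?thesis
      by (simp only: x_def y_def sin_cos_squared_add mult_1_right)
  qed
  then show ?thesis using that x y by metis
qed

text \<open>A shift by \<open>q\<close> rotates the coefficient vector \<open>(X, Y)\<close> by the
  angle \<open>n q\<close>. Invariance, tested at \<open>x = 0\<close> and a quarter period later,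
  means that a nonzero vector is fixed, so \<open>cos (n q) = 1\<close>, which no such
  \<open>q\<close> satisfies.\<close>

lemma trig_minimal_period:
  assumes "n > 0" "X \<noteq> 0 \<or> Y \<noteq> 0" "0 < q" "q < 2 * pi / n"
  shows "\<exists>x. X * cos (n * (x + q)) + Y * sin (n * (x + q)) \<noteq> X * cos (n * x) + Y * sin (n * x)"
proof (rule ccontr)
  assume "\<not> ?thesis"
  then have eq: "X * cos (n * (x + q)) + Y * sin (n * (x + q)) = X * cos (n * x) + Y * sin (n * x)" for x by blast
  define c where "c = cos (n * q)"
  define s where "s = sin (n * q)"
  have 1: "X * c + Y * s = X" using eq[of 0] by (simp add: c_def s_def)
  have e: "n * (pi / (2 * n) + q) = pi / 2 + n * q" "n * (pi / (2 * n)) = pi / 2" using \<open>n > 0\<close> by (simp_all add: field_simps)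
  have 2: "- X * s + Y * c = Y" using eq[of "pi / (2 * n)"] unfolding e by (simp add: c_def s_def sin_add cos_add)
  \<comment> \<open>The scalar product of the vector with its rotated copy.\<close>
  have "(X\<^sup>2 + Y\<^sup>2) * c = X * (X * c + Y * s) + Y * (- X * s + Y * c)"
    by (simp add: algebra_simps power2_eq_square)
  then have "(X\<^sup>2 + Y\<^sup>2) * c = X\<^sup>2 + Y\<^sup>2" unfolding 1 2 by (simp add: power2_eq_square)
  moreover have "X\<^sup>2 + Y\<^sup>2 \<noteq> 0" using assms(2) by (simp add: sum_power2_eq_zero_iff)
  ultimately have "cos (n * q) = 1" unfolding c_def using mult_cancel_left2 by blast
  then obtain k :: int where k: "n * q = k * 2 * pi" by (auto simp: cos_one_2pi_int)
  have "0 < n * q" "n * q < 2 * pi" using assms by (auto simp: field_simps)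
  then have "0 < real_of_int k" unfolding k by (simp add: zero_less_mult_iff)
  moreover have "real_of_int k < 1"
  proof (rule ccontr)
    assume "\<not> real_of_int k < 1"
    then have "1 * (2 * pi) \<le> real_of_int k * (2 * pi)" by (intro mult_right_mono) auto
    then show False using \<open>n * q < 2 * pi\<close> k by simp
  qed
  ultimately show False by simp
qed

text \<open>With \<open>\<phi>\<close> as time, \<open>1/r\<close> (Binet's equation) or
  \<open>1/r^2\<close> is a harmonic oscillator about the equilibrium \<open>C\<close>, of frequency
  \<open>\<xi>\<close> or \<open>2 \<xi>\<close>. The \<open>w\<close> of each case is the
  derivative with respect to \<open>\<phi>\<close>.\<close>

lemma bertrand_orbit_equation:
  assumes xi: "\<xi> > 0" and i: "i \<in> {1, 2}"
    and V: "\<And>r. r > 0 \<Longrightarrow> V r = bertrand_potential i A B r"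
    and "K \<noteq> 0" and pos: "\<And>t. r t > 0"
    and dr: "\<And>t. (r has_real_derivative v t) (at t)"
    and dphi: "\<And>t. (\<phi> has_real_derivative K / (\<xi>\<^sup>2 * (r t)\<^sup>2)) (at t)"
    and dv: "\<And>t. (v has_real_derivative K\<^sup>2 / (\<xi>\<^sup>2 * (r t)^3) - deriv V (r t)) (at t)"
  obtains C X Y where
    "\<And>t. 1 / (r t) ^ i = C + (X * cos (real i * \<xi> * \<phi> t) + Y * sin (real i * \<xi> * \<phi> t))"
  using i
proof (elim insertE emptyE)
  assume i: "i = 1"
  have V1: "deriv V r = A / r\<^sup>2" if "r > 0" for r using deriv_gravity V that unfolding i by blast
  \<comment> \<open>The value of \<open>1/r\<close> on the circular orbit with momentum
    \<open>K\<close>.\<close>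
  define C where "C = \<xi>\<^sup>2 * A / K\<^sup>2"
  have u: "((\<lambda>t. 1 / r t - C) has_real_derivative - (\<xi>\<^sup>2 / K) * v t * (K / (\<xi>\<^sup>2 * (r t)\<^sup>2))) (at t)" for t
    using dr[of t] pos[of t] \<open>K \<noteq> 0\<close> xi
    by (auto intro!: derivative_eq_intros simp: field_simps power2_eq_square)
  have w: "((\<lambda>t. - (\<xi>\<^sup>2 / K) * v t) has_real_derivative - \<xi>\<^sup>2 * (1 / r t - C) * (K / (\<xi>\<^sup>2 * (r t)\<^sup>2))) (at t)" for t
  proof -
    have "- (\<xi>\<^sup>2 / K) * (K\<^sup>2 / (\<xi>\<^sup>2 * (r t)^3) - deriv V (r t)) = - \<xi>\<^sup>2 * (1 / r t - C) * (K / (\<xi>\<^sup>2 * (r t)\<^sup>2))"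
      unfolding V1[OF pos] C_def using pos[of t] \<open>K \<noteq> 0\<close> xi by (simp add: field_simps eval_nat_numeral)
    then show ?thesis using DERIV_cmult[OF dv[of t], of "- (\<xi>\<^sup>2 / K)"] by simp
  qed
  obtain X Y where "\<And>t. 1 / r t - C = X * cos (\<xi> * \<phi> t) + Y * sin (\<xi> * \<phi> t)"
    using harmonic_in_angle[OF _ dphi u w] xi by blast
  then show ?thesis using that[of C X Y] by (simp add: i algebra_simps)
next
  assume i: "i = 2"
  have V1: "deriv V r = A * r" if "r > 0" for r using deriv_oscillator V that unfolding i by blast
  have cp: "central_potential V" using central_bertrand[OF _ V] i by auto
  obtain E0 where E0: "\<And>t. (v t)\<^sup>2 / 2 + (V (r t) + K\<^sup>2 / (2 * \<xi>\<^sup>2 * (r t)\<^sup>2)) = E0"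
    by (rule reduced_energy[OF xi cp is_interval_univ pos dr dv]) auto
  define E where "E = E0 - B"
  have E: "(v t)\<^sup>2 / 2 + A * (r t)\<^sup>2 / 2 + K\<^sup>2 / (2 * \<xi>\<^sup>2 * (r t)\<^sup>2) = E" for t
    using E0[of t] V[OF pos[of t]] unfolding i bertrand_potential_2 by (simp add: E_def)
  \<comment> \<open>For the oscillator potential the centre depends on the energy, because energy
    conservation is used to eliminate the squared radial velocity from the second derivative of
    \<open>1/r^2\<close>.\<close>
  define C where "C = E * \<xi>\<^sup>2 / K\<^sup>2"
  have u: "((\<lambda>t. 1 / (r t)\<^sup>2 - C) has_real_derivative - (2 * \<xi>\<^sup>2 / K) * (v t / r t) * (K / (\<xi>\<^sup>2 * (r t)\<^sup>2))) (at t)" for t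
    using dr[of t] pos[of t] \<open>K \<noteq> 0\<close> xi
    by (auto intro!: derivative_eq_intros simp: field_simps eval_nat_numeral)
  have w: "((\<lambda>t. - (2 * \<xi>\<^sup>2 / K) * (v t / r t)) has_real_derivative
      - (2 * \<xi>)\<^sup>2 * (1 / (r t)\<^sup>2 - C) * (K / (\<xi>\<^sup>2 * (r t)\<^sup>2))) (at t)" for t
  proof -
    have "((\<lambda>t. v t / r t) has_real_derivative
        ((K\<^sup>2 / (\<xi>\<^sup>2 * (r t)^3) - deriv V (r t)) * r t - v t * v t) / (r t * r t)) (at t)"
      by (rule DERIV_divide[OF dv dr]) (use pos[of t] in simp)
    from DERIV_cmult[OF this, of "- (2 * \<xi>\<^sup>2 / K)"]
    have 1: "((\<lambda>t. - (2 * \<xi>\<^sup>2 / K) * (v t / r t)) has_real_derivative - (2 * \<xi>\<^sup>2 / K) *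
        (((K\<^sup>2 / (\<xi>\<^sup>2 * (r t)^3) - deriv V (r t)) * r t - v t * v t) / (r t * r t))) (at t)" .
    have vv: "v t * v t = 2 * E - A * (r t)\<^sup>2 - K\<^sup>2 / (\<xi>\<^sup>2 * (r t)\<^sup>2)"
      using E[of t] xi pos[of t] by (simp add: power2_eq_square field_simps)
    have "- (2 * \<xi>\<^sup>2 / K) * (((K\<^sup>2 / (\<xi>\<^sup>2 * (r t)^3) - deriv V (r t)) * r t - v t * v t) / (r t * r t))
      = - (2 * \<xi>)\<^sup>2 * (1 / (r t)\<^sup>2 - C) * (K / (\<xi>\<^sup>2 * (r t)\<^sup>2))"
      unfolding V1[OF pos] C_def vv using pos[of t] \<open>K \<noteq> 0\<close> xi by (simp add: field_simps eval_nat_numeral)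
    with 1 show ?thesis by simp
  qed
  obtain X Y where "\<And>t. 1 / (r t)\<^sup>2 - C = X * cos (2 * \<xi> * \<phi> t) + Y * sin (2 * \<xi> * \<phi> t)"
    using harmonic_in_angle[OF _ dphi u w] xi by auto
  then show ?thesis using that[of C X Y] by (simp add: i algebra_simps)
qed

section \<open>Closedness and minimal period of the orbits\<close>

lemma surj_angle:
  assumes xi: "\<xi> > 0" and "K \<noteq> 0" and pos: "\<And>t. r t > 0" and bd: "\<And>t. r t \<le> R"
    and dphi: "\<And>t. (\<phi> has_real_derivative K / (\<xi>\<^sup>2 * (r t)\<^sup>2)) (at t)"
  shows "surj \<phi>"
proof -
  have "R > 0" using pos[of 0] bd[of 0] by simp
  have ge: "\<bar>K\<bar> / (\<xi>\<^sup>2 * R\<^sup>2) \<le> \<bar>K\<bar> / (\<xi>\<^sup>2 * (r t)\<^sup>2)" for t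
    using pos[of t] bd[of t] xi \<open>R > 0\<close> by (intro divide_left_mono mult_left_mono power_mono mult_pos_pos) auto
  have c: "\<bar>K\<bar> / (\<xi>\<^sup>2 * R\<^sup>2) > 0" using \<open>K \<noteq> 0\<close> xi \<open>R > 0\<close> by simp
  show ?thesis
  proof (cases "K > 0")
    case True
    then show ?thesis using increasing_surj[OF dphi c] ge by simp
  next
    case False
    have "((\<lambda>t. - \<phi> t) has_real_derivative \<bar>K\<bar> / (\<xi>\<^sup>2 * (r t)\<^sup>2)) (at t)" for t
      using DERIV_minus[OF dphi[of t]] False by simp
    from increasing_surj[OF this c ge] have s: "surj (\<lambda>t. - \<phi> t)" .
    show ?thesis
    proof (rule surjI)
      show "\<phi> (inv (\<lambda>t. - \<phi> t) (- x)) = x" for x using surj_f_inv_f[OF s, of "- x"] by simp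
    qed
  qed
qed

text \<open>The inverse of \<open>\<phi>\<close>, time as a function of angle, has the
  \<open>L\<close>-periodic derivative \<open>1/k\<close>, so every advance of the angle by
  \<open>L\<close> takes the same time.\<close>

lemma angle_shift:
  fixes \<phi> k :: "real \<Rightarrow> real"
  assumes d: "\<And>t. (\<phi> has_real_derivative k (\<phi> t)) (at t)" and k: "\<And>x. k x > 0" "\<And>x. k (x + L) = k x"
    and "surj \<phi>" "L > 0"
  obtains T where "T > 0" "\<And>t. \<phi> (t + T) = \<phi> t + L"
proof -
  note diffeo = increasing_diffeo[OF d k(1)]
  define \<psi> where "\<psi> = inv \<phi>"
  have \<phi>\<psi>: "\<phi> (\<psi> x) = x" for x using \<open>surj \<phi>\<close> by (simp add: \<psi>_def surj_f_inv_f)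
  have \<psi>\<phi>: "\<psi> (\<phi> t) = t" for t using diffeo(2) by (simp add: \<psi>_def inv_f_f)
  have d\<psi>: "(\<psi> has_real_derivative inverse (k x)) (at x)" for x
    using diffeo(5)[of "\<psi> x"] by (simp add: \<phi>\<psi> flip: \<psi>_def)
  have "((\<lambda>x. \<psi> (x + L) - \<psi> x) has_real_derivative 0) (at x)" for x
  proof -
    have "((\<lambda>x. \<psi> (x + L)) has_real_derivative inverse (k (x + L)) * 1) (at x)"
      by (rule DERIV_chain2[OF d\<psi>]) (auto intro!: derivative_eq_intros)
    from DERIV_diff[OF this d\<psi>[of x]] show ?thesis by (simp add: k(2))
  qed
  then have c: "\<psi> (x + L) - \<psi> x = \<psi> (0 + L) - \<psi> 0" for x
    by (intro DERIV_isconst_all[of "\<lambda>x. \<psi> (x + L) - \<psi> x"]) blast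
  define T where "T = \<psi> (0 + L) - \<psi> 0"
  have "\<phi> (t + T) = \<phi> t + L" for t
  proof -
    have "\<psi> (\<phi> t + L) = t + T" using c[of "\<phi> t"] by (simp add: \<psi>\<phi> T_def)
    then show ?thesis by (metis \<phi>\<psi>)
  qed
  moreover have "T > 0"
  proof -
    have "\<phi> (0 + T) > \<phi> 0" using calculation[of 0] \<open>L > 0\<close> by simp
    then show ?thesis using diffeo(1) by (simp add: strict_mono_less)
  qed
  ultimately show ?thesis using that by blast
qed

locale bertrand_orbit =
  fixes \<xi> :: real and i :: nat and A B :: real and V :: "real \<Rightarrow> real" and I r \<phi>
  assumes xi: "\<xi> > 0" and i: "i \<in> {1, 2}" and A: "A > 0"
    and V: "\<And>r. r > 0 \<Longrightarrow> V r = bertrand_potential i A B r"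
    and nb: "nonsingular_bounded \<xi> V I r \<phi>"
begin

text \<open>The orbit equation makes the radius a function \<open>g\<close> of the angle. Every real
  number occurs as an angle, so \<open>y > 0\<close> on the whole line and not just along part of
  the orbit.\<close>

lemma shape:
  obtains K g y C X Y where "I = UNIV" "K \<noteq> 0" "surj \<phi>" "\<And>t. r t > 0" "\<And>t. r t = g (\<phi> t)"
    "\<And>t. (\<phi> has_real_derivative K / (\<xi>\<^sup>2 * (r t)\<^sup>2)) (at t)"
    "\<And>x. y x = C + (X * cos (real i * \<xi> * x) + Y * sin (real i * \<xi> * x))"
    "\<And>x. y x > 0" "\<And>x. g x = root i (1 / y x)" "\<And>x. g x > 0"
proof -
  have cp: "central_potential V" using central_bertrand[OF i V] .
  obtain K where I: "I = UNIV" and K: "K \<noteq> 0" and pos: "\<And>t. r t > 0"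
    and red: "\<And>t. (r has_real_derivative deriv r t) (at t)"
     "\<And>t. (\<phi> has_real_derivative K / (\<xi>\<^sup>2 * (r t)\<^sup>2)) (at t)"
     "\<And>t. (deriv r has_real_derivative K\<^sup>2 / (\<xi>\<^sup>2 * (r t)^3) - deriv V (r t)) (at t)"
    using nonsingular_reduced[OF xi cp nb] by blast
  obtain r1 r2 where "orbit UNIV r \<phi> \<subseteq> annulus r1 r2"
    using nb I by (auto simp: nonsingular_bounded_def bounded_motion_def)
  then have "(r t, cis (\<phi> t)) \<in> annulus r1 r2" for t unfolding orbit_def by blast
  then have r2: "r t \<le> r2" for t by (simp add: annulus_def)
  have s: "surj \<phi>" by (rule surj_angle[OF xi K pos r2 red(2)])
  obtain C X Y where y: "\<And>t. 1 / (r t) ^ i = C + (X * cos (real i * \<xi> * \<phi> t) + Y * sin (real i * \<xi> * \<phi> t))"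
    using bertrand_orbit_equation[OF xi i V K pos red] by blast
  define y where "y x = C + (X * cos (real i * \<xi> * x) + Y * sin (real i * \<xi> * x))" for x
  define g where "g x = root i (1 / y x)" for x
  have y\<phi>: "y (\<phi> t) = 1 / (r t) ^ i" for t by (simp add: y_def y)
  have "y x > 0" for x
  proof -
    obtain t where "x = \<phi> t" using s by (metis surjD)
    then show ?thesis using pos[of t] by (simp add: y\<phi>)
  qed
  moreover have "i > 0" using i by auto
  then have "r t = g (\<phi> t)" for t
    using pos[of t] by (simp add: g_def y\<phi> real_root_power_cancel)
  ultimately show ?thesis
    using that[of K g y C X Y] I K s pos red(2) y_def g_def \<open>i > 0\<close> by simp
qed

lemma closed:
  assumes "\<xi> \<in> \<rat>"
  shows "closed_motion I r \<phi>"
proof -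
  obtain K g y C X Y where s: "I = UNIV" "K \<noteq> 0" "surj \<phi>" "\<And>t. r t > 0" "\<And>t. r t = g (\<phi> t)"
    "\<And>t. (\<phi> has_real_derivative K / (\<xi>\<^sup>2 * (r t)\<^sup>2)) (at t)"
    "\<And>x. y x = C + (X * cos (real i * \<xi> * x) + Y * sin (real i * \<xi> * x))"
    "\<And>x. g x = root i (1 / y x)" "\<And>x. g x > 0"
    using shape by metis
  obtain m n :: nat where mn: "n \<noteq> 0" "\<bar>\<xi>\<bar> = real m / real n" using Rats_abs_nat_div_natE[OF assms] by metis
  \<comment> \<open>For \<open>\<xi> = m/n\<close>, \<open>n\<close> full turns change the argument
    \<open>i \<xi> x\<close> by \<open>2 pi i m\<close>, so \<open>L\<close> is a common period of
    the radius function and of \<open>cis\<close>.\<close>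
  define L where "L = 2 * pi * real n"
  have "L > 0" using mn by (simp add: L_def)
  have shift: "real i * \<xi> * (x + L) = real i * \<xi> * x + 2 * pi * of_int (int (i * m))" for x
    using mn xi by (simp add: L_def field_simps)
  have "y (x + L) = y x" for x
  proof -
    have "sin (real i * \<xi> * (x + L)) = sin (real i * \<xi> * x) \<and> cos (real i * \<xi> * (x + L)) = cos (real i * \<xi> * x)"
      unfolding sin_cos_eq_iff using shift by blast
    then show ?thesis by (simp add: s(7))
  qed
  then have gL: "g (x + L) = g x" for x by (simp add: s(8))
  have cisL: "cis (x + L) = cis x" for x
  proof -
    have "\<exists>k::int. x + L = x + 2 * pi * of_int k" by (rule exI[of _ "int n"]) (simp add: L_def)
    then have "sin (x + L) = sin x \<and> cos (x + L) = cos x" unfolding sin_cos_eq_iff .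
    then show ?thesis by (simp add: complex_eq_iff)
  qed
  have "\<exists>T>0. \<forall>t. r (t + T) = r t \<and> cis (\<phi> (t + T)) = cis (\<phi> t)"
  proof (cases "K > 0")
    case True
    obtain T where T: "T > 0" "\<And>t. \<phi> (t + T) = \<phi> t + L"
    proof (rule angle_shift[of \<phi> "\<lambda>x. K / (\<xi>\<^sup>2 * (g x)\<^sup>2)" L])
      show "(\<phi> has_real_derivative K / (\<xi>\<^sup>2 * (g (\<phi> t))\<^sup>2)) (at t)" for t using s(6)[of t] by (simp add: s(5))
      show "K / (\<xi>\<^sup>2 * (g x)\<^sup>2) > 0" for x using True xi s(9)[of x] by simp
    qed (use gL \<open>surj \<phi>\<close> \<open>L > 0\<close> in auto)
    then show ?thesis by (intro exI[of _ T]) (simp add: s(5) gL cisL)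
  next
    case False
    \<comment> \<open>For negative momentum the angle decreases; the shift argument is applied to
      \<open>-\<phi>\<close>.\<close>
    obtain T where T: "T > 0" "\<And>t. - \<phi> (t + T) = - \<phi> t + L"
    proof (rule angle_shift[of "\<lambda>t. - \<phi> t" "\<lambda>x. - K / (\<xi>\<^sup>2 * (g (- x))\<^sup>2)" L])
      show "((\<lambda>t. - \<phi> t) has_real_derivative - K / (\<xi>\<^sup>2 * (g (- (- \<phi> t)))\<^sup>2)) (at t)" for t
        using DERIV_minus[OF s(6)[of t]] by (simp add: s(5))
      show "- K / (\<xi>\<^sup>2 * (g (- x))\<^sup>2) > 0" for x
        using False \<open>K \<noteq> 0\<close> xi s(9)[of "- x"] by (intro divide_pos_pos) auto
      show "- K / (\<xi>\<^sup>2 * (g (- (x + L)))\<^sup>2) = - K / (\<xi>\<^sup>2 * (g (- x))\<^sup>2)" for x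
        using gL[of "- (x + L)"] by simp
      show "surj (\<lambda>t. - \<phi> t)" using \<open>surj \<phi>\<close> by (metis (no_types, lifting) surj_def minus_minus)
    qed (use \<open>L > 0\<close> in auto)
    have \<phi>T: "\<phi> t = \<phi> (t + T) + L" for t using T(2)[of t] by simp
    have "r t = r (t + T)" "cis (\<phi> t) = cis (\<phi> (t + T))" for t
      using gL[of "\<phi> (t + T)"] cisL[of "\<phi> (t + T)"] by (simp_all add: s(5) flip: \<phi>T)
    then show ?thesis using T(1) by (intro exI[of _ T]) simp
  qed
  then show ?thesis by (simp add: closed_motion_def s(1))
qed

text \<open>The root is injective on positive reals, so \<open>g\<close> and the trigonometric sum
  \<open>y\<close> have the same periods; a noncircular orbit makes the amplitude of that sum
  nonzero.\<close>

lemma minimal_period: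
  assumes "\<not> circular I r \<phi>"
  shows "\<exists>g. given_by I r \<phi> g \<and> minimal_positive_period g (2 * pi / (real i * \<xi>))"
proof -
  obtain K g y C X Y where s: "I = UNIV" "K \<noteq> 0" "surj \<phi>" "\<And>t. r t > 0" "\<And>t. r t = g (\<phi> t)"
    "\<And>t. (\<phi> has_real_derivative K / (\<xi>\<^sup>2 * (r t)\<^sup>2)) (at t)"
    "\<And>x. y x = C + (X * cos (real i * \<xi> * x) + Y * sin (real i * \<xi> * x))"
    "\<And>x. y x > 0" "\<And>x. g x = root i (1 / y x)"
    using shape by metis
  define n where "n = real i * \<xi>"
  have "n > 0" using xi i by (auto simp: n_def)
  have "i > 0" using i by auto
  have gy: "g x = g x' \<longleftrightarrow> y x = y x'" for x x' using \<open>i > 0\<close> s(8)[of x] s(8)[of x'] by (simp add: s(9))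
  have "X \<noteq> 0 \<or> Y \<noteq> 0"
  proof (rule ccontr)
    assume "\<not> ?thesis"
    then have "y x = C" for x by (simp add: s(7))
    then have "r t = root i (1 / C)" for t by (simp add: s(5,9))
    then have "circular UNIV r \<phi>"
      using circular_if_const_radius[OF _ s(2) _ xi s(6), of "root i (1 / C)"] s(4) by metis
    with assms s(1) show False by simp
  qed
  have "minimal_positive_period g (2 * pi / n)"
    unfolding minimal_positive_period_def
  proof (intro conjI allI impI)
    show "2 * pi / n > 0" using \<open>n > 0\<close> by simp
    show "g (x + 2 * pi / n) = g x" for x
    proof -
      have "n * (x + 2 * pi / n) = n * x + 2 * pi" using \<open>n > 0\<close> by (simp add: field_simps)
      then show ?thesis unfolding gy s(7) n_def[symmetric] by simp
    qed
    fix q assume q: "0 < q \<and> q < 2 * pi / n"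
    then obtain x where "X * cos (n * (x + q)) + Y * sin (n * (x + q)) \<noteq> X * cos (n * x) + Y * sin (n * x)"
      using trig_minimal_period[OF \<open>n > 0\<close> \<open>X \<noteq> 0 \<or> Y \<noteq> 0\<close>] by blast
    then have "g (x + q) \<noteq> g x" unfolding gy s(7) n_def[symmetric] by simp
    then show "\<not> (\<forall>x. g (x + q) = g x)" by blast
  qed
  moreover have "given_by I r \<phi> g"
  proof -
    have "(\<lambda>t. (\<phi> t, r t)) ` UNIV = (\<lambda>x. (x, g x)) ` range \<phi>" by (simp add: s(5) image_image)
    then show ?thesis using \<open>surj \<phi>\<close> by (simp add: given_by_def s(1))
  qed
  ultimately show ?thesis by (auto simp: n_def)
qed

end

text \<open>At the vertex the gravitational potential tends to minus infinity, and the oscillator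
  tends to \<open>B\<close>, which bounds it below.\<close>

lemma vertex_attracting_bertrand:
  assumes "i \<in> {1, 2}" "A > 0"
  shows "vertex_attracting (bertrand_potential i A B)"
  using assms(1)
proof (elim insertE emptyE)
  assume i: "i = 1"
  have "filterlim (\<lambda>r. - A / r + B) at_bot (at_right 0)"
    using \<open>A > 0\<close> by real_asymp
  then have lim: "((\<lambda>r. ereal (bertrand_potential 1 A B r)) \<longlongrightarrow> - \<infinity>) (at_right 0)"
    unfolding bertrand_potential_1 tendsto_MInfty by (simp add: filterlim_at_bot_dense)
  have "(INF r\<in>{0<..}. ereal (bertrand_potential 1 A B r)) = - \<infinity>"
  proof (rule ccontr)
    define m where "m = (INF r\<in>{0<..}. ereal (bertrand_potential 1 A B r))"
    assume "(INF r\<in>{0<..}. ereal (bertrand_potential 1 A B r)) \<noteq> - \<infinity>"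
    then have "- \<infinity> < m" by (simp add: m_def)
    then have "\<forall>\<^sub>F r in at_right 0. ereal (bertrand_potential 1 A B r) < m"
      using lim by (rule order_tendstoD(2)[rotated])
    moreover have "\<forall>\<^sub>F r in at_right (0::real). r > 0" by (rule eventually_at_right_less)
    ultimately have "\<forall>\<^sub>F r in at_right (0::real). False"
    proof eventually_elim
      case (elim r)
      then have "m \<le> ereal (bertrand_potential 1 A B r)" unfolding m_def by (intro INF_lower) auto
      with elim show ?case by simp
    qed
    then show False by simp
  qed
  with lim show ?thesis by (simp add: vertex_attracting_def i)
next
  assume i: "i = 2"
  have "((\<lambda>r. A * r\<^sup>2 / 2 + B) \<longlongrightarrow> A * 0\<^sup>2 / 2 + B) (at_right 0)" by (intro tendsto_intros) simp
  then have lim: "((\<lambda>r. ereal (bertrand_potential 2 A B r)) \<longlongrightarrow> ereal B) (at_right 0)"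
    by (simp add: bertrand_potential_2)
  have "(INF r\<in>{0<..}. ereal (bertrand_potential 2 A B r)) = ereal B"
  proof (rule antisym)
    show "ereal B \<le> (INF r\<in>{0<..}. ereal (bertrand_potential 2 A B r))"
      using \<open>A > 0\<close> by (intro INF_greatest) (simp add: bertrand_potential_2)
    show "(INF r\<in>{0<..}. ereal (bertrand_potential 2 A B r)) \<le> ereal B"
    proof (rule tendsto_lowerbound[OF lim])
      have "\<forall>\<^sub>F r in at_right (0::real). r > 0" by (rule eventually_at_right_less)
      then show "\<forall>\<^sub>F r in at_right 0. (INF r\<in>{0<..}. ereal (bertrand_potential 2 A B r)) \<le> ereal (bertrand_potential 2 A B r)"
        by eventually_elim (auto intro!: INF_lower)
    qed simp
  qed
  with lim show ?thesis by (simp add: vertex_attracting_def i)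
qed

text \<open>This is the content of "two" in the count up to constants. Differences of the values at
  radii 1, 2 and 4 would give \<open>c A1 = 3 A2\<close> and \<open>c A1 = 24 A2\<close>.\<close>

lemma bertrand_potentials_independent:
  assumes "A1 > 0" "A2 > 0"
  shows "\<not> (\<exists>c d. \<forall>r>0. bertrand_potential 2 A2 B2 r = c * bertrand_potential 1 A1 B1 r + d)"
proof
  assume "\<exists>c d. \<forall>r>0. bertrand_potential 2 A2 B2 r = c * bertrand_potential 1 A1 B1 r + d"
  then obtain c d where "\<And>r. r > 0 \<Longrightarrow> A2 * r\<^sup>2 / 2 + B2 = c * (- A1 / r + B1) + d"
    unfolding bertrand_potential_1 bertrand_potential_2 by blast
  from this[of 1] this[of 2] this[of 4] \<open>A2 > 0\<close> show False by (simp add: algebra_simps)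
qed

section \<open>Closing potentials\<close>

text \<open>Three facts yield all five notions: every nonsingular bounded orbit closes, every circle
  is stable, and a well orbit of positive amplitude around radius 1 is bounded and
  noncircular.\<close>

lemma closing_bertrand:
  assumes xi: "\<xi> > 0" and rat: "\<xi> \<in> \<rat>" and i: "i \<in> {1, 2}" and A: "A > 0"
    and V: "\<And>r. r > 0 \<Longrightarrow> V r = bertrand_potential i A B r"
  shows "closing \<xi> V" "locally_closing \<xi> V" "semilocally_closing \<xi> V"
    "strongly_closing \<xi> V" "weakly_closing \<xi> V"
proof -
  have cp: "central_potential V" using central_bertrand[OF i V] .
  have st: "stable_radius V r" if "r > 0" for r using stable_radius_bertrand[OF i A V that] .
  have all: "closed_motion I r \<phi>" if "nonsingular_bounded \<xi> V I r \<phi>" for I r \<phi>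
    by (rule bertrand_orbit.closed[OF bertrand_orbit.intro[OF xi i A V that] rat])
  have near: "closed_near \<xi> V r" for r
    unfolding closed_near_def using all zero_less_one by blast
  have ex: "\<exists>I r \<phi>. nonsingular_bounded \<xi> V I r \<phi> \<and> \<not> circular I r \<phi>"
  proof -
    obtain \<delta> H h where w: "cone_well \<xi> V 1 (\<xi> * sqrt (1^3 * deriv V 1)) \<delta> H h"
      using cone_well_exists[OF xi cp st[OF zero_less_one]] by metis
    interpret cone_well \<xi> V 1 "\<xi> * sqrt (1^3 * deriv V 1)" \<delta> H h by fact
    have mu: "0 < \<delta> / 2" "0 \<le> \<delta> / 2" "\<delta> / 2 < \<delta>" using delta by auto
    obtain \<theta> r \<phi> F where o: "\<And>t. r t = 1 / H (\<delta> / 2 * sin (\<theta> t))"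
      "solution \<xi> V UNIV r \<phi>" "has_angular_momentum \<xi> UNIV r \<phi> (\<xi> * sqrt (1^3 * deriv V 1))"
      "surj \<theta>"
      by (rule well_orbit[OF mu(2,3)]) blast
    show ?thesis using well_orbit_trajectory[OF mu(1,3) o(1,4,2,3)] by blast
  qed
  have ss: "strongly_stable \<xi> V r" if "r > 0" for r using strongly_stable_iff[OF xi cp] st that by blast
  show "closing \<xi> V" using ex all by (simp add: closing_def cond_ex_def cond_all_def)
  show "locally_closing \<xi> V"
    unfolding locally_closing_def cond_ex_loc_def cond_all_loc_def using near ss[of 1] by auto
  show "semilocally_closing \<xi> V"
    unfolding semilocally_closing_def cond_all_sloc_def cond_all_loc_def using near ex all by blast
  show "strongly_closing \<xi> V"
    unfolding strongly_closing_def cond_all_loc_def using near ss by blast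
  show "weakly_closing \<xi> V"
    unfolding weakly_closing_def cond_all_loc_weak_def
    using near orbitally_stable_if_stable_radius[OF xi cp st] by blast
qed

text \<open>Each notion gives closedness near stable circles; what remains is a stable circle,
  supplied by a noncircular orbit, by strong stability of all circles, or by their orbital
  stability.\<close>

lemma closing_imp_locally_closing:
  assumes xi: "\<xi> > 0" and V: "central_potential V"
    and P: "closing \<xi> V \<or> locally_closing \<xi> V \<or> semilocally_closing \<xi> V \<or> strongly_closing \<xi> V \<or> weakly_closing \<xi> V"
  shows "locally_closing \<xi> V"
proof -
  have ss: "strongly_stable \<xi> V r \<longleftrightarrow> stable_radius V r" for r by (rule strongly_stable_iff[OF xi V])
  have loc: "locally_closing \<xi> V" if "\<exists>r. stable_radius V r" "\<And>r. stable_radius V r \<Longrightarrow> closed_near \<xi> V r"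
    using that by (simp add: locally_closing_def cond_ex_loc_def cond_all_loc_def ss)
  from P consider "closing \<xi> V" | "locally_closing \<xi> V" | "semilocally_closing \<xi> V"
    | "strongly_closing \<xi> V" | "weakly_closing \<xi> V" by blast
  then show ?thesis
  proof cases
    case 1
    then have "closed_near \<xi> V r" for r
      unfolding closing_def cond_all_def closed_near_def using zero_less_one by blast
    moreover have "\<exists>r. stable_radius V r"
      using 1 stable_radius_if_noncircular[OF xi V] by (auto simp: closing_def cond_ex_def)
    ultimately show ?thesis by (intro loc)
  next
    case 3
    then obtain I r \<phi> where "nonsingular_bounded \<xi> V I r \<phi>" "\<not> circular I r \<phi>"
      by (auto simp: semilocally_closing_def)
    then have "\<exists>r. stable_radius V r" by (rule stable_radius_if_noncircular[OF xi V])
    then show ?thesis using 3 ss by (intro loc) (auto simp: semilocally_closing_def cond_all_loc_def)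
  next
    case 4
    then have "\<forall>r>0. stable_radius V r" by (simp add: strongly_closing_def ss)
    then have "\<exists>r. stable_radius V r" using zero_less_one by blast
    then show ?thesis using 4 by (intro loc) (auto simp: strongly_closing_def cond_all_loc_def ss)
  next
    case 5
    then have os: "\<And>r. r > 0 \<Longrightarrow> orbitally_stable \<xi> V r" by (simp add: weakly_closing_def)
    show ?thesis
    proof (rule loc)
      show "\<exists>r. stable_radius V r" by (rule stable_radius_if_weakly_closing[OF xi V os])
      show "closed_near \<xi> V r" if "stable_radius V r" for r
        using 5 os[of r] that by (auto simp: weakly_closing_def cond_all_loc_weak_def stable_radius_def)
    qed
  qed
qed

theorem mainTheorem5:
  fixes \<xi> :: real
  assumes "\<xi> > 0"
  shows
    "(\<xi> \<notin> \<rat> \<longrightarrow>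
       (\<forall>P \<in> {closing \<xi>, locally_closing \<xi>, semilocally_closing \<xi>, strongly_closing \<xi>, weakly_closing \<xi>}.
          \<not> (\<exists>V. central_potential V \<and> P V))) \<and>
     (\<xi> \<in> \<rat> \<longrightarrow>
       (\<forall>P \<in> {closing \<xi>, locally_closing \<xi>, semilocally_closing \<xi>, strongly_closing \<xi>, weakly_closing \<xi>}.
          \<forall>V. central_potential V \<and> P V \<longleftrightarrow>
            (\<exists>i\<in>{1, 2}. \<exists>A>0. \<exists>B. \<forall>r>0. V r = bertrand_potential i A B r)) \<and>
       (\<forall>A1>0. \<forall>A2>0. \<forall>B1 B2. \<not> (\<exists>c d. \<forall>r>0.
          bertrand_potential 2 A2 B2 r = c * bertrand_potential 1 A1 B1 r + d)) \<and>
       (\<forall>i\<in>{1, 2}. \<forall>A>0. \<forall>B.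
          (\<forall>I r \<phi>. nonsingular_bounded \<xi> (bertrand_potential i A B) I r \<phi> \<and> \<not> circular I r \<phi> \<longrightarrow>
             (\<exists>g. given_by I r \<phi> g \<and> minimal_positive_period g (2 * pi / (real i * \<xi>)))) \<and>
          vertex_attracting (bertrand_potential i A B)))"
proof (intro conjI impI)
  let ?S = "{closing \<xi>, locally_closing \<xi>, semilocally_closing \<xi>, strongly_closing \<xi>, weakly_closing \<xi>}"
  \<comment> \<open>Through this reduction the rigidity statement for locally closing potentials
    settles all five notions at once.\<close>
  have loc: "locally_closing \<xi> V" if "P \<in> ?S" "central_potential V" "P V" for P V
    using closing_imp_locally_closing[OF assms that(2)] that(1,3) by auto
  show "\<forall>P\<in>?S. \<not> (\<exists>V. central_potential V \<and> P V)" if "\<xi> \<notin> \<rat>"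
    using locally_closing_rigid(1)[OF assms _ loc] that by blast
  show "\<forall>P\<in>?S. \<forall>V. central_potential V \<and> P V \<longleftrightarrow>
      (\<exists>i\<in>{1, 2}. \<exists>A>0. \<exists>B. \<forall>r>0. V r = bertrand_potential i A B r)" if rat: "\<xi> \<in> \<rat>"
  proof (intro ballI allI iffI)
    fix P V assume P: "P \<in> ?S"
    show "\<exists>i\<in>{1, 2}. \<exists>A>0. \<exists>B. \<forall>r>0. V r = bertrand_potential i A B r" if "central_potential V \<and> P V"
      using locally_closing_rigid(2)[OF assms _ loc[OF P]] that by blast
    assume "\<exists>i\<in>{1, 2}. \<exists>A>0. \<exists>B. \<forall>r>0. V r = bertrand_potential i A B r"
    then obtain i A B where i: "i \<in> {1, 2}" "A > 0" and V: "\<And>r. r > 0 \<Longrightarrow> V r = bertrand_potential i A B r"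
      by blast
    have "central_potential V" by (rule central_bertrand[OF i(1) V])
    moreover have "P V" using P closing_bertrand[OF assms rat i V] by auto
    ultimately show "central_potential V \<and> P V" ..
  qed
  show "\<forall>A1>0. \<forall>A2>0. \<forall>B1 B2. \<not> (\<exists>c d. \<forall>r>0.
      bertrand_potential 2 A2 B2 r = c * bertrand_potential 1 A1 B1 r + d)"
    using bertrand_potentials_independent by blast
  show "\<forall>i\<in>{1, 2}. \<forall>A>0. \<forall>B.
      (\<forall>I r \<phi>. nonsingular_bounded \<xi> (bertrand_potential i A B) I r \<phi> \<and> \<not> circular I r \<phi> \<longrightarrow>
         (\<exists>g. given_by I r \<phi> g \<and> minimal_positive_period g (2 * pi / (real i * \<xi>)))) \<and>
      vertex_attracting (bertrand_potential i A B)"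
  proof (intro ballI allI impI conjI)
    fix i :: nat and A B :: real and I r \<phi>
    assume i: "i \<in> {1, 2}" "A > 0"
    show "vertex_attracting (bertrand_potential i A B)" by (rule vertex_attracting_bertrand[OF i])
    assume "nonsingular_bounded \<xi> (bertrand_potential i A B) I r \<phi> \<and> \<not> circular I r \<phi>"
    then show "\<exists>g. given_by I r \<phi> g \<and> minimal_positive_period g (2 * pi / (real i * \<xi>))"
      using bertrand_orbit.minimal_period[OF bertrand_orbit.intro[OF assms i refl]] by blast
  qed
qed

end
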